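(* Let $d\ge 3$ be an integer. Consider loop percolation on the $d$-regular tree $\mathbb{T}_d$ with intensity $\alpha\ge 0$ and killing parameter $\kappa>-1$, and let $\alpha_c(\kappa)$ be its critical value. Let $\kappa_c=\frac{2\sqrt{d-1}}{d}-1$ and, for $\kappa\ge\kappa_c$, $\tau_\kappa=\frac{d(1+\kappa)-\sqrt{d^2(1+\kappa)^2-4(d-1)}}{2(d-1)}$. Then, for $\kappa>-1$, $\alpha_c(\kappa)>0$ if and only if $\kappa>\kappa_c$. Furthermore, for each $\kappa>\kappa_c$, $\alpha_c(\kappa)$ is the unique solution $\alpha>0$ to the equation $$\sum_{n\ge 0}\Big(\big(1-\tau_\kappa^{2(n+1)}\big)^{-\alpha}-1\Big)(d-1)^n=\frac{1}{d-2}.$$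
   Context: $\mathbb{T}_d$ is the infinite $d$-regular tree with a fixed vertex $0$ (the root). A based loop is a nearest-neighbor path $\dot\ell=(v_1,\dots,v_n)$ on $\mathbb{T}_d$ ($n\ge 2$, consecutive vertices adjacent) with $v_n$ a neighbor of $v_1$. Loops are equivalence classes of based loops modulo cyclic shifts. For $\kappa>-1$, $\dot\mu_\kappa$ is the measure on based loops with $\dot\mu_\kappa(\dot\ell)=\frac1n\big(\frac1{1+\kappa}\big)^n\big(\frac1d\big)^n$ for $\dot\ell=(v_1,\dots,v_n)$, and $\mu_\kappa$ is its pushforward to loops. $\mathcal{L}_{\alpha,\kappa}$ is the Poisson point process of loops with intensity $\alpha\mu_\kappa$, $\alpha\ge 0$, with law $\mathbb{P}_{\alpha,\kappa}$. A loop is open if it occurs at least once in $\mathcal{L}_{\alpha,\kappa}$. Vertices $u,v$ are loop-connected if there are open loops $\ell_1,\dots,\ell_k$ with $u\in\ell_1$, $v\in\ell_k$ and each consecutive pair $\ell_{i-1},\ell_i$ sharing a vertex (a vertex is always loop-connected to itself). $\mathcal{C}(u)$ is the set of vertices loop-connected to $u$. $\theta(\alpha,\kappa)=\mathbb{P}_{\alpha,\kappa}(|\mathcal{C}(0)|=\infty)$ and $\alpha_c(\kappa)=\inf\{\alpha\ge 0:\theta(\alpha,\kappa)>0\}$. *)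

theory Defs
  imports "HOL-Probability.Probability"
begin

section \<open>The infinite regular tree\<close>

text \<open>
  Vertices are words: the empty word is the root, the children of \<open>p\<close> are the words \<open>x # p\<close>, and
  the letters are bounded so that the root has \<open>d\<close> children and every other vertex \<open>d - 1\<close>.
\<close>

inductive_set tree_vertices :: "nat \<Rightarrow> nat list set" for d :: nat where
  root: "[] \<in> tree_vertices d"
| child: "p \<in> tree_vertices d \<Longrightarrow> x < (if p = [] then d else d - 1) \<Longrightarrow> x # p \<in> tree_vertices d"

definition tree_adj :: "nat \<Rightarrow> nat list \<Rightarrow> nat list \<Rightarrow> bool" where
  "tree_adj d u v \<longleftrightarrow>
     u \<in> tree_vertices d \<and> v \<in> tree_vertices d \<and> ((\<exists>x. u = x # v) \<or> (\<exists>x. v = x # u))"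

lemma tree_vertices_Cons_iff:
  "x # p \<in> tree_vertices d \<longleftrightarrow> p \<in> tree_vertices d \<and> x < (if p = [] then d else d - 1)"
  by (auto intro: tree_vertices.intros elim: tree_vertices.cases)

lemma tree_adj_sym: "tree_adj d u v \<Longrightarrow> tree_adj d v u"
  by (auto simp: tree_adj_def)

lemma tree_regular:
  assumes "d \<ge> 1" "v \<in> tree_vertices d"
  shows "card {u. tree_adj d v u} = d"
proof (cases v)
  case Nil
  have "{u. tree_adj d v u} = (\<lambda>x. [x]) ` {..<d}"
    using Nil by (auto simp: tree_adj_def tree_vertices_Cons_iff tree_vertices.root)
  then show ?thesis
    by (simp add: card_image inj_on_def)
next
  case (Cons y p)
  have "{u. tree_adj d v u} = insert p ((\<lambda>x. x # v) ` {..<d-1})"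
    using Cons assms by (auto simp: tree_adj_def tree_vertices_Cons_iff)
  moreover have "p \<notin> (\<lambda>x. x # v) ` {..<d-1}"
    using Cons by (auto dest: arg_cong[of _ _ length])
  ultimately show ?thesis
    using assms by (simp add: card_image inj_on_def)
qed

lemma tree_connected:
  assumes "u \<in> tree_vertices d" "v \<in> tree_vertices d"
  shows "(tree_adj d)\<^sup>*\<^sup>* u v"
proof -
  have *: "(tree_adj d)\<^sup>*\<^sup>* w [] \<and> (tree_adj d)\<^sup>*\<^sup>* [] w" if "w \<in> tree_vertices d" for w
    using that
  proof (induction w)
    case (child w x)
    then have "w \<in> tree_vertices d" "tree_adj d (x # w) w"
      by (auto simp: tree_adj_def tree_vertices_Cons_iff)
    with child show ?case
      by (meson tree_adj_sym converse_rtranclp_into_rtranclp rtranclp.rtrancl_into_rtrancl)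
  qed simp
  from *[OF assms(1)] *[OF assms(2)] show ?thesis
    by (meson rtranclp_trans)
qed

lemma tree_acyclic:
  assumes "length c \<ge> 3" "distinct c" "successively (tree_adj d) c" "tree_adj d (last c) (hd c)"
  shows False
proof -
  define n where "n = length c"
  have n: "n \<ge> 3" and ne: "c \<noteq> []" using assms(1) by (auto simp: n_def)
  have step: "tree_adj d (c ! i) (c ! (Suc i mod n))" if "i < n" for i
  proof (cases "Suc i = n")
    case True
    then have "i = length c - 1" "Suc i mod n = 0"
      by (simp_all add: n_def)
    then have "c ! i = last c" "c ! (Suc i mod n) = hd c"
      using ne by (simp_all add: last_conv_nth hd_conv_nth)
    then show ?thesis
      using assms(4) by simp
  next
    case False
    then show ?thesis
      using that assms(3) by (simp add: successively_conv_nth n_def)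
  qed
  obtain i where i: "i < n" "\<And>j. j < n \<Longrightarrow> length (c ! j) \<le> length (c ! i)"
  proof -
    have "finite ((\<lambda>j. length (c ! j)) ` {..<n})" "(\<lambda>j. length (c ! j)) ` {..<n} \<noteq> {}"
      using n by (auto simp: lessThan_empty_iff)
    from Max_in[OF this] obtain i where "i < n" "length (c ! i) = Max ((\<lambda>j. length (c ! j)) ` {..<n})"
      by auto
    then show thesis by (intro that[of i]) auto
  qed
  have tl: "c ! j = tl (c ! i)" if "j < n" "tree_adj d (c ! i) (c ! j)" for j
    using that i(2)[OF that(1)] by (auto simp: tree_adj_def)
  define k where "k = (if i = 0 then n - 1 else i - 1)"
  have k: "k < n" "Suc k mod n = i" using i n by (auto simp: k_def)
  have "c ! (Suc i mod n) = tl (c ! i)"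
    using step[OF i(1)] n by (intro tl) auto
  moreover have "c ! k = tl (c ! i)"
    using step[OF k(1)] k by (intro tl) (auto intro: tree_adj_sym)
  moreover have "Suc i mod n < n" using n by simp
  ultimately have "Suc i mod n = k"
    using nth_eq_iff_index_eq[OF assms(2), of "Suc i mod n" k] k(1) by (simp add: n_def)
  then show False
    using n i(1) by (cases "Suc i = n") (auto simp: k_def split: if_splits)
qed


section \<open>Loops and the loop measure\<close>

definition based_loops :: "nat \<Rightarrow> nat list list set" where
  "based_loops d = {l. 2 \<le> length l \<and> set l \<subseteq> tree_vertices d \<and>
     successively (tree_adj d) l \<and> tree_adj d (last l) (hd l)}"

definition cyclic_shift :: "nat \<Rightarrow> (nat list list \<times> nat list list) set" where
  "cyclic_shift d = {(l, m). l \<in> based_loops d \<and> (\<exists>k. m = rotate k l)}"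

definition loops :: "nat \<Rightarrow> nat list list set set" where
  "loops d = based_loops d // cyclic_shift d"

definition based_loop_measure :: "nat \<Rightarrow> real \<Rightarrow> nat list list measure" where
  "based_loop_measure d \<kappa> = point_measure (based_loops d)
     (\<lambda>l. ennreal (1 / real (length l) * (1 / (1 + \<kappa>)) ^ length l * (1 / real d) ^ length l))"

definition loop_measure :: "nat \<Rightarrow> real \<Rightarrow> nat list list set measure" where
  "loop_measure d \<kappa> =
     distr (based_loop_measure d \<kappa>) (count_space (loops d)) (\<lambda>l. cyclic_shift d `` {l})"

lemma rotate1_based_loops:
  assumes "l \<in> based_loops d"
  shows "rotate1 l \<in> based_loops d"
proof (cases l)
  case (Cons v m)
  with assms have "m \<noteq> []" by (auto simp: based_loops_def)
  then show ?thesis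
    using assms Cons by (auto simp: based_loops_def successively_append_iff successively_Cons)
qed (use assms in auto)

lemma rotate_based_loops: "l \<in> based_loops d \<Longrightarrow> rotate k l \<in> based_loops d"
  by (induction k) (auto intro: rotate1_based_loops)

lemma equiv_cyclic_shift: "equiv (based_loops d) (cyclic_shift d)"
proof (rule equivI)
  show "cyclic_shift d \<subseteq> based_loops d \<times> based_loops d"
    by (auto simp: cyclic_shift_def rotate_based_loops)
  show "refl_on (based_loops d) (cyclic_shift d)"
    by (auto simp: refl_on_def cyclic_shift_def intro: exI[of _ 0])
  show "sym (cyclic_shift d)"
  proof (rule symI)
    fix l m assume "(l, m) \<in> cyclic_shift d"
    then obtain k where l: "l \<in> based_loops d" and m: "m = rotate k l"
      by (auto simp: cyclic_shift_def)
    have "length l > 0" using l by (auto simp: based_loops_def)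
    then have "k mod length l \<le> length l" by (simp add: less_imp_le)
    then have "rotate (length l - k mod length l) m = l"
      unfolding m by (subst rotate_conv_mod) (simp add: rotate_rotate)
    then show "(m, l) \<in> cyclic_shift d"
      using l m by (auto simp: cyclic_shift_def rotate_based_loops intro!: exI[of _ "length l - k mod length l"])
  qed
  show "trans (cyclic_shift d)"
    by (rule transI) (auto simp: cyclic_shift_def rotate_rotate)
qed

lemma countable_loops: "countable (loops d)"
  unfolding loops_def quotient_def by auto

lemma space_loop_measure: "space (loop_measure d \<kappa>) = loops d"
  by (simp add: loop_measure_def)

lemma sets_loop_measure: "sets (loop_measure d \<kappa>) = Pow (loops d)"
  by (simp add: loop_measure_def)

lemma finite_loop: "c \<in> loops d \<Longrightarrow> finite c"
proof -
  assume "c \<in> loops d"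
  then obtain l where l: "c = {m. \<exists>k. m = rotate k l}" "l \<in> based_loops d"
    by (auto simp: loops_def quotient_def cyclic_shift_def)
  have "c \<subseteq> {m. set m \<subseteq> set l \<and> length m = length l}"
    using l by auto
  then show "finite c"
    using finite_lists_length_eq[of "set l" "length l"] finite_subset by auto
qed

lemma emeasure_loop_measure_singleton:
  assumes "c \<in> loops d"
  shows "emeasure (loop_measure d \<kappa>) {c} =
    (\<Sum>l\<in>c. ennreal (1 / real (length l) * (1 / (1 + \<kappa>)) ^ length l * (1 / real d) ^ length l))"
proof -
  have eq: "(\<lambda>l. cyclic_shift d `` {l}) -` {c} \<inter> based_loops d = c"
  proof -
    have "c \<subseteq> based_loops d"
      using assms in_quotient_imp_subset[OF equiv_cyclic_shift] by (auto simp: loops_def)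
    moreover have "cyclic_shift d `` {l} = c \<longleftrightarrow> l \<in> c" if "l \<in> based_loops d" for l
    proof
      assume "cyclic_shift d `` {l} = c"
      then show "l \<in> c"
        using equiv_class_self[OF equiv_cyclic_shift that] by blast
    next
      assume "l \<in> c"
      obtain a where a: "c = cyclic_shift d `` {a}"
        using assms by (auto simp: loops_def elim: quotientE)
      with \<open>l \<in> c\<close> have "(a, l) \<in> cyclic_shift d" by simp
      then show "cyclic_shift d `` {l} = c"
        using equiv_class_eq[OF equiv_cyclic_shift] a by simp
    qed
    ultimately show ?thesis by auto
  qed
  have sp: "space (based_loop_measure d \<kappa>) = based_loops d"
    by (simp add: based_loop_measure_def space_point_measure)
  have m: "(\<lambda>l. cyclic_shift d `` {l}) \<in> based_loop_measure d \<kappa> \<rightarrow>\<^sub>M count_space (loops d)"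
    by (auto simp: based_loop_measure_def loops_def intro: quotientI)
  have "emeasure (loop_measure d \<kappa>) {c} = emeasure (based_loop_measure d \<kappa>) c"
    unfolding loop_measure_def using assms by (subst emeasure_distr[OF m]) (auto simp: sp eq)
  also have "\<dots> = (\<Sum>l\<in>c. ennreal (1 / real (length l) * (1 / (1 + \<kappa>)) ^ length l * (1 / real d) ^ length l))"
    unfolding based_loop_measure_def
    by (rule emeasure_point_measure_finite2) (use eq finite_loop[OF assms] in auto)
  finally show ?thesis .
qed


section \<open>Poisson point processes on a countable set\<close>

text \<open>The library's \<open>poisson_pmf\<close> is specified for positive rates only.\<close>

definition poisson :: "real \<Rightarrow> nat pmf" where
  "poisson r = (if r = 0 then return_pmf 0 else poisson_pmf r)"

lemma pmf_poisson_nonneg: "r \<ge> 0 \<Longrightarrow> pmf (poisson r) k = r ^ k / fact k * exp (- r)"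
  by (cases k) (auto simp: poisson_def)

text \<open>
  The law of a Poisson point process whose intensity measure \<open>M\<close> lives on a countable discrete
  space and is finite on points: a configuration \<open>\<omega>\<close> gives the multiplicity \<open>\<omega> x\<close> of every point
  \<open>x\<close>.  The lemmas below recover the usual characterisation: the number of points in a set of
  finite intensity is Poisson distributed, it is almost surely infinite in a set of infinite
  intensity, and the numbers of points in disjoint sets are independent.
\<close>

definition poisson_process :: "'a measure \<Rightarrow> ('a \<Rightarrow> nat) measure" where
  "poisson_process M = (\<Pi>\<^sub>M x\<in>space M. measure_pmf (poisson (measure M {x})))"

definition points_in :: "'a set \<Rightarrow> ('a \<Rightarrow> nat) \<Rightarrow> ennreal" where
  "points_in A \<omega> = (\<integral>\<^sup>+x. of_nat (\<omega> x) \<partial>count_space A)"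

lemma points_in_SUP:
  assumes "countable A"
  shows "points_in A \<omega> = (SUP n. of_nat (\<Sum>x | x \<in> A \<and> to_nat_on A x < n. \<omega> x))"
proof -
  let ?F = "\<lambda>n. {x. x \<in> A \<and> to_nat_on A x < n}"
  have fin: "finite (?F n)" for n
  proof -
    have "finite (to_nat_on A ` ?F n)"
      by (rule finite_subset[of _ "{..<n}"]) auto
    moreover have "inj_on (to_nat_on A) (?F n)"
      using inj_on_to_nat_on[OF assms] by (rule inj_on_subset) auto
    ultimately show ?thesis by (rule finite_imageD)
  qed
  have "points_in A \<omega> = (\<integral>\<^sup>+x. (SUP n. of_nat (\<omega> x) * indicator (?F n) x) \<partial>count_space A)"
    unfolding points_in_def
  proof (rule nn_integral_cong)
    fix x assume "x \<in> space (count_space A)"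
    then have x: "x \<in> ?F (Suc (to_nat_on A x))" by auto
    show "of_nat (\<omega> x) = (SUP n. of_nat (\<omega> x) * indicator (?F n) x :: ennreal)"
    proof (rule antisym)
      show "of_nat (\<omega> x) \<le> (SUP n. of_nat (\<omega> x) * indicator (?F n) x :: ennreal)"
        using x by (intro SUP_upper2[of "Suc (to_nat_on A x)"]) auto
      show "(SUP n. of_nat (\<omega> x) * indicator (?F n) x :: ennreal) \<le> of_nat (\<omega> x)"
        by (intro SUP_least) (auto simp: indicator_def)
    qed
  qed
  also have "\<dots> = (SUP n. \<integral>\<^sup>+x. of_nat (\<omega> x) * indicator (?F n) x \<partial>count_space A)"
    by (rule nn_integral_monotone_convergence_SUP)
       (auto simp: incseq_def le_fun_def indicator_def)
  also have "\<dots> = (SUP n. of_nat (\<Sum>x\<in>?F n. \<omega> x))"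
  proof (rule SUP_cong[OF refl])
    fix n
    have "(\<integral>\<^sup>+x. of_nat (\<omega> x) * indicator (?F n) x \<partial>count_space A) =
          (\<Sum>x\<in>?F n. of_nat (\<omega> x) * indicator (?F n) x)"
      by (rule nn_integral_count_space') (use fin in \<open>auto simp: indicator_def\<close>)
    then show "(\<integral>\<^sup>+x. of_nat (\<omega> x) * indicator (?F n) x \<partial>count_space A) = of_nat (\<Sum>x\<in>?F n. \<omega> x)"
      by (simp add: indicator_def)
  qed
  finally show ?thesis .
qed

context
  fixes M :: "'a measure"
  assumes countable: "countable (space M)"
    and sets_eq: "sets M = Pow (space M)"
    and finite_points: "\<And>x. x \<in> space M \<Longrightarrow> emeasure M {x} < \<infinity>"
begin

interpretation P: product_prob_space "\<lambda>x. measure_pmf (poisson (measure M {x}))" "space M"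
  by unfold_locales

interpretation PP: prob_space "poisson_process M"
  unfolding poisson_process_def by (rule P.prob_space_axioms)

lemma prob_space_poisson_process: "prob_space (poisson_process M)"
  by (rule PP.prob_space_axioms)

lemma measurable_multiplicity [measurable]:
  assumes "x \<in> space M"
  shows "(\<lambda>\<omega>. \<omega> x) \<in> poisson_process M \<rightarrow>\<^sub>M count_space UNIV"
proof -
  have "(\<lambda>\<omega>. \<omega> x) \<in> poisson_process M \<rightarrow>\<^sub>M measure_pmf (poisson (measure M {x}))"
    unfolding poisson_process_def using assms by (rule measurable_component_singleton)
  then show ?thesis
    by (simp cong: measurable_cong_sets)
qed

lemma measurable_points_in:
  assumes "A \<subseteq> space M"
  shows "points_in A \<in> borel_measurable (\<Pi>\<^sub>M x\<in>A. measure_pmf (poisson (measure M {x})))"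
proof -
  have "countable A" using assms countable countable_subset by blast
  moreover have [measurable]: "(\<lambda>\<omega>. \<omega> x) \<in> (\<Pi>\<^sub>M x\<in>A. measure_pmf (poisson (measure M {x}))) \<rightarrow>\<^sub>M count_space UNIV"
    if "x \<in> A" for x
    using measurable_component_singleton[OF that, of "\<lambda>x. measure_pmf (poisson (measure M {x}))"]
    by (simp cong: measurable_cong_sets)
  ultimately show ?thesis
    unfolding points_in_SUP[OF \<open>countable A\<close>, abs_def] by (auto simp: of_nat_sum)
qed

lemma indep_multiplicities:
  "PP.indep_vars (\<lambda>x. measure_pmf (poisson (measure M {x}))) (\<lambda>x \<omega>. \<omega> x) (space M)"
proof (cases "space M = {}")
  case True
  then show ?thesis
    by (simp add: PP.indep_vars_def PP.indep_sets_def)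
next
  case False
  show ?thesis
  proof (subst PP.indep_vars_iff_distr_eq_PiM'[OF False])
    let ?R = "\<lambda>x. measure_pmf (poisson (measure M {x}))"
    show "(\<lambda>\<omega>. \<omega> x) \<in> poisson_process M \<rightarrow>\<^sub>M ?R x" if "x \<in> space M" for x
      using measurable_multiplicity[OF that] by (simp cong: measurable_cong_sets)
    have "distr (poisson_process M) (Pi\<^sub>M (space M) ?R) (\<lambda>\<omega>. \<lambda>x\<in>space M. \<omega> x) =
          distr (poisson_process M) (poisson_process M) (\<lambda>\<omega>. \<omega>)"
      by (rule distr_cong) (auto simp: poisson_process_def space_PiM)
    also have "\<dots> = poisson_process M"
      by simp
    also have "\<dots> = Pi\<^sub>M (space M) (\<lambda>x. distr (poisson_process M) (?R x) (\<lambda>\<omega>. \<omega> x))"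
      unfolding poisson_process_def by (rule PiM_cong) (simp_all add: P.PiM_component)
    finally show "distr (poisson_process M) (Pi\<^sub>M (space M) ?R) (\<lambda>\<omega>. \<lambda>x\<in>space M. \<omega> x) =
      Pi\<^sub>M (space M) (\<lambda>x. distr (poisson_process M) (?R x) (\<lambda>\<omega>. \<omega> x))" .
  qed
qed

lemma poisson_process_indep:
  assumes "disjoint_family_on A I" "\<And>i. i \<in> I \<Longrightarrow> A i \<subseteq> space M"
  shows "PP.indep_vars (\<lambda>_. borel) (\<lambda>i. points_in (A i)) I"
proof -
  have "PP.indep_vars (\<lambda>_. borel) (\<lambda>i \<omega>. points_in (A i) (restrict (\<lambda>x. \<omega> x) (A i))) I"
    by (rule PP.indep_vars_compose2[OF PP.indep_vars_restrict[OF indep_multiplicities]])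
       (use assms measurable_points_in in auto)
  moreover have "points_in (A i) (restrict (\<lambda>x. \<omega> x) (A i)) = points_in (A i) \<omega>" for i \<omega>
    unfolding points_in_def by (rule nn_integral_cong) simp
  ultimately show ?thesis by simp
qed

lemma borel_measurable_points_in:
  assumes "A \<subseteq> space M"
  shows "points_in A \<in> borel_measurable (poisson_process M)"
  using poisson_process_indep[of "\<lambda>_. A" "{()}"] assms
  by (auto simp: PP.indep_vars_def disjoint_family_on_def)

lemma points_in_finite: "finite F \<Longrightarrow> points_in F \<omega> = of_nat (\<Sum>x\<in>F. \<omega> x)"
  by (simp add: points_in_def nn_integral_count_space_finite)

lemma poisson_process_finite_set:
  assumes "finite F" "F \<subseteq> space M"
  shows "PP.prob {\<omega> \<in> space (poisson_process M). points_in F \<omega> = of_nat k} =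
         pmf (poisson (measure M F)) k"
  using assms
proof (induction F arbitrary: k rule: finite_induct)
  case empty
  then show ?case
    by (cases "k = 0") (simp_all add: poisson_def PP.prob_space points_in_finite)
next
  case (insert y F)
  let ?Q = "poisson_process M"
  have y: "y \<in> space M" and F: "F \<subseteq> space M" using insert by auto
  have [measurable]: "points_in {y} \<in> borel_measurable ?Q" "points_in F \<in> borel_measurable ?Q"
    using y F by (auto intro: borel_measurable_points_in)
  have one: "PP.prob {\<omega> \<in> space ?Q. points_in {y} \<omega> = of_nat j} = pmf (poisson (measure M {y})) j" for j
    unfolding poisson_process_def
    using P.emeasure_PiM_Collect_single[OF y, of "{j}"]
    by (simp add: measure_def pmf.rep_eq points_in_finite)
  have ind: "PP.prob {\<omega> \<in> space ?Q. points_in {y} \<omega> = of_nat j \<and> points_in F \<omega> = of_nat i} =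
     pmf (poisson (measure M {y})) j * pmf (poisson (measure M F)) i" for i j
  proof -
    have "PP.indep_vars (\<lambda>_. borel) (\<lambda>b. points_in (if b then {y} else F)) UNIV"
      using insert y by (intro poisson_process_indep) (auto simp: disjoint_family_on_def)
    then have "PP.prob (\<Inter>b\<in>UNIV. points_in (if b then {y} else F) -` {of_nat (if b then j else i)} \<inter> space ?Q) =
       (\<Prod>b\<in>UNIV. PP.prob (points_in (if b then {y} else F) -` {of_nat (if b then j else i)} \<inter> space ?Q))"
      by (rule PP.indep_varsD) auto
    moreover have "(\<Inter>b\<in>UNIV. points_in (if b then {y} else F) -` {of_nat (if b then j else i)} \<inter> space ?Q) =
      {\<omega> \<in> space ?Q. points_in {y} \<omega> = of_nat j \<and> points_in F \<omega> = of_nat i}"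
      by (auto simp: UNIV_bool)
    ultimately show ?thesis
      using one[of j] insert.IH[OF F, of i]
      by (simp add: UNIV_bool vimage_def Int_def conj_commute mult.commute)
  qed
  have fm: "emeasure M {y} \<noteq> \<infinity>" "emeasure M F \<noteq> \<infinity>"
  proof -
    show "emeasure M {y} \<noteq> \<infinity>" using finite_points[OF y] by auto
    have "emeasure M F = (\<Sum>x\<in>F. emeasure M {x})"
      using insert.hyps(1) F sets_eq by (intro emeasure_eq_sum_singleton) auto
    moreover have "emeasure M {x} \<noteq> \<infinity>" if "x \<in> F" for x
      using finite_points[of x] F that by auto
    ultimately show "emeasure M F \<noteq> \<infinity>"
      using insert.hyps(1) by auto
  qed
  have add: "measure M (insert y F) = measure M {y} + measure M F"
    using measure_Union[OF fm, of] y F insert.hyps(2) sets_eq by auto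
  have exp_sum: "exp (- measure M F - measure M {y}) = exp (- measure M F) * exp (- measure M {y})"
    by (simp add: mult_exp_exp)
  have "{\<omega> \<in> space ?Q. points_in (insert y F) \<omega> = of_nat k} =
        (\<Union>j\<le>k. {\<omega> \<in> space ?Q. points_in {y} \<omega> = of_nat j \<and> points_in F \<omega> = of_nat (k - j)})"
  proof -
    have "n + m = k \<longleftrightarrow> (\<exists>j\<le>k. n = j \<and> m = k - j)" for n m :: nat by auto
    then show ?thesis
      using insert.hyps unfolding points_in_finite[OF \<open>finite F\<close>]
        points_in_finite[OF finite.insertI[OF \<open>finite F\<close>]] points_in_finite[OF finite.insertI[OF finite.emptyI]]
      by (auto simp del: of_nat_sum of_nat_add)
  qed
  also have "PP.prob \<dots> = (\<Sum>j\<le>k. PP.prob {\<omega> \<in> space ?Q. points_in {y} \<omega> = of_nat j \<and> points_in F \<omega> = of_nat (k - j)})"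
    by (rule PP.finite_measure_finite_Union) (auto simp: disjoint_family_on_def)
  also have "\<dots> = (\<Sum>j\<le>k. pmf (poisson (measure M {y})) j * pmf (poisson (measure M F)) (k - j))"
    by (simp only: ind)
  also have "\<dots> = (\<Sum>j\<le>k. of_nat (k choose j) * measure M {y} ^ j * measure M F ^ (k - j)) *
       (exp (- (measure M {y} + measure M F)) / fact k)"
    unfolding sum_distrib_right
    by (rule sum.cong)
       (simp_all add: pmf_poisson_nonneg binomial_fact exp_sum field_simps)
  also have "\<dots> = pmf (poisson (measure M (insert y F))) k"
    unfolding add by (subst binomial_ring[symmetric]) (simp add: pmf_poisson_nonneg)
  finally show ?case .
qed

lemma poisson_process_cdf:
  fixes A :: "'a set" and k :: nat
  assumes A: "A \<subseteq> space M"
  defines "F \<equiv> \<lambda>n. {x \<in> A. to_nat_on A x < n}"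
  shows "(\<lambda>n. \<Sum>j\<le>k. pmf (poisson (measure M (F n))) j) \<longlonglongrightarrow>
           PP.prob {\<omega> \<in> space (poisson_process M). points_in A \<omega> \<le> of_nat k}"
    and "(\<lambda>n. emeasure M (F n)) \<longlonglongrightarrow> emeasure M A"
    and "emeasure M (F n) < \<infinity>"
proof -
  let ?Q = "poisson_process M"
  have cA: "countable A" using A countable countable_subset by blast
  have fin: "finite (F n)" for n
  proof -
    have "finite (to_nat_on A ` F n)"
      by (rule finite_subset[of _ "{..<n}"]) (auto simp: F_def)
    moreover have "inj_on (to_nat_on A) (F n)"
      using inj_on_to_nat_on[OF cA] by (rule inj_on_subset) (auto simp: F_def)
    ultimately show ?thesis by (rule finite_imageD)
  qed
  have FM: "F n \<subseteq> space M" for n using A by (auto simp: F_def)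
  have [measurable]: "points_in (F n) \<in> borel_measurable ?Q" for n
    by (rule borel_measurable_points_in[OF FM])
  have "(\<Sum>j\<le>k. pmf (poisson (measure M (F n))) j) =
    PP.prob {\<omega> \<in> space ?Q. points_in (F n) \<omega> \<le> of_nat k}" for n
  proof -
    have "{\<omega> \<in> space ?Q. points_in (F n) \<omega> \<le> of_nat k} =
      (\<Union>j\<le>k. {\<omega> \<in> space ?Q. points_in (F n) \<omega> = of_nat j})"
      unfolding points_in_finite[OF fin] by (auto simp: of_nat_le_iff simp del: of_nat_sum)
    then have "PP.prob {\<omega> \<in> space ?Q. points_in (F n) \<omega> \<le> of_nat k} =
      (\<Sum>j\<le>k. PP.prob {\<omega> \<in> space ?Q. points_in (F n) \<omega> = of_nat j})"
      by (simp only:) (rule PP.finite_measure_finite_Union, auto simp: disjoint_family_on_def)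
    then show ?thesis
      using poisson_process_finite_set[OF fin FM] by simp
  qed
  moreover have "(\<lambda>n. PP.prob {\<omega> \<in> space ?Q. points_in (F n) \<omega> \<le> of_nat k}) \<longlonglongrightarrow>
    PP.prob (\<Inter>n. {\<omega> \<in> space ?Q. points_in (F n) \<omega> \<le> of_nat k})"
  proof (rule PP.finite_Lim_measure_decseq)
    have "points_in (F n) \<omega> \<le> points_in (F m) \<omega>" if "n \<le> m" for n m \<omega>
      unfolding points_in_finite[OF fin] of_nat_le_iff
      using that by (intro sum_mono2 fin) (auto simp: F_def)
    then show "decseq (\<lambda>n. {\<omega> \<in> space ?Q. points_in (F n) \<omega> \<le> of_nat k})"
      unfolding decseq_def using order_trans by blast
  qed auto
  moreover have "(\<Inter>n. {\<omega> \<in> space ?Q. points_in (F n) \<omega> \<le> of_nat k}) =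
    {\<omega> \<in> space ?Q. points_in A \<omega> \<le> of_nat k}"
    unfolding points_in_SUP[OF cA] points_in_finite[OF fin]
    by (auto simp: SUP_le_iff F_def simp del: of_nat_sum)
  ultimately show "(\<lambda>n. \<Sum>j\<le>k. pmf (poisson (measure M (F n))) j) \<longlonglongrightarrow>
     PP.prob {\<omega> \<in> space ?Q. points_in A \<omega> \<le> of_nat k}"
    by simp
  have "(\<Union>n. F n) = A" by (auto simp: F_def)
  moreover have "(\<lambda>n. emeasure M (F n)) \<longlonglongrightarrow> emeasure M (\<Union>n. F n)"
    using FM sets_eq by (intro Lim_emeasure_incseq) (auto simp: incseq_def F_def)
  ultimately show "(\<lambda>n. emeasure M (F n)) \<longlonglongrightarrow> emeasure M A"
    by simp
  have "emeasure M (F n) = (\<Sum>x\<in>F n. emeasure M {x})"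
    using fin FM sets_eq by (intro emeasure_eq_sum_singleton) auto
  then show "emeasure M (F n) < \<infinity>"
    using finite_points FM[of n] fin[of n] by (auto simp: less_top)
qed

lemma poisson_process_count:
  assumes A: "A \<subseteq> space M" and fin: "emeasure M A < \<infinity>"
  shows "PP.prob {\<omega> \<in> space (poisson_process M). points_in A \<omega> = of_nat k} =
         pmf (poisson (measure M A)) k"
proof -
  let ?Q = "poisson_process M"
  let ?F = "\<lambda>n. {x \<in> A. to_nat_on A x < n}"
  have [measurable]: "points_in A \<in> borel_measurable ?Q"
    by (rule borel_measurable_points_in[OF A])
  have lim: "(\<lambda>n. measure M (?F n)) \<longlonglongrightarrow> measure M A"
    unfolding measure_def using poisson_process_cdf(2)[OF A] fin by (intro tendsto_enn2real) auto
  have cdf: "PP.prob {\<omega> \<in> space ?Q. points_in A \<omega> \<le> of_nat k} = (\<Sum>j\<le>k. pmf (poisson (measure M A)) j)" for k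
  proof (rule LIMSEQ_unique[OF poisson_process_cdf(1)[OF A]])
    show "(\<lambda>n. \<Sum>j\<le>k. pmf (poisson (measure M (?F n))) j) \<longlonglongrightarrow> (\<Sum>j\<le>k. pmf (poisson (measure M A)) j)"
      using lim by (auto simp: pmf_poisson_nonneg intro!: tendsto_intros)
  qed
  show ?thesis
  proof (cases k)
    case 0
    then show ?thesis using cdf[of 0] by simp
  next
    case (Suc i)
    have cA: "countable A" using A countable countable_subset by blast
    have split: "points_in A \<omega> \<le> of_nat (Suc i) \<longleftrightarrow> points_in A \<omega> \<le> of_nat i \<or> points_in A \<omega> = of_nat (Suc i)" for \<omega>
    proof
      assume le: "points_in A \<omega> \<le> of_nat (Suc i)"
      define g where "g n = (\<Sum>x | x \<in> A \<and> to_nat_on A x < n. \<omega> x)" for n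
      have SUP: "points_in A \<omega> = (SUP n. of_nat (g n))"
        unfolding g_def by (rule points_in_SUP[OF cA])
      show "points_in A \<omega> \<le> of_nat i \<or> points_in A \<omega> = of_nat (Suc i)"
      proof (cases "\<forall>n. g n \<le> i")
        case True
        then have "points_in A \<omega> \<le> of_nat i"
          unfolding SUP by (intro SUP_least) simp
        then show ?thesis ..
      next
        case False
        then obtain n where "Suc i \<le> g n" by (auto simp: not_le Suc_le_eq)
        then have "of_nat (Suc i) \<le> (of_nat (g n) :: ennreal)"
          by (simp only: of_nat_le_iff)
        also have "\<dots> \<le> points_in A \<omega>"
          unfolding SUP by (rule SUP_upper) simp
        finally show ?thesis using le by auto
      qed
    next
      assume "points_in A \<omega> \<le> of_nat i \<or> points_in A \<omega> = of_nat (Suc i)"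
      moreover have "(of_nat i :: ennreal) \<le> of_nat (Suc i)"
        by (simp only: of_nat_le_iff)
      ultimately show "points_in A \<omega> \<le> of_nat (Suc i)"
        by (metis order_trans order_refl)
    qed
    have "PP.prob {\<omega> \<in> space ?Q. points_in A \<omega> \<le> of_nat (Suc i)} =
      PP.prob ({\<omega> \<in> space ?Q. points_in A \<omega> \<le> of_nat i} \<union> {\<omega> \<in> space ?Q. points_in A \<omega> = of_nat (Suc i)})"
      unfolding split by (rule arg_cong[where f = PP.prob]) auto
    also have "\<dots> = PP.prob {\<omega> \<in> space ?Q. points_in A \<omega> \<le> of_nat i} + PP.prob {\<omega> \<in> space ?Q. points_in A \<omega> = of_nat (Suc i)}"
      by (rule PP.finite_measure_Union) (auto simp: of_nat_le_iff simp del: of_nat_Suc)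
    finally show ?thesis
      using Suc unfolding cdf by simp
  qed
qed

lemma poisson_process_infinite:
  assumes A: "A \<subseteq> space M" and inf: "emeasure M A = \<infinity>"
  shows "AE \<omega> in poisson_process M. points_in A \<omega> = \<infinity>"
proof -
  let ?Q = "poisson_process M"
  let ?F = "\<lambda>n. {x \<in> A. to_nat_on A x < n}"
  have [measurable]: "points_in A \<in> borel_measurable ?Q"
    by (rule borel_measurable_points_in[OF A])
  have lim: "filterlim (\<lambda>n. measure M (?F n)) at_top sequentially"
    using poisson_process_cdf(2)[OF A] poisson_process_cdf(3)[OF A] inf
    by (simp add: emeasure_eq_ennreal_measure less_top flip: ennreal_tendsto_top_eq_at_top)
  have "PP.prob {\<omega> \<in> space ?Q. points_in A \<omega> \<le> of_nat k} = 0" for k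
  proof (rule LIMSEQ_unique[OF poisson_process_cdf(1)[OF A]])
    have "((\<lambda>r::real. r ^ j / fact j * exp (- r)) \<longlongrightarrow> 0) at_top" for j
      using tendsto_divide[OF tendsto_power_div_exp_0[of j] tendsto_const[of "fact j"]] by (simp add: exp_minus field_simps)
    from filterlim_compose[OF this lim]
    have "(\<lambda>n. pmf (poisson (measure M (?F n))) j) \<longlonglongrightarrow> 0" for j
      by (simp only: pmf_poisson_nonneg[OF measure_nonneg])
    then have "(\<lambda>n. \<Sum>j\<le>k. pmf (poisson (measure M (?F n))) j) \<longlonglongrightarrow> (\<Sum>j\<le>k. 0)"
      by (rule tendsto_sum)
    then show "(\<lambda>n. \<Sum>j\<le>k. pmf (poisson (measure M (?F n))) j) \<longlonglongrightarrow> 0"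
      by simp
  qed
  then have "AE \<omega> in ?Q. \<not> points_in A \<omega> \<le> of_nat k" for k
    by (intro AE_I[of _ _ "{\<omega> \<in> space ?Q. points_in A \<omega> \<le> of_nat k}"]) (auto simp: PP.emeasure_eq_measure)
  then have "AE \<omega> in ?Q. \<forall>k. \<not> points_in A \<omega> \<le> of_nat k"
    by (simp add: AE_all_countable)
  then show ?thesis
  proof (rule AE_mp[OF _ AE_I2], safe)
    fix \<omega> assume *: "\<forall>k. \<not> points_in A \<omega> \<le> of_nat k"
    show "points_in A \<omega> = \<infinity>"
    proof (rule ccontr)
      assume "points_in A \<omega> \<noteq> \<infinity>"
      then obtain k where "points_in A \<omega> < of_nat k"
        using ennreal_Ex_less_of_nat by (auto simp: less_top)
      with * show False by (meson less_imp_le)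
    qed
  qed
qed

end


section \<open>Loop percolation\<close>

definition loop_soup :: "nat \<Rightarrow> real \<Rightarrow> real \<Rightarrow> (nat list list set \<Rightarrow> nat) measure" where
  "loop_soup d \<alpha> \<kappa> = poisson_process (scale_measure (ennreal \<alpha>) (loop_measure d \<kappa>))"

definition open_loops :: "nat \<Rightarrow> (nat list list set \<Rightarrow> nat) \<Rightarrow> nat list list set set" where
  "open_loops d \<omega> = {c \<in> loops d. 1 \<le> \<omega> c}"

definition loop_vertices :: "nat list list set \<Rightarrow> nat list set" where
  "loop_vertices c = (\<Union>l\<in>c. set l)"

definition loop_connected :: "nat \<Rightarrow> (nat list list set \<Rightarrow> nat) \<Rightarrow> nat list \<Rightarrow> nat list \<Rightarrow> bool" where
  "loop_connected d \<omega> u v \<longleftrightarrow> u = v \<or>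
     (\<exists>cs. cs \<noteq> [] \<and> set cs \<subseteq> open_loops d \<omega> \<and>
        u \<in> loop_vertices (hd cs) \<and> v \<in> loop_vertices (last cs) \<and>
        successively (\<lambda>c c'. loop_vertices c \<inter> loop_vertices c' \<noteq> {}) cs)"

definition cluster :: "nat \<Rightarrow> (nat list list set \<Rightarrow> nat) \<Rightarrow> nat list \<Rightarrow> nat list set" where
  "cluster d \<omega> u = {v \<in> tree_vertices d. loop_connected d \<omega> u v}"

definition percolation_prob :: "nat \<Rightarrow> real \<Rightarrow> real \<Rightarrow> real" where
  "percolation_prob d \<alpha> \<kappa> =
     measure (loop_soup d \<alpha> \<kappa>) {\<omega> \<in> space (loop_soup d \<alpha> \<kappa>). infinite (cluster d \<omega> [])}"

text \<open>The infimum is taken in the extended reals, so that \<open>\<alpha>\<^sub>c = \<infinity>\<close> if there is no percolation.\<close>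

definition alpha_c :: "nat \<Rightarrow> real \<Rightarrow> ereal" where
  "alpha_c d \<kappa> = Inf {ereal \<alpha> | \<alpha>. 0 \<le> \<alpha> \<and> percolation_prob d \<alpha> \<kappa> > 0}"

definition kappa_c :: "nat \<Rightarrow> real" where
  "kappa_c d = 2 * sqrt (real d - 1) / real d - 1"

definition tau :: "nat \<Rightarrow> real \<Rightarrow> real" where
  "tau d \<kappa> = (real d * (1 + \<kappa>) - sqrt ((real d)\<^sup>2 * (1 + \<kappa>)\<^sup>2 - 4 * (real d - 1))) / (2 * (real d - 1))"

text \<open>The loop measure satisfies the assumptions of the lemmas on \<open>poisson_process\<close>.\<close>

lemma loop_intensity:
  fixes d :: nat and \<alpha> \<kappa> :: real
  defines "M \<equiv> scale_measure (ennreal \<alpha>) (loop_measure d \<kappa>)"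
  shows "countable (space M)" "sets M = Pow (space M)" "\<And>c. c \<in> space M \<Longrightarrow> emeasure M {c} < \<infinity>"
proof -
  show "countable (space M)"
    by (simp add: M_def space_scale_measure space_loop_measure countable_loops)
  show "sets M = Pow (space M)"
    by (simp add: M_def space_scale_measure space_loop_measure sets_loop_measure)
  show "emeasure M {c} < \<infinity>" if "c \<in> space M" for c
  proof -
    have c: "c \<in> loops d"
      using that by (simp add: M_def space_scale_measure space_loop_measure)
    have "emeasure (loop_measure d \<kappa>) {c} < \<infinity>"
      unfolding emeasure_loop_measure_singleton[OF c] using finite_loop[OF c] by (auto simp: less_top)
    then show ?thesis
      by (simp add: M_def ennreal_mult_less_top)
  qed
qed

lemma sets_infinite_cluster:
  "{\<omega> \<in> space (loop_soup d \<alpha> \<kappa>). infinite (cluster d \<omega> u)} \<in> sets (loop_soup d \<alpha> \<kappa>)"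
proof -
  let ?Q = "loop_soup d \<alpha> \<kappa>"
  have coord [measurable]: "(\<lambda>\<omega>. \<omega> c) \<in> ?Q \<rightarrow>\<^sub>M count_space UNIV" if "c \<in> loops d" for c
    unfolding loop_soup_def using that
    by (intro measurable_multiplicity loop_intensity) (simp_all add: space_scale_measure space_loop_measure)
  have conn [measurable]: "Measurable.pred ?Q (\<lambda>\<omega>. loop_connected d \<omega> u v)" for v
  proof -
    define S where "S = {cs \<in> lists (loops d). cs \<noteq> [] \<and> u \<in> loop_vertices (hd cs) \<and>
      v \<in> loop_vertices (last cs) \<and> successively (\<lambda>c c'. loop_vertices c \<inter> loop_vertices c' \<noteq> {}) cs}"
    have "countable S"
      unfolding S_def by (rule countable_subset[OF _ countable_lists[OF countable_loops[of d]]]) auto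
    have "{\<omega> \<in> space ?Q. \<forall>c\<in>set cs. 1 \<le> \<omega> c} \<in> sets ?Q" if "cs \<in> S" for cs
    proof (rule sets.sets_Collect_finite_All')
      show "{\<omega> \<in> space ?Q. 1 \<le> \<omega> c} \<in> sets ?Q" if "c \<in> set cs" for c
      proof -
        have [measurable]: "(\<lambda>\<omega>. \<omega> c) \<in> ?Q \<rightarrow>\<^sub>M count_space UNIV"
          using that \<open>cs \<in> S\<close> by (intro coord) (auto simp: S_def)
        show ?thesis by measurable
      qed
      show "set cs \<noteq> {}"
        using \<open>cs \<in> S\<close> by (auto simp: S_def)
    qed simp
    then have "(\<Union>cs\<in>S. {\<omega> \<in> space ?Q. \<forall>c\<in>set cs. 1 \<le> \<omega> c}) \<in> sets ?Q"
      by (intro sets.countable_UN'' \<open>countable S\<close>)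
    moreover have "{\<omega> \<in> space ?Q. loop_connected d \<omega> u v} =
      (if u = v then space ?Q else (\<Union>cs\<in>S. {\<omega> \<in> space ?Q. \<forall>c\<in>set cs. 1 \<le> \<omega> c}))"
      unfolding loop_connected_def S_def open_loops_def by auto
    ultimately show ?thesis
      unfolding pred_def by auto
  qed
  have "infinite (cluster d \<omega> u) \<longleftrightarrow>
    (\<forall>n. \<exists>v. v \<in> tree_vertices d \<and> n \<le> to_nat v \<and> loop_connected d \<omega> u v)" for \<omega>
  proof -
    have "infinite (cluster d \<omega> u) \<longleftrightarrow> infinite (to_nat ` cluster d \<omega> u)"
      by (simp add: finite_image_iff inj_on_def)
    also have "\<dots> \<longleftrightarrow> (\<forall>n. \<exists>m\<ge>n. m \<in> to_nat ` cluster d \<omega> u)"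
      by (rule infinite_nat_iff_unbounded_le)
    also have "\<dots> \<longleftrightarrow> (\<forall>n. \<exists>v. v \<in> tree_vertices d \<and> n \<le> to_nat v \<and> loop_connected d \<omega> u v)"
      by (simp add: cluster_def image_iff) metis
    finally show ?thesis .
  qed
  then show ?thesis
    by simp
qed

end

theory Submission
  imports Defs "HOL-Library.Sublist"
begin

text \<open>
  Because the graph is a tree, the cluster of the root consists of the vertices all of whose edges
  towards the root are covered by some open loop.  A walk decomposition with first-return generating
  functions gives the mass of the loops crossing an edge, hence the probability that it is not
  covered.  Decomposing a path at its last uncovered edge yields a renewal equation: if \<open>p n\<close> is the
  probability that a vertex is connected to a given descendant \<open>n\<close> generations below by loops inside
  its subtree, then \<open>(\<Sum>k\<le>n. u k * p (n - k)) = 1\<close> with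
  \<open>u k = (1 - \<tau>\<^bsup>2\<^esup>)\<^bsup>\<alpha>\<^esup> (1 - \<tau>\<^bsup>2(k+1)\<^esup>)\<^bsup>-\<alpha>\<^esup>\<close>.
  With \<open>D(s) = (\<Sum>k. ((1 - \<tau>\<^bsup>2(k+1)\<^esup>)\<^bsup>-\<alpha>\<^esup> - 1) s\<^bsup>k\<^esup>)\<close>
  the generating function of \<open>p\<close> is a multiple of \<open>1 / (1 - (s - 1) D(s))\<close>.  If
  \<open>(d - 2) D(d - 1) < 1\<close>, the expected number of vertices at distance \<open>n\<close> connected to the root tends
  to \<open>0\<close>.  If it exceeds \<open>1\<close>, then \<open>(d - 1)\<^bsup>n\<^esup> p n > 1\<close> for some \<open>n\<close>, and since disjoint subtrees
  use disjoint sets of loops, a supercritical Galton--Watson process embeds into the cluster.  For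
  \<open>\<kappa> < \<kappa>\<^sub>c\<close> the loops crossing any given edge have infinite mass, so every edge is covered.
\<close>

section \<open>Weighted sums over closed walks\<close>

text \<open>One long loop covers many edges, so coverings of different edges are correlated. The
  correlation is broken at an uncovered edge: if the edge above \<open>u\<close> is uncovered, every
  open loop meeting the subtree of \<open>u\<close> stays inside it, and those loops are independent
  of the loops crossing the edge. This is why \<open>p n\<close> allows only loops inside a subtree
  and why the last uncovered edge regenerates. The kernel is a void probability. Inside the subtree
  of a non-root vertex, the loops crossing the edge between depths k - 1 and k have mass - ln ((1 -
  tau^2) / (1 - tau^(2(k+1)))), and exp (- alpha * mass) is \<open>u k\<close>. At the root the
  extra child compensates for the missing parent: every edge is uncovered with the same probability
  (1 - tau^2)^alpha, and the equation becomes a delayed renewal equation. The argument s = d - 1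
  enters because (d - 1)^n p n is the mean offspring number of a block of n levels. At kappa_c one
  has (d - 1) tau^2 = 1, so D(d - 1) diverges for every alpha > 0; this puts the borderline value on
  the side of zero critical intensity.\<close>

definition wsum :: "ennreal \<Rightarrow> 'a list set \<Rightarrow> ennreal" where
  "wsum w A = emeasure (density (count_space UNIV) (\<lambda>l. w ^ length l)) A"

lemma wsum_eq_nn_integral: "wsum w A = (\<integral>\<^sup>+l. w ^ length l \<partial>count_space A)"
  unfolding wsum_def
  by (subst emeasure_density) (auto simp: nn_integral_count_space_indicator)

lemma wsum_finite: "finite A \<Longrightarrow> wsum w A = (\<Sum>l\<in>A. w ^ length l)"
  by (simp add: wsum_eq_nn_integral nn_integral_count_space_finite)

text \<open>Since \<open>wsum\<close> is the \<open>emeasure\<close> of a density, this and the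
  following bounds are instances of general facts about measures, without convergence
  conditions.\<close>

lemma wsum_mono: "A \<subseteq> B \<Longrightarrow> wsum w A \<le> wsum w B"
  unfolding wsum_def by (rule emeasure_mono) auto

lemma wsum_Un_le: "wsum w (A \<union> B) \<le> wsum w A + wsum w B"
  unfolding wsum_def by (rule emeasure_subadditive) auto

lemma wsum_UN_disjoint:
  "finite I \<Longrightarrow> disjoint_family_on A I \<Longrightarrow> wsum w (\<Union>i\<in>I. A i) = (\<Sum>i\<in>I. wsum w (A i))"
  unfolding wsum_def by (rule sum_emeasure[symmetric]) auto

lemma wsum_UN_le: "finite I \<Longrightarrow> wsum w (\<Union>i\<in>I. A i) \<le> (\<Sum>i\<in>I. wsum w (A i))"
  unfolding wsum_def by (rule emeasure_subadditive_finite) auto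

lemma wsum_UN_nat: "disjoint_family A \<Longrightarrow> wsum w (\<Union>i::nat. A i) = (\<Sum>i. wsum w (A i))"
  unfolding wsum_def by (rule suminf_emeasure[symmetric]) auto

text \<open>Truncation makes induction on the length available for sums that are not known to be
  finite, as in \<open>green_le\<close>.\<close>

lemma wsum_SUP_length: "wsum w A = (SUP N. wsum w {l \<in> A. length l \<le> N})"
proof -
  have "A = (\<Union>N. {l \<in> A. length l \<le> N})" by auto
  then show ?thesis
    unfolding wsum_def by (subst SUP_emeasure_incseq) (auto simp: incseq_def)
qed

lemma wsum_image:
  assumes "inj_on g A" "\<And>l. l \<in> A \<Longrightarrow> length (g l) = k + length l"
  shows "wsum w (g ` A) = w ^ k * wsum w A"
proof -
  have "wsum w (g ` A) = (\<integral>\<^sup>+l. w ^ length (g l) \<partial>count_space A)"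
    unfolding wsum_eq_nn_integral
    by (rule nn_integral_bij_count_space[symmetric]) (use assms in \<open>auto simp: bij_betw_def\<close>)
  also have "\<dots> = (\<integral>\<^sup>+l. w ^ k * w ^ length l \<partial>count_space A)"
    by (rule nn_integral_cong) (simp add: assms power_add)
  also have "\<dots> = w ^ k * wsum w A"
    by (simp add: nn_integral_cmult wsum_eq_nn_integral)
  finally show ?thesis .
qed

lemma nn_integral_count_space_times:
  fixes f :: "'a \<Rightarrow> ennreal" and g :: "'b \<Rightarrow> ennreal"
  shows "(\<integral>\<^sup>+p. f (fst p) * g (snd p) \<partial>count_space (A \<times> B)) =
    (\<integral>\<^sup>+a. f a \<partial>count_space A) * (\<integral>\<^sup>+b. g b \<partial>count_space B)"
proof -
  have "(\<integral>\<^sup>+p. f (fst p) * g (snd p) \<partial>count_space (A \<times> B)) =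
    (\<integral>\<^sup>+p. (f (fst p) * indicator A (fst p)) * (g (snd p) * indicator B (snd p)) \<partial>count_space UNIV)"
    by (subst nn_integral_count_space_indicator) (auto simp: indicator_def intro!: nn_integral_cong)
  also have "\<dots> = (\<integral>\<^sup>+a. \<integral>\<^sup>+b. (f a * indicator A a) * (g b * indicator B b) \<partial>count_space UNIV \<partial>count_space UNIV)"
    by (subst nn_integral_fst_count_space[symmetric]) simp
  also have "\<dots> = (\<integral>\<^sup>+a. f a \<partial>count_space A) * (\<integral>\<^sup>+b. g b \<partial>count_space B)"
    by (simp add: nn_integral_cmult nn_integral_multc nn_integral_count_space_indicator[where X=A]
        nn_integral_count_space_indicator[where X=B])
  finally show ?thesis .
qed

lemma wsum_image2:
  assumes "inj_on g (A \<times> B)" "\<And>a b. a \<in> A \<Longrightarrow> b \<in> B \<Longrightarrow> length (g (a, b)) = k + length a + length b"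
  shows "wsum w (g ` (A \<times> B)) = w ^ k * wsum w A * wsum w B"
proof -
  have "wsum w (g ` (A \<times> B)) = (\<integral>\<^sup>+p. w ^ length (g p) \<partial>count_space (A \<times> B))"
    unfolding wsum_eq_nn_integral
    by (rule nn_integral_bij_count_space[symmetric]) (use assms in \<open>auto simp: bij_betw_def\<close>)
  also have "\<dots> = (\<integral>\<^sup>+p. w ^ k * w ^ length (fst p) * w ^ length (snd p) \<partial>count_space (A \<times> B))"
    by (rule nn_integral_cong) (auto simp: assms power_add)
  also have "\<dots> = w ^ k * wsum w A * wsum w B"
    using nn_integral_count_space_times[where f = "\<lambda>a. w ^ k * w ^ length a" and A = A and g = "\<lambda>b. w ^ length b" and B = B]
    by (simp add: nn_integral_cmult wsum_eq_nn_integral)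
  finally show ?thesis .
qed

text \<open>Upper bounds for concatenated walks need no unique decomposition: overcounting only
  enlarges the right-hand side.\<close>

lemma wsum_image2_le:
  assumes "\<And>a b. a \<in> A \<Longrightarrow> b \<in> B \<Longrightarrow> length (g (a, b)) = k + length a + length b"
  shows "wsum w (g ` (A \<times> B)) \<le> w ^ k * wsum w A * wsum w B"
proof -
  \<comment> \<open>\<open>U\<close> picks one preimage for each element of the image, so the sum
    over the image runs over a part of the product.\<close>
  obtain U where U: "U \<subseteq> A \<times> B" "inj_on g U" "g ` (A \<times> B) = g ` U"
    using subset_image_inj[of "g ` (A \<times> B)" g "A \<times> B"] by auto
  have "wsum w (g ` (A \<times> B)) = (\<integral>\<^sup>+p. w ^ length (g p) \<partial>count_space U)"
    unfolding wsum_eq_nn_integral U(3)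
    by (rule nn_integral_bij_count_space[symmetric]) (use U in \<open>auto simp: bij_betw_def\<close>)
  also have "\<dots> \<le> (\<integral>\<^sup>+p. w ^ length (g p) \<partial>count_space (A \<times> B))"
    using U(1) by (auto simp: nn_integral_count_space_indicator indicator_def intro!: nn_integral_mono)
  also have "\<dots> = (\<integral>\<^sup>+p. w ^ k * w ^ length (fst p) * w ^ length (snd p) \<partial>count_space (A \<times> B))"
    by (rule nn_integral_cong) (auto simp: assms power_add)
  also have "\<dots> = w ^ k * wsum w A * wsum w B"
    using nn_integral_count_space_times[where f = "\<lambda>a. w ^ k * w ^ length a" and A = A and g = "\<lambda>b. w ^ length b" and B = B]
    by (simp add: nn_integral_cmult wsum_eq_nn_integral)
  finally show ?thesis .
qed

section \<open>First-return decomposition of closed walks\<close>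

definition cwalks :: "('a \<Rightarrow> 'a \<Rightarrow> bool) \<Rightarrow> 'a set \<Rightarrow> 'a \<Rightarrow> 'a list set" where
  "cwalks E S x = {l. set l \<subseteq> S \<and> hd (l @ [x]) = x \<and> successively E (l @ [x])}"

text \<open>Here, as in \<open>cwalks\<close>, the final return to \<open>x\<close> is not listed:
  \<open>length\<close> counts steps and closed walks concatenate by \<open>@\<close>. An excursion
  meets \<open>x\<close> only at its two ends.\<close>

definition excursions :: "('a \<Rightarrow> 'a \<Rightarrow> bool) \<Rightarrow> 'a set \<Rightarrow> 'a \<Rightarrow> 'a list set" where
  "excursions E S x = {x # m | m. x \<notin> set m \<and> set m \<subseteq> S \<and> successively E (x # m @ [x])}"

lemma Nil_in_cwalks [simp]: "[] \<in> cwalks E S x"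
  by (simp add: cwalks_def)

lemma successively_append_Cons:
  "successively E (a @ x # b) \<longleftrightarrow> successively E (a @ [x]) \<and> successively E (x # b)"
  by (auto simp: successively_append_iff successively_Cons)

lemma cwalks_count_Suc:
  assumes "x \<in> S"
  shows "{l \<in> cwalks E S x. count_list l x = Suc j} =
    (\<lambda>(e, l). e @ l) ` (excursions E S x \<times> {l \<in> cwalks E S x. count_list l x = j})" (is "?L = ?R")
proof
  show "?L \<subseteq> ?R"
  proof
    fix l assume l: "l \<in> ?L"
    then have "l \<noteq> []" by auto
    with l obtain t where t: "l = x # t" by (cases l) (auto simp: cwalks_def)
    \<comment> \<open>The second visit to \<open>x\<close> ends the first excursion. If there is
      none, \<open>r\<close> is empty and the closing \<open>x\<close> is the return.\<close>
    define m where "m = takeWhile (\<lambda>y. y \<noteq> x) t"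
    define r where "r = dropWhile (\<lambda>y. y \<noteq> x) t"
    have mr: "t = m @ r" by (simp add: m_def r_def)
    have hr: "hd (r @ [x]) = x"
      using hd_dropWhile[of "\<lambda>y. y \<noteq> x" t] by (cases "r = []") (auto simp: r_def hd_append)
    have xm: "x \<notin> set m" by (auto simp: m_def dest: set_takeWhileD)
    obtain r' where r': "r @ [x] = x # r'"
      using hr by (cases r) auto
    have "successively E (x # m @ r @ [x])" using l t mr by (auto simp: cwalks_def)
    then have "successively E ((x # m) @ x # r')" by (simp add: r')
    then have s: "successively E (x # m @ [x])" "successively E (r @ [x])"
      using successively_append_Cons[of E "x # m" x r'] r' by auto
    have "set m \<subseteq> S" "set r \<subseteq> S" using l t mr by (auto simp: cwalks_def)
    then have "x # m \<in> excursions E S x" "r \<in> cwalks E S x"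
      using s xm hr by (auto simp: excursions_def cwalks_def)
    moreover have "count_list r x = j" using l t mr xm by (simp add: count_list_append)
    ultimately show "l \<in> ?R"
      using t mr by (intro image_eqI[of _ _ "(x # m, r)"]) auto
  qed
  show "?R \<subseteq> ?L"
  proof safe
    fix e l assume e: "e \<in> excursions E S x" and l: "l \<in> cwalks E S x"
    then obtain m where m: "e = x # m" "x \<notin> set m" "set m \<subseteq> S" "successively E (x # m @ [x])"
      by (auto simp: excursions_def)
    obtain r' where r': "l @ [x] = x # r'"
      using l by (cases l) (auto simp: cwalks_def)
    have "successively E ((x # m) @ l @ [x])"
      using m l successively_append_Cons[of E "x # m" x r'] by (auto simp: cwalks_def r')
    then show "e @ l \<in> cwalks E S x"
      using m l assms by (auto simp: cwalks_def)
    show "count_list (e @ l) x = Suc (count_list l x)"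
      using m by (simp add: count_list_append)
  qed
qed

text \<open>The excursion is read off the concatenation: it stops just before the next occurrence of
  \<open>x\<close>, or at the end of the list.\<close>

lemma inj_on_append_excursions:
  "inj_on (\<lambda>(e, l). e @ l) (excursions E S x \<times> cwalks E S x)"
proof (rule inj_onI, clarify)
  fix e l e' l'
  assume *: "e \<in> excursions E S x" "l \<in> cwalks E S x" "e' \<in> excursions E S x" "l' \<in> cwalks E S x"
    and eq: "e @ l = e' @ l'"
  have tw: "takeWhile (\<lambda>y. y \<noteq> x) (tl (e @ l)) = tl e \<and> e = x # tl e"
    if "e \<in> excursions E S x" "l \<in> cwalks E S x" for e l
  proof -
    from that(1) obtain m where m: "e = x # m" "x \<notin> set m"
      by (auto simp: excursions_def)
    have "takeWhile (\<lambda>y. y \<noteq> x) l = []"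
      using that(2) by (cases l) (auto simp: cwalks_def)
    moreover have "takeWhile (\<lambda>y. y \<noteq> x) (m @ l) = m @ takeWhile (\<lambda>y. y \<noteq> x) l"
      using m(2) by (intro takeWhile_append2) auto
    ultimately show ?thesis using m by simp
  qed
  have "tl e = tl e'"
    using tw[OF *(1,2)] tw[OF *(3,4)] eq by simp
  then have "e = e'" using tw[OF *(1,2)] tw[OF *(3,4)] by metis
  with eq show "e = e' \<and> l = l'" by simp
qed

lemma wsum_cwalks_count:
  assumes "x \<in> S"
  shows "wsum w {l \<in> cwalks E S x. count_list l x = j} = wsum w (excursions E S x) ^ j"
proof (induction j)
  case 0
  have "l = []" if "l \<in> cwalks E S x" "count_list l x = 0" for l
    using that by (cases l) (auto simp: cwalks_def)
  then have "{l \<in> cwalks E S x. count_list l x = 0} = {[]}"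
    by auto
  then show ?case by (simp add: wsum_finite)
next
  case (Suc j)
  have "inj_on (\<lambda>(e, l). e @ l) (excursions E S x \<times> {l \<in> cwalks E S x. count_list l x = j})"
    by (rule inj_on_subset[OF inj_on_append_excursions]) auto
  then show ?case
    unfolding cwalks_count_Suc[OF assms]
    by (subst wsum_image2[where k = 0]) (auto simp: Suc)
qed

text \<open>Sorting by the number of visits to \<open>x\<close> gives a geometric series. In this
  undivided form the equation holds for infinite values as well.\<close>

lemma wsum_cwalks:
  assumes "x \<in> S"
  shows "wsum w (cwalks E S x) = 1 + wsum w (excursions E S x) * wsum w (cwalks E S x)"
proof -
  let ?A = "\<lambda>j. {l \<in> cwalks E S x. count_list l x = j}"
  have "cwalks E S x = (\<Union>j. ?A j)" by auto
  moreover have "disjoint_family ?A" by (auto simp: disjoint_family_on_def)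
  ultimately have eq: "wsum w (cwalks E S x) = (\<Sum>j. wsum w (excursions E S x) ^ j)"
    by (metis (no_types, lifting) suminf_cong wsum_UN_nat wsum_cwalks_count[OF assms])
  show ?thesis
    unfolding eq
    by (subst suminf_offset[where i = 1, of "\<lambda>j. _ ^ j"]) (auto simp: ennreal_suminf_cmult)
qed

section \<open>Closed walks on the tree\<close>

text \<open>The neighbour of \<open>u\<close> through which the path from \<open>u\<close> to
  \<open>a\<close> leaves: a child of \<open>u\<close> if \<open>a\<close> is strictly below
  \<open>u\<close>, and the parent if \<open>a\<close> is not in the subtree of \<open>u\<close>. By
  truncated subtraction the value at \<open>a = u\<close> is \<open>u\<close>.\<close>

definition tree_dir :: "nat list \<Rightarrow> nat list \<Rightarrow> nat list" where
  "tree_dir u a = (if suffix u a then drop (length a - length u - 1) a else tl u)"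

lemma tree_adj_irrefl [simp]: "\<not> tree_adj d v v"
  by (auto simp: tree_adj_def dest: arg_cong[of _ _ length])

lemma tree_dir_adj: "tree_adj d u y \<Longrightarrow> tree_dir u y = y"
  by (auto simp: tree_adj_def tree_dir_def suffix_def dest: arg_cong[of _ _ length])

text \<open>A walk can change its branch at \<open>u\<close> only by passing through
  \<open>u\<close>; in this form the walk arguments use that the graph is a tree.\<close>

lemma tree_dir_step:
  assumes "tree_adj d a b" "a \<noteq> u" "b \<noteq> u"
  shows "tree_dir u a = tree_dir u b"
proof -
  have *: "tree_dir u a = tree_dir u (x # a)" if "a \<noteq> u" "x # a \<noteq> u" for x a
  proof (cases "suffix u a")
    case True
    then have "length u < length a"
      using that(1) by (auto simp: suffix_def)
    then show ?thesis
      using True by (auto simp: tree_dir_def suffix_Cons Suc_diff_le drop_Cons' )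
  next
    case False
    then show ?thesis using that by (auto simp: tree_dir_def suffix_Cons)
  qed
  show ?thesis
    using assms * by (auto simp: tree_adj_def)
qed

lemma tree_dir_walk:
  assumes "successively (tree_adj d) m" "u \<notin> set m" "a \<in> set m"
  shows "tree_dir u a = tree_dir u (hd m)"
  using assms
proof (induction m)
  case (Cons y m)
  show ?case
  proof (cases "a = y")
    case False
    then have a: "a \<in> set m" and m: "m \<noteq> []" using Cons.prems by auto
    then have "tree_dir u a = tree_dir u (hd m)" and "tree_adj d y (hd m)"
      using Cons by (auto simp: successively_Cons)
    moreover have "hd m \<noteq> u" using Cons.prems m by auto
    ultimately show ?thesis
      using tree_dir_step[of d y "hd m" u] Cons.prems by auto
  qed simp
qed simp

lemma tree_dir_child: "tree_dir z a = x # z \<longleftrightarrow> suffix (x # z) a"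
proof
  assume *: "tree_dir z a = x # z"
  have "suffix z a"
    using * by (cases z) (auto simp: tree_dir_def split: if_splits dest: arg_cong[of _ _ length])
  then show "suffix (x # z) a"
    using * suffix_drop[of "length a - length z - 1" a] by (simp add: tree_dir_def)
next
  assume "suffix (x # z) a"
  then show "tree_dir z a = x # z"
    by (auto simp: tree_dir_def suffix_def)
qed

lemma tree_dir_parent:
  assumes "v \<noteq> []"
  shows "tree_dir v a = tl v \<longleftrightarrow> \<not> suffix v a"
proof -
  have "drop (length a - length v - 1) a \<noteq> tl v" if "suffix v a"
  proof
    assume eq: "drop (length a - length v - 1) a = tl v"
    have "length v \<le> length (drop (length a - length v - 1) a)"
      using suffix_length_le[OF that] by simp
    then show False using assms unfolding eq by (cases v) auto
  qed
  then show ?thesis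
    using assms by (auto simp: tree_dir_def)
qed

section \<open>Subtrees, children and neighbours\<close>

definition subtree :: "nat \<Rightarrow> nat list \<Rightarrow> nat list set" where
  "subtree d p = {a \<in> tree_vertices d. suffix p a}"

definition children :: "nat \<Rightarrow> nat list \<Rightarrow> nat list set" where
  "children d p = (\<lambda>x. x # p) ` {..<(if p = [] then d else d - 1)}"

lemma finite_children [simp]: "finite (children d p)"
  by (simp add: children_def)

lemma card_children: "card (children d p) = (if p = [] then d else d - 1)"
  by (simp add: children_def card_image inj_on_def)

lemma tree_adj_iff:
  assumes "v \<in> tree_vertices d"
  shows "tree_adj d v z \<longleftrightarrow> z \<in> children d v \<or> v \<noteq> [] \<and> z = tl v"
  using assms by (cases v) (auto simp: tree_adj_def children_def tree_vertices_Cons_iff tree_vertices.root)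

lemma finite_tree_adj [simp]: "finite {z. z \<in> S \<and> tree_adj d v z}"
proof (cases "v \<in> tree_vertices d")
  case True
  have "finite (insert (tl v) (children d v))" by simp
  then show ?thesis
    by (rule rev_finite_subset) (auto simp: tree_adj_iff[OF True])
qed (auto simp: tree_adj_def)

lemma tree_vertices_suffix: "v \<in> tree_vertices d \<Longrightarrow> suffix u v \<Longrightarrow> u \<in> tree_vertices d"
  by (induction rule: tree_vertices.induct) (auto simp: suffix_Cons intro: tree_vertices.intros)

lemma tree_vertices_tl: "v \<in> tree_vertices d \<Longrightarrow> tl v \<in> tree_vertices d"
  by (cases v) (auto simp: tree_vertices_Cons_iff)

lemma tree_adj_tl: "v \<in> tree_vertices d \<Longrightarrow> v \<noteq> [] \<Longrightarrow> tree_adj d v (tl v)"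
  by (simp add: tree_adj_iff)

section \<open>Green functions of walks confined to a set of vertices\<close>

abbreviation twalks :: "nat \<Rightarrow> nat list set \<Rightarrow> nat list \<Rightarrow> nat list list set" where
  "twalks d \<equiv> cwalks (tree_adj d)"

definition green :: "nat \<Rightarrow> ennreal \<Rightarrow> nat list set \<Rightarrow> nat list \<Rightarrow> ennreal" where
  "green d w S x = wsum w (twalks d S x)"

definition return_weight :: "nat \<Rightarrow> ennreal \<Rightarrow> nat list set \<Rightarrow> nat list \<Rightarrow> ennreal" where
  "return_weight d w S x = wsum w (excursions (tree_adj d) S x)"

lemma green_return: "x \<in> S \<Longrightarrow> green d w S x = 1 + return_weight d w S x * green d w S x"
  unfolding green_def return_weight_def by (rule wsum_cwalks)

text \<open>A walk from \<open>y\<close> that avoids its neighbour \<open>z\<close> stays in the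
  branch of \<open>z\<close> containing \<open>y\<close>, so only that part of the domain
  matters.\<close>

lemma twalks_local:
  assumes "tree_adj d z y" "z \<notin> S" "\<And>a. a \<in> S \<Longrightarrow> tree_dir z a = y \<Longrightarrow> a \<in> S'"
  shows "twalks d S y \<subseteq> twalks d S' y"
proof
  fix l assume l: "l \<in> twalks d S y"
  have "a \<in> S'" if a: "a \<in> set l" for a
  proof -
    have "z \<notin> set (l @ [y])" using l assms(1,2) by (auto simp: cwalks_def)
    then have "tree_dir z a = tree_dir z (hd (l @ [y]))"
      using l a by (intro tree_dir_walk[of d]) (auto simp: cwalks_def)
    also have "\<dots> = y" using l tree_dir_adj[OF assms(1)] by (auto simp: cwalks_def)
    finally show ?thesis using assms(3) l a by (auto simp: cwalks_def)
  qed
  then show "l \<in> twalks d S' y" using l by (auto simp: cwalks_def)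
qed

lemma green_local:
  assumes "tree_adj d z y" "z \<notin> S" "z \<notin> S'" "\<And>a. tree_dir z a = y \<Longrightarrow> a \<in> S \<longleftrightarrow> a \<in> S'"
  shows "green d w S y = green d w S' y"
proof -
  have "twalks d S y = twalks d S' y"
    using assms by (intro equalityI twalks_local[of d z]) auto
  then show ?thesis by (simp add: green_def)
qed

text \<open>An excursion on a tree returns through the neighbour by which it left. Between these two
  steps it is a closed walk at that neighbour avoiding \<open>x\<close>.\<close>

lemma excursions_tree:
  "excursions (tree_adj d) S x =
    (\<Union>z\<in>{z \<in> S. tree_adj d x z}. (\<lambda>l. x # l @ [z]) ` twalks d (S - {x}) z)" (is "?L = ?R")
proof
  show "?L \<subseteq> ?R"
  proof
    fix e assume "e \<in> ?L"
    then obtain m where e: "e = x # m" and m: "x \<notin> set m" "set m \<subseteq> S"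
      and s: "successively (tree_adj d) (x # m @ [x])"
      by (auto simp: excursions_def)
    have ne: "m \<noteq> []" using s by auto
    have s1: "tree_adj d x (hd m)" "successively (tree_adj d) m" "tree_adj d (last m) x"
      using s ne by (auto simp: successively_Cons successively_append_iff)
    have "tree_dir x (last m) = tree_dir x (hd m)"
      using s1 m ne by (intro tree_dir_walk) auto
    then have eq: "last m = hd m"
      using tree_dir_adj[OF s1(1)] tree_dir_adj[OF tree_adj_sym[OF s1(3)]] by simp
    have bl: "m = butlast m @ [hd m]" using ne eq by (metis append_butlast_last_id)
    have "butlast m \<in> twalks d (S - {x}) (hd m)"
      using m s1 bl ne by (auto simp: cwalks_def dest: in_set_butlastD)
    then show "e \<in> ?R"
      using e bl s1 ne m by (intro UN_I[of "hd m"] image_eqI[of _ _ "butlast m"]) auto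
  qed
  show "?R \<subseteq> ?L"
  proof safe
    fix z l assume z: "z \<in> S" "tree_adj d x z" and l: "l \<in> twalks d (S - {x}) z"
    have "successively (tree_adj d) (x # m @ [x])"
      if "successively (tree_adj d) m" "hd m = z" "last m = z" "m \<noteq> []" for m
      using that z by (auto simp: successively_Cons successively_append_iff tree_adj_sym)
    from this[of "l @ [z]"] have "successively (tree_adj d) (x # (l @ [z]) @ [x])"
      using l by (auto simp: cwalks_def)
    then show "x # l @ [z] \<in> ?L"
      using l z by (auto simp: excursions_def cwalks_def)
  qed
qed

text \<open>The factor \<open>w\<^sup>2\<close> pays for leaving \<open>x\<close> and returning to
  it; excursions through different neighbours are different lists.\<close>

lemma return_weight_eq:
  "return_weight d w S x = w\<^sup>2 * (\<Sum>z | z \<in> S \<and> tree_adj d x z. green d w (S - {x}) z)"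
proof -
  have "return_weight d w S x =
    (\<Sum>z | z \<in> S \<and> tree_adj d x z. wsum w ((\<lambda>l. x # l @ [z]) ` twalks d (S - {x}) z))"
    unfolding return_weight_def excursions_tree
    by (rule wsum_UN_disjoint) (auto simp: disjoint_family_on_def)
  also have "\<dots> = (\<Sum>z | z \<in> S \<and> tree_adj d x z. w\<^sup>2 * green d w (S - {x}) z)"
    unfolding green_def by (intro sum.cong refl wsum_image) (auto simp: inj_on_def)
  finally show ?thesis by (simp add: sum_distrib_left)
qed

text \<open>A supersolution of the quadratic fixed-point equation dominates the Green function. The
  missing neighbour \<open>x\<close> leaves at most \<open>d - 1\<close> directions at
  \<open>z\<close>, and the same holds at each later vertex because the previous one is
  removed.\<close>

lemma green_le:
  assumes \<gamma>: "1 + of_nat (d - 1) * w\<^sup>2 * \<gamma>\<^sup>2 \<le> \<gamma>" and "tree_adj d z x" "x \<notin> S"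
  shows "green d w S z \<le> \<gamma>"
proof -
  have g1: "1 \<le> \<gamma>" using \<gamma> by (meson le_iff_add order_trans)
  have "wsum w {l \<in> twalks d S z. length l \<le> N} \<le> \<gamma>" for N
    using assms(2,3)
  proof (induction N arbitrary: S z x)
    case 0
    have "wsum w {l \<in> twalks d S z. length l \<le> 0} \<le> wsum w {[] :: nat list list}" by (rule wsum_mono) auto
    also have "\<dots> = 1" by (simp add: wsum_finite)
    finally show ?case using g1 by (rule order_trans)
  next
    case (Suc N)
    let ?W = "\<lambda>S z. {l \<in> twalks d S z. length l \<le> N}"
    let ?Y = "{y \<in> S. tree_adj d z y}"
    have zV: "z \<in> tree_vertices d" using Suc.prems by (auto simp: tree_adj_def)
    have dpos: "1 \<le> d"
    proof -
      have "{u. tree_adj d z u} \<noteq> {}" using Suc.prems by auto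
      then show ?thesis using zV Suc.prems
        by (auto simp: tree_adj_iff children_def tree_vertices.simps[of z] split: if_splits)
    qed
    \<comment> \<open>A nonempty walk is a first excursion followed by a closed walk. Both remaining
      pieces have length at most \<open>N\<close>, since the listed \<open>z\<close> and
      \<open>y\<close> account for two steps.\<close>
    have "{l \<in> twalks d S z. length l \<le> Suc N} \<subseteq>
      {[]} \<union> (\<Union>y\<in>?Y. (\<lambda>(m, l). z # m @ y # l) ` (?W (S - {z}) y \<times> ?W S z))"
    proof
      fix l assume l: "l \<in> {l \<in> twalks d S z. length l \<le> Suc N}"
      show "l \<in> {[]} \<union> (\<Union>y\<in>?Y. (\<lambda>(m, l). z # m @ y # l) ` (?W (S - {z}) y \<times> ?W S z))"
      proof (cases "l = []")
        case False
        then have hd: "hd l = z" "z \<in> S" using l by (cases l; auto simp: cwalks_def)+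
        then have "z \<in> set l" using False by (metis hd_in_set)
        then obtain j where "count_list l z = Suc j"
          using count_notin[of z l] by (metis count_list_0_iff not0_implies_Suc)
        then have "l \<in> {l \<in> twalks d S z. count_list l z = Suc j}" using l by auto
        then obtain e l' where e: "e \<in> excursions (tree_adj d) S z" "l' \<in> twalks d S z" "l = e @ l'"
          unfolding cwalks_count_Suc[OF hd(2)] by auto
        then obtain y m where "y \<in> ?Y" "m \<in> twalks d (S - {z}) y" "e = z # m @ [y]"
          unfolding excursions_tree by auto
        then show ?thesis using e l by (auto intro!: bexI[of _ y] image_eqI[of _ _ "(m, l')"])
      qed auto
    qed
    then have "wsum w {l \<in> twalks d S z. length l \<le> Suc N} \<le>
      wsum w ({[]} \<union> (\<Union>y\<in>?Y. (\<lambda>(m, l). z # m @ y # l) ` (?W (S - {z}) y \<times> ?W S z)))"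
      by (rule wsum_mono)
    also have "\<dots> \<le> wsum w {[] :: nat list list} + wsum w (\<Union>y\<in>?Y. (\<lambda>(m, l). z # m @ y # l) ` (?W (S - {z}) y \<times> ?W S z))"
      by (rule wsum_Un_le)
    also have "\<dots> \<le> 1 + (\<Sum>y\<in>?Y. wsum w ((\<lambda>(m, l). z # m @ y # l) ` (?W (S - {z}) y \<times> ?W S z)))"
      by (intro add_mono wsum_UN_le) (auto simp: wsum_finite)
    also have "\<dots> \<le> 1 + (\<Sum>y\<in>?Y. w\<^sup>2 * wsum w (?W (S - {z}) y) * wsum w (?W S z))"
      by (intro add_mono sum_mono order_refl wsum_image2_le) auto
    also have "\<dots> \<le> 1 + (\<Sum>y\<in>?Y. w\<^sup>2 * \<gamma> * \<gamma>)"
      by (intro add_mono sum_mono order_refl mult_mono Suc.IH[of _ z] Suc.IH[of _ x])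
        (use Suc.prems in \<open>auto simp: tree_adj_sym\<close>)
    also have "\<dots> = 1 + of_nat (card ?Y) * w\<^sup>2 * \<gamma>\<^sup>2"
      by (simp add: power2_eq_square mult.assoc)
    also have "\<dots> \<le> 1 + of_nat (d - 1) * w\<^sup>2 * \<gamma>\<^sup>2"
    proof (intro add_mono order_refl mult_right_mono)
      have "?Y \<subseteq> {u. tree_adj d z u} - {x}" using Suc.prems by auto
      then have "card ?Y \<le> card ({u. tree_adj d z u} - {x})"
        using finite_tree_adj[of UNIV d z] by (intro card_mono) auto
      also have "\<dots> = d - 1"
        using Suc.prems tree_regular[OF dpos zV] finite_tree_adj[of UNIV d z] by auto
      finally show "(of_nat (card ?Y) :: ennreal) \<le> of_nat (d - 1)" by simp
    qed auto
    finally show ?case using \<gamma> by simp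
  qed
  then show ?thesis
    unfolding green_def by (subst wsum_SUP_length) (rule SUP_least)
qed

lemma subtree_subset: "suffix p v \<Longrightarrow> subtree d v \<subseteq> subtree d p"
  by (auto simp: subtree_def dest: suffix_order.trans)

lemma subtree_disjoint:
  "length u = length v \<Longrightarrow> u \<noteq> v \<Longrightarrow> subtree d u \<inter> subtree d v = {}"
  by (auto simp: subtree_def suffix_def)

lemma parent_notin_subtree: "v \<noteq> [] \<Longrightarrow> tl v \<notin> subtree d v"
  by (cases v) (auto simp: subtree_def suffix_def dest: arg_cong[of _ _ length])

lemma child_in_subtree:
  "v \<in> tree_vertices d \<Longrightarrow> c \<in> children d v \<Longrightarrow> c \<in> subtree d v \<and> c \<in> tree_vertices d \<and> c \<noteq> [] \<and> tl c = v \<and> tree_adj d v c"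
  by (auto simp: children_def subtree_def tree_vertices_Cons_iff suffix_Cons tree_adj_def split: if_splits)

section \<open>Green functions on the two sides of an edge\<close>

definition green_up :: "nat \<Rightarrow> ennreal \<Rightarrow> nat list \<Rightarrow> ennreal" where
  "green_up d w v = green d w (subtree d v) v"

text \<open>For \<open>v\<close> strictly below \<open>p\<close>, cutting the edge above
  \<open>v\<close> splits the subtree of \<open>p\<close>. \<open>green_up\<close> starts at
  \<open>v\<close> on the lower side, \<open>green_down\<close> at the parent of \<open>v\<close> on
  the upper side.\<close>

definition green_down :: "nat \<Rightarrow> ennreal \<Rightarrow> nat list \<Rightarrow> nat list \<Rightarrow> ennreal" where
  "green_down d w p v = green d w (subtree d p - subtree d v) (tl v)"

text \<open>Once \<open>v\<close> is removed, the branch of \<open>c\<close> is exactly the subtree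
  of \<open>c\<close>.\<close>

lemma green_child:
  assumes "v \<in> tree_vertices d" "c \<in> children d v" "v \<notin> S" "\<And>a. a \<in> subtree d c \<Longrightarrow> a \<in> S"
    "S \<subseteq> tree_vertices d"
  shows "green d w S c = green_up d w c"
proof -
  have c: "tree_adj d v c" "tl c = v" "c \<noteq> []" using child_in_subtree[OF assms(1,2)] by auto
  obtain x where x: "c = x # v" using c by (cases c) auto
  show ?thesis
    unfolding green_up_def
    by (rule green_local[OF c(1) assms(3)])
      (use parent_notin_subtree[OF c(3)] c(2) assms(4,5) in \<open>auto simp: x tree_dir_child subtree_def\<close>)
qed

lemma return_weight_up:
  assumes v: "v \<in> tree_vertices d"
  shows "return_weight d w (subtree d v) v = w\<^sup>2 * (\<Sum>c\<in>children d v. green_up d w c)"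
proof -
  have "{z. z \<in> subtree d v \<and> tree_adj d v z} = children d v"
    using child_in_subtree[OF v] parent_notin_subtree[of v d]
    by (auto simp: tree_adj_iff[OF v])
  moreover have "green d w (subtree d v - {v}) c = green_up d w c" if c: "c \<in> children d v" for c
    using child_in_subtree[OF v c] subtree_subset[of v c d] parent_notin_subtree[of c d]
    by (intro green_child[OF v c]) (auto simp: subtree_def)
  ultimately show ?thesis
    unfolding return_weight_eq by simp
qed

lemma self_in_subtree: "v \<in> tree_vertices d \<Longrightarrow> v \<in> subtree d v"
  by (simp add: subtree_def)

lemma green_up_eq:
  assumes v: "v \<in> tree_vertices d"
  shows "green_up d w v = 1 + w\<^sup>2 * (\<Sum>c\<in>children d v. green_up d w c) * green_up d w v"
  unfolding green_up_def
  by (subst green_return[OF self_in_subtree[OF v]])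
    (simp add: return_weight_up[OF v] green_up_def)

text \<open>On the upper side the parent of \<open>v\<close> sees the siblings of \<open>v\<close>,
  each contributing a full \<open>green_up\<close>, and its own parent, contributing
  \<open>green_down\<close> one level higher. The recursion climbs until it stops at
  \<open>p\<close>.\<close>

lemma green_down_eq:
  assumes p: "p \<in> tree_vertices d" and v: "v \<in> subtree d p" "v \<noteq> p"
  shows "green_down d w p v = 1 + w\<^sup>2 * ((\<Sum>c\<in>children d (tl v) - {v}. green_up d w c) +
    (if tl v = p then 0 else green_down d w p (tl v))) * green_down d w p v"
proof -
  let ?u = "tl v" and ?S = "subtree d p - subtree d v"
  have vV: "v \<in> tree_vertices d" using v by (auto simp: subtree_def)
  have ne: "v \<noteq> []" using v by (auto simp: subtree_def)
  obtain x where x: "v = x # ?u" using ne by (cases v) auto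
  have uV: "?u \<in> tree_vertices d" by (rule tree_vertices_tl[OF vV])
  have up: "?u \<in> subtree d p" using v x uV by (auto simp: subtree_def suffix_Cons)
      (metis suffix_Cons)
  have uS: "?u \<in> ?S" using up parent_notin_subtree[OF ne] by auto
  have vu: "subtree d v \<subseteq> subtree d ?u" by (rule subtree_subset) (metis x suffix_ConsI suffix_order.refl)
  have up': "subtree d ?u \<subseteq> subtree d p" using up by (intro subtree_subset) (auto simp: subtree_def)
  have sib: "subtree d c \<inter> subtree d v = {}" if "c \<in> children d ?u" "c \<noteq> v" for c
    using that arg_cong[OF x, of length] by (intro subtree_disjoint) (auto simp: children_def)
  have N: "{z. z \<in> ?S \<and> tree_adj d ?u z} = (children d ?u - {v}) \<union> (if ?u = p then {} else {tl ?u})"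
  proof (rule set_eqI, safe)
    fix z assume z: "z \<in> subtree d p" "z \<notin> subtree d v" "tree_adj d ?u z"
      "z \<notin> (if ?u = p then {} else {tl ?u})"
    show "z \<in> children d ?u"
    proof (rule ccontr)
      assume "z \<notin> children d ?u"
      then have "z = tl ?u" "?u \<noteq> []" using z by (auto simp: tree_adj_iff[OF uV])
      with z have "?u = p" by (auto split: if_splits)
      then show False using z parent_notin_subtree[OF \<open>?u \<noteq> []\<close>, of d] \<open>z = tl ?u\<close> by auto
    qed
  next
    assume "v \<in> subtree d p" "v \<notin> subtree d v" then show False using self_in_subtree[OF vV] by auto
  next
    fix z assume "z \<in> children d ?u" "z \<noteq> v"
    then show "z \<in> subtree d p" "tree_adj d ?u z"
      using child_in_subtree[OF uV] up' by auto
    assume "z \<in> subtree d v"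
    then show False using \<open>z \<in> children d ?u\<close> sib[OF _ \<open>z \<noteq> v\<close>] self_in_subtree child_in_subtree[OF uV]
      by blast
  next
    fix z assume "z \<in> (if ?u = p then {} else {tl ?u})"
    then have z: "z = tl ?u" and up0: "?u \<noteq> p" by (auto split: if_splits)
    then have une: "?u \<noteq> []" using up by (auto simp: subtree_def)
    then show "tree_adj d ?u z" using tree_adj_tl[OF uV] z by auto
    show "z \<in> subtree d p" using up up0 une z tree_vertices_tl[OF uV]
      by (cases ?u) (auto simp: subtree_def suffix_Cons)
    assume "z \<in> subtree d v"
    then show False using vu parent_notin_subtree[OF une, of d] z by auto
  qed
  have G: "green d w (?S - {?u}) c = green_up d w c" if c: "c \<in> children d ?u - {v}" for c
  proof (rule green_child[OF uV])
    show "a \<in> ?S - {?u}" if a: "a \<in> subtree d c" for a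
    proof -
      have cc: "c \<in> subtree d ?u" "c \<noteq> []" "tl c = ?u"
        using child_in_subtree[OF uV, of c] c by auto
      then have "a \<in> subtree d ?u"
        using a subtree_subset[of ?u c d] by (auto simp: subtree_def)
      then show ?thesis
        using up' a c sib[of c] parent_notin_subtree[OF cc(2), of d] cc(3) by auto
    qed
  qed (use c in \<open>auto simp: subtree_def\<close>)
  have P: "green d w (?S - {?u}) (tl ?u) = green_down d w p ?u" if "?u \<noteq> p"
  proof -
    have une: "?u \<noteq> []" using up that by (auto simp: subtree_def)
    show ?thesis
      unfolding green_down_def
      by (rule green_local[of d ?u])
        (use tree_adj_tl[OF uV une] self_in_subtree[OF uV] vu in
          \<open>auto simp: tree_dir_parent[OF une] subtree_def\<close>)
  qed
  have "tl ?u \<notin> children d ?u"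
    by (auto simp: children_def dest: arg_cong[of _ _ length])
  then have "return_weight d w ?S ?u = w\<^sup>2 * ((\<Sum>c\<in>children d ?u - {v}. green_up d w c) +
    (if ?u = p then 0 else green_down d w p ?u))"
    unfolding return_weight_eq N using G P by (cases "?u = p") (auto simp: sum.union_disjoint add.commute)
  then show ?thesis
    using green_return[OF uS, of d w] unfolding green_down_def by simp
qed

section \<open>Values of the Green functions\<close>

text \<open>The infimum over all non-root vertices replaces homogeneity: one quadratic inequality
  results before the values at different vertices are known to agree.\<close>

lemma green_up_INF_le:
  fixes d w
  defines "i \<equiv> (INF v\<in>{v \<in> tree_vertices d. v \<noteq> []}. green_up d w v)"
  shows "1 + of_nat (d - 1) * w\<^sup>2 * i\<^sup>2 \<le> i"
proof -
  have le: "i \<le> green_up d w v" if "v \<in> tree_vertices d" "v \<noteq> []" for v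
    unfolding i_def using that by (intro INF_lower) auto
  have "1 + of_nat (d - 1) * w\<^sup>2 * i\<^sup>2 \<le> green_up d w v" if v: "v \<in> tree_vertices d" "v \<noteq> []" for v
  proof -
    have "of_nat (d - 1) * i = (\<Sum>c\<in>children d v. i)"
      using v by (simp add: card_children)
    also have "\<dots> \<le> (\<Sum>c\<in>children d v. green_up d w c)"
      using child_in_subtree[OF v(1)] by (intro sum_mono le) auto
    finally have "w\<^sup>2 * (of_nat (d - 1) * i) * i \<le>
      w\<^sup>2 * (\<Sum>c\<in>children d v. green_up d w c) * green_up d w v"
      using le[OF v] by (intro mult_mono) auto
    then show ?thesis
      by (subst green_up_eq[OF v(1)]) (auto simp: power2_eq_square mult_ac intro!: add_mono)
  qed
  then show ?thesis
    unfolding i_def by (intro INF_greatest) auto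
qed

text \<open>A finite infimum would satisfy a quadratic inequality with negative
  discriminant.\<close>

lemma green_up_infinite:
  fixes \<omega> :: real
  assumes v: "v \<in> tree_vertices d" "v \<noteq> []" and \<omega>: "1 < 4 * real (d - 1) * \<omega>\<^sup>2" "0 \<le> \<omega>"
  shows "green_up d (ennreal \<omega>) v = \<infinity>"
proof -
  define i where "i = (INF v\<in>{v \<in> tree_vertices d. v \<noteq> []}. green_up d (ennreal \<omega>) v)"
  have i: "1 + of_nat (d - 1) * (ennreal \<omega>)\<^sup>2 * i\<^sup>2 \<le> i"
    unfolding i_def by (rule green_up_INF_le)
  have "i = \<infinity>"
  proof (cases i)
    case (real r)
    have "ennreal (1 + real (d - 1) * \<omega>\<^sup>2 * r\<^sup>2) \<le> ennreal r"
      using i \<omega> real by (simp add: ennreal_mult ennreal_power ennreal_of_nat_eq_real_of_nat)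
    then have le: "1 + real (d - 1) * \<omega>\<^sup>2 * r\<^sup>2 \<le> r" using real by (metis ennreal_le_iff)
    define k where "k = real (d - 1) * \<omega>\<^sup>2"
    have "1 + k * r\<^sup>2 \<le> r" "1 < 4 * k" using le \<omega> by (simp_all only: k_def mult.assoc)
    moreover have "0 \<le> (r / 2 - 1)\<^sup>2" by simp
    moreover have "(1/4) * r\<^sup>2 \<le> k * r\<^sup>2" using \<open>1 < 4 * k\<close> by (intro mult_right_mono) auto
    moreover have "r \<noteq> 0" using \<open>1 + k * r\<^sup>2 \<le> r\<close> by auto
    then have "(1/4) * r\<^sup>2 < k * r\<^sup>2" using \<open>1 < 4 * k\<close> by (intro mult_strict_right_mono) auto
    ultimately show ?thesis by (auto simp: power2_eq_square algebra_simps)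
  qed simp
  moreover have "i \<le> green_up d (ennreal \<omega>) v"
    unfolding i_def using v by (intro INF_lower) auto
  ultimately show ?thesis by (simp add: top_unique)
qed

text \<open>
  \<open>\<omega>\<close> is the weight of one step, \<open>\<gamma> = \<tau> / \<omega>\<close> and \<open>q = \<tau>\<^sup>2\<close>; the assumption \<open>\<gamma>_small\<close> selects
  the smaller root of the quadratic equation \<open>\<gamma>_eq\<close>.
\<close>

locale walk_weight =
  fixes d :: nat and \<omega> \<gamma> :: real
  assumes d3: "3 \<le> d" and \<omega>_pos: "0 < \<omega>" and \<gamma>_pos: "0 < \<gamma>"
    and \<gamma>_eq: "\<gamma> = 1 + (real d - 1) * \<omega>\<^sup>2 * \<gamma>\<^sup>2"
    and \<gamma>_small: "2 * (real d - 1) * \<omega>\<^sup>2 * \<gamma> \<le> 1"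
begin

abbreviation "w \<equiv> ennreal \<omega>"

definition "q = (\<omega> * \<gamma>)\<^sup>2"

lemma real_d: "real (d - 1) = real d - 1"
  using d3 by simp

lemma q_pos: "0 < q" and q_le: "(real d - 1) * q \<le> 1" and q_less_1: "q < 1" and \<gamma>_q: "\<gamma> = 1 + (real d - 1) * q"
proof -
  show "0 < q" using \<omega>_pos \<gamma>_pos by (simp add: q_def)
  show eq: "\<gamma> = 1 + (real d - 1) * q"
    using \<gamma>_eq by (simp add: q_def power_mult_distrib)
  \<comment> \<open>Multiplied by \<open>\<gamma>\<close>, the assumption
    \<open>\<gamma>_small\<close> reads \<open>2 * (d - 1) * q \<le> \<gamma>\<close>, and
    \<open>\<gamma> = 1 + (d - 1) * q\<close>.\<close>
  have "2 * ((real d - 1) * q) = \<gamma> * (2 * (real d - 1) * \<omega>\<^sup>2 * \<gamma>)"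
    by (simp add: q_def power2_eq_square)
  also have "\<dots> \<le> \<gamma> * 1" using \<gamma>_small \<gamma>_pos by (intro mult_left_mono) auto
  finally show le: "(real d - 1) * q \<le> 1" using eq by simp
  have "2 * q \<le> (real d - 1) * q" using d3 \<open>0 < q\<close> by (intro mult_right_mono) auto
  then show "q < 1" using le \<open>0 < q\<close> by linarith
qed

lemma \<gamma>_ennreal: "1 + of_nat (d - 1) * w\<^sup>2 * (ennreal \<gamma>)\<^sup>2 = ennreal \<gamma>"
proof -
  have "1 + of_nat (d - 1) * w\<^sup>2 * (ennreal \<gamma>)\<^sup>2 = ennreal (1 + (real d - 1) * \<omega>\<^sup>2 * \<gamma>\<^sup>2)"
    using \<omega>_pos \<gamma>_pos d3
    by (simp add: ennreal_mult ennreal_power ennreal_of_nat_eq_real_of_nat real_d)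
  then show ?thesis using \<gamma>_eq by simp
qed

lemma green_le_\<gamma>: "tree_adj d z x \<Longrightarrow> x \<notin> S \<Longrightarrow> green d w S z \<le> ennreal \<gamma>"
  by (rule green_le) (use \<gamma>_ennreal in auto)

text \<open>\<open>green_le\<close> bounds the value by the smaller root from above; the quadratic
  inequality for the infimum excludes everything strictly below that root.\<close>

lemma green_up_value:
  assumes v: "v \<in> tree_vertices d" "v \<noteq> []"
  shows "green_up d w v = ennreal \<gamma>"
proof -
  have up: "green_up d w v \<le> ennreal \<gamma>"
    unfolding green_up_def
    by (rule green_le_\<gamma>[OF tree_adj_tl[OF v] parent_notin_subtree[OF v(2)]])
  define i where "i = (INF v\<in>{v \<in> tree_vertices d. v \<noteq> []}. green_up d w v)"
  have i: "1 + of_nat (d - 1) * w\<^sup>2 * i\<^sup>2 \<le> i"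
    unfolding i_def by (rule green_up_INF_le)
  have iv: "i \<le> green_up d w v"
    unfolding i_def using v by (intro INF_lower) auto
  obtain r where r: "i = ennreal r" "0 \<le> r"
    using order_trans[OF iv up] by (cases i) (auto simp: top_unique)
  have r\<gamma>: "r \<le> \<gamma>" using order_trans[OF iv up] r \<gamma>_pos by simp
  have "ennreal (1 + (real d - 1) * \<omega>\<^sup>2 * r\<^sup>2) \<le> ennreal r"
    using i \<omega>_pos r d3 by (simp add: ennreal_mult ennreal_power ennreal_of_nat_eq_real_of_nat real_d)
  then have le: "1 + (real d - 1) * \<omega>\<^sup>2 * r\<^sup>2 \<le> r" using r by simp
  define k where "k = (real d - 1) * \<omega>\<^sup>2"
  have k: "0 < k" "1 + k * r\<^sup>2 \<le> r" "\<gamma> = 1 + k * \<gamma>\<^sup>2" "2 * k * \<gamma> \<le> 1"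
    using le \<gamma>_eq \<gamma>_small d3 \<omega>_pos by (simp_all add: k_def algebra_simps)
  \<comment> \<open>Subtracting the relations for \<open>r\<close> and \<open>\<gamma>\<close> gives
    \<open>\<gamma> - r \<le> k * (\<gamma> - r) * (\<gamma> + r)\<close>. For
    \<open>r < \<gamma>\<close> this forces
    \<open>1 \<le> k * (\<gamma> + r) < 2 * k * \<gamma> \<le> 1\<close>.\<close>
  have "\<gamma> \<le> r"
  proof (rule ccontr)
    assume "\<not> \<gamma> \<le> r"
    then have "k * (\<gamma> + r) < k * (2 * \<gamma>)" using k by (intro mult_strict_left_mono) auto
    also have "\<dots> \<le> 1" using k by simp
    finally have "(\<gamma> - r) * (k * (\<gamma> + r)) < (\<gamma> - r) * 1"
      using \<open>\<not> \<gamma> \<le> r\<close> by (intro mult_strict_left_mono) auto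
    then show False using k(2,3) by (simp add: algebra_simps power2_eq_square)
  qed
  then show ?thesis using up iv r r\<gamma> by (simp add: antisym)
qed

text \<open>For non-root \<open>p\<close> the value is \<open>\<gamma> * h k\<close> with the
  fractional linear recursion \<open>h (k + 1) = 1 / (1 + q * (1 - h k))\<close>. It starts at
  \<open>h 0 = 0\<close>, because the parent of \<open>p\<close> lies outside the domain, and is
  solved by quotients of consecutive \<open>1 - q ^ k\<close>.\<close>

lemma green_down_value:
  assumes p: "p \<in> tree_vertices d" and v: "v \<in> subtree d p" "v \<noteq> p"
  shows "green_down d w p v =
    ennreal (\<gamma> * (if p = [] then 1 else (1 - q ^ (length v - length p)) / (1 - q ^ Suc (length v - length p))))"
  using v
proof (induction "length v" arbitrary: v rule: less_induct)
  case less
  let ?u = "tl v"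
  define h where "h k = (if p = [] then 1 else (1 - q ^ k) / (1 - q ^ Suc k))" for k
  have vV: "v \<in> tree_vertices d" using less.prems by (auto simp: subtree_def)
  have ne: "v \<noteq> []" using less.prems by (auto simp: subtree_def)
  have uV: "?u \<in> tree_vertices d" by (rule tree_vertices_tl[OF vV])
  have uv: "tree_adj d ?u v" using tree_adj_sym[OF tree_adj_tl[OF vV ne]] .
  have len: "length p < length v"
    using less.prems by (auto simp: subtree_def suffix_def)
  have up: "?u \<in> subtree d p" using less.prems ne uV by (cases v) (auto simp: subtree_def suffix_Cons)
  have ch: "v \<in> children d ?u"
  proof -
    have "v \<noteq> tl ?u" using ne by (cases v) (auto dest: arg_cong[of _ _ length])
    then show ?thesis using uv tree_adj_iff[OF uV] by auto
  qed
  have sum: "(\<Sum>c\<in>children d ?u - {v}. green_up d w c) = ennreal (real (card (children d ?u) - 1) * \<gamma>)"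
  proof -
    have "(\<Sum>c\<in>children d ?u - {v}. green_up d w c) = (\<Sum>c\<in>children d ?u - {v}. ennreal \<gamma>)"
      using child_in_subtree[OF uV] by (intro sum.cong refl green_up_value) auto
    then show ?thesis
      using \<gamma>_pos ch by (simp add: ennreal_mult ennreal_of_nat_eq_real_of_nat)
  qed
  have "v \<notin> subtree d p - subtree d v" using self_in_subtree[OF vV] by auto
  then have fin: "green_down d w p v \<le> ennreal \<gamma>"
    unfolding green_down_def by (rule green_le_\<gamma>[OF uv])
  obtain x where x: "green_down d w p v = ennreal x" "0 \<le> x"
    using fin by (cases "green_down d w p v") (auto simp: top_unique)
  define k where "k = length v - Suc (length p)"
  have k: "length v - length p = Suc k" using len by (simp add: k_def)
  define y where "y = (if ?u = p then 0 else \<gamma> * h k)"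
  have h0: "0 \<le> h k" for k
    using q_pos q_less_1 by (auto simp: h_def power_le_one simp del: power_Suc)
  have y: "(if ?u = p then 0 else green_down d w p ?u) = ennreal y" "0 \<le> y"
  proof -
    show "0 \<le> y" using h0 \<gamma>_pos by (simp add: y_def)
    have "length ?u - length p = k" "length ?u < length v" using ne by (simp_all add: k_def)
    then show "(if ?u = p then 0 else green_down d w p ?u) = ennreal y"
      using less.hyps[of ?u] up by (simp add: y_def h_def)
  qed
  define a where "a = \<omega>\<^sup>2 * (real (card (children d ?u) - 1) * \<gamma> + y)"
  have a0: "0 \<le> a" using y \<gamma>_pos by (simp add: a_def)
  have "ennreal x = 1 + w\<^sup>2 * (ennreal (real (card (children d ?u) - 1) * \<gamma>) + ennreal y) * ennreal x"
    using green_down_eq[OF p less.prems, of w] unfolding sum y x .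
  also have "\<dots> = ennreal (1 + a * x)"
    using x y \<gamma>_pos \<omega>_pos a0 by (simp add: a_def ennreal_mult ennreal_power)
  finally have xa: "x = 1 + a * x" using x a0 by (subst (asm) ennreal_inj) auto
  have \<gamma>1: "\<gamma> * (1 - \<omega>\<^sup>2 * (real d - 1) * \<gamma>) = 1"
    using \<gamma>_eq by (simp add: algebra_simps power2_eq_square)
  have "x = \<gamma> * h (Suc k)"
  proof (cases "p = []")
    case True
    \<comment> \<open>If \<open>?u\<close> is the root, it has \<open>d - 1\<close> children besides
      \<open>v\<close> and no parent; otherwise it has \<open>d - 2\<close> such children and the
      parent contributes \<open>\<gamma>\<close>. The total is the same.\<close>
    have "a = \<omega>\<^sup>2 * (real d - 1) * \<gamma>"
      using True d3 by (auto simp: a_def y_def h_def card_children algebra_simps of_nat_diff)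
    then have "\<gamma> * (1 - a) = 1" using \<gamma>1 by simp
    moreover have "x * (1 - a) = 1" using xa by (simp add: algebra_simps)
    ultimately show ?thesis using True by (simp add: h_def) (metis mult_cancel_right zero_neq_one mult_zero_right)
  next
    case False
    \<comment> \<open>At \<open>?u = p\<close> the index is \<open>k = 0\<close>, and
      \<open>h 0 = 0\<close> absorbs the missing parent, so one formula covers both cases.\<close>
    have yk: "y = \<gamma> * h k"
    proof (cases "?u = p")
      case True
      then have "k = 0" using ne by (simp add: k_def flip: True)
      then show ?thesis using True False by (simp add: y_def h_def)
    qed (simp add: y_def)
    have "?u \<noteq> []" using up False by (auto simp: subtree_def)
    then have a: "a = \<omega>\<^sup>2 * ((real d - 2) * \<gamma> + \<gamma> * h k)"
      using d3 yk by (simp add: a_def card_children of_nat_diff)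
    have qk: "q ^ Suc j < 1" for j
      using q_pos q_less_1 by (rule_tac power_Suc_less_one) auto
    have "\<gamma> * (1 - a) = \<gamma> * (1 - \<omega>\<^sup>2 * (real d - 1) * \<gamma>) + q * (1 - h k)"
      by (simp add: a q_def algebra_simps power2_eq_square)
    also have "\<dots> = 1 + q * (1 - h k)" using \<gamma>1 by simp
    also have "\<dots> = (1 - q ^ Suc (Suc k)) / (1 - q ^ Suc k)"
      using qk[of k] False by (simp add: h_def field_simps del: power_Suc) (simp add: algebra_simps)
    finally have "\<gamma> * (1 - a) = (1 - q ^ Suc (Suc k)) / (1 - q ^ Suc k)" .
    then have "\<gamma> * h (Suc k) * (1 - a) = 1"
      using qk[of k] qk[of "Suc k"] False by (simp add: h_def field_simps del: power_Suc)
    moreover have "x * (1 - a) = 1" using xa by (simp add: algebra_simps)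
    ultimately show ?thesis by (metis mult_cancel_right zero_neq_one mult_zero_right)
  qed
  then show ?case unfolding x k h_def by simp
qed

end

section \<open>The loop measure of loops through a vertex\<close>

lemma successively_adj_vertices:
  "successively (tree_adj d) m \<Longrightarrow> 2 \<le> length m \<Longrightarrow> set m \<subseteq> tree_vertices d"
proof (induction m)
  case (Cons a m)
  then obtain b m' where m: "m = b # m'" by (cases m) auto
  show ?case
  proof (cases m')
    case Nil
    then show ?thesis using Cons.prems m by (auto simp: tree_adj_def)
  next
    case Cons': (Cons c m'')
    then show ?thesis using Cons m by (auto simp: tree_adj_def)
  qed
qed simp

text \<open>The minimal length two and membership in the tree come for free on the right, since
  every step of a closed walk is an edge.\<close>

lemma based_loops_hd_conv:
  "{l \<in> based_loops d. x \<in> set l \<and> set l \<subseteq> S \<and> hd l = x} = {l \<in> twalks d S x. l \<noteq> []}"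
proof (intro equalityI subsetI CollectI)
  fix l assume "l \<in> {l \<in> based_loops d. x \<in> set l \<and> set l \<subseteq> S \<and> hd l = x}"
  then show "l \<in> twalks d S x \<and> l \<noteq> []"
    by (auto simp: based_loops_def cwalks_def hd_append successively_append_iff)
next
  fix l assume "l \<in> {l \<in> twalks d S x. l \<noteq> []}"
  then have l: "l \<noteq> []" "hd l = x" "set l \<subseteq> S" "successively (tree_adj d) (l @ [x])"
    by (auto simp: cwalks_def hd_append)
  have len: "2 \<le> length (l @ [x])" using l(1) by (cases l) auto
  have "2 \<le> length l"
    using l by (cases l rule: remdups_adj.cases) auto
  moreover have "set l \<subseteq> tree_vertices d"
    using successively_adj_vertices[OF l(4) len] by auto
  ultimately show "l \<in> based_loops d \<and> x \<in> set l \<and> set l \<subseteq> S \<and> hd l = x"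
    using l by (auto simp: based_loops_def successively_append_iff dest: hd_in_set)
qed

lemma nn_integral_count_space_if:
  "(\<integral>\<^sup>+l. (if P l then f l else 0) \<partial>count_space A) = (\<integral>\<^sup>+l. f l \<partial>count_space {l \<in> A. P l})"
proof -
  have "(\<integral>\<^sup>+l. (if P l then f l else 0) \<partial>count_space A) =
    (\<integral>\<^sup>+l. (if P l then f l else 0) \<partial>count_space {l \<in> A. P l})"
    by (rule nn_integral_count_space_eq) auto
  also have "\<dots> = (\<integral>\<^sup>+l. f l \<partial>count_space {l \<in> A. P l})"
    by (rule nn_integral_cong) auto
  finally show ?thesis .
qed

lemma count_list_rotate:
  fixes l :: "'a list"
  shows "count_list (rotate n l) x = count_list l x"
proof (induction n)
  case (Suc n)
  have "count_list (rotate1 m) x = count_list m x" for m :: "'a list"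
    by (cases m) (auto simp: count_list_append)
  then show ?case using Suc by simp
qed simp

definition loop_mass :: "nat \<Rightarrow> ennreal \<Rightarrow> (nat list set \<Rightarrow> bool) \<Rightarrow> ennreal" where
  "loop_mass d w P =
     (\<integral>\<^sup>+l. ennreal (1 / real (length l)) * w ^ length l \<partial>count_space {l \<in> based_loops d. P (set l)})"

text \<open>
  Every loop through \<open>x\<close> is rerooted at one of its visits to \<open>x\<close>; this replaces the weight
  \<open>1 / length l\<close> by one over the number of visits.
\<close>

lemma loop_mass_through:
  assumes "x \<in> S"
  shows   "loop_mass d w (\<lambda>V. x \<in> V \<and> V \<subseteq> S) =
    (\<Sum>j. ennreal (1 / real (Suc j)) * return_weight d w S x ^ Suc j)"
proof -
  define B where "B = {l \<in> based_loops d. x \<in> set l \<and> set l \<subseteq> S}"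
  define B0 where "B0 = {l \<in> B. hd l = x}"
  define c where "c l = ennreal (1 / real (count_list l x))" for l
  define g where "g l = c l * (ennreal (1 / real (length l)) * w ^ length l)" for l :: "nat list list"
  have cnt: "count_list l x > 0" "l \<noteq> []" if "l \<in> B" for l
    using that count_list_0_iff[of l x] by (auto simp: B_def based_loops_def)
  have mult_inv: "of_nat n * (ennreal (1 / real n) * a) = a" if "n > 0" for n a
  proof -
    have "of_nat n * ennreal (1 / real n) = ennreal (real n * (1 / real n))"
      by (subst ennreal_mult) (auto simp: ennreal_of_nat_eq_real_of_nat)
    then show ?thesis using that by (simp add: mult.assoc[symmetric])
  qed
  have "loop_mass d w (\<lambda>V. x \<in> V \<and> V \<subseteq> S) =
    (\<integral>\<^sup>+l. (\<Sum>i. if i < length l \<and> l ! i = x then g l else 0) \<partial>count_space B)"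
    unfolding loop_mass_def B_def[symmetric]
  proof (rule nn_integral_cong)
    fix l assume "l \<in> space (count_space B)"
    then have l: "l \<in> B" by simp
    let ?N = "{i. i < length l \<and> l ! i = x}"
    have "card ?N = count_list l x"
      unfolding count_list_eq_length_filter length_filter_conv_card
      by (rule arg_cong[where f = card]) auto
    then have "(\<Sum>i. if i < length l \<and> l ! i = x then g l else 0) = of_nat (count_list l x) * g l"
      by (subst suminf_finite[of ?N]) auto
    also have "\<dots> = ennreal (1 / real (length l)) * w ^ length l"
      unfolding g_def c_def by (rule mult_inv[OF cnt(1)[OF l]])
    finally show "ennreal (1 / real (length l)) * w ^ length l =
      (\<Sum>i. if i < length l \<and> l ! i = x then g l else 0)" ..
  qed
  also have "\<dots> = (\<Sum>i. \<integral>\<^sup>+l. (if i < length l \<and> l ! i = x then g l else 0) \<partial>count_space B)"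
    by (rule nn_integral_suminf) simp
  \<comment> \<open>Rotation by \<open>i\<close> brings the visit at position \<open>i\<close> to
    the front and preserves the length, the vertex set and the number of visits. The condition
    \<open>i < length l\<close> that is left sums to the factor cancelling
    \<open>1 / length l\<close>.\<close>
  also have "\<dots> = (\<Sum>i. \<integral>\<^sup>+l. (if i < length l then g l else 0) \<partial>count_space B0)"
  proof (rule suminf_cong)
    fix i
    have bij: "bij_betw (rotate i) {l \<in> B. i < length l \<and> l ! i = x} {l \<in> B0. i < length l}"
    proof (rule bij_betw_byWitness[where f' = "\<lambda>l. rotate (length l - i) l"])
      show "rotate i ` {l \<in> B. i < length l \<and> l ! i = x} \<subseteq> {l \<in> B0. i < length l}"
        using cnt by (auto simp: B0_def B_def rotate_based_loops hd_rotate_conv_nth)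
      show "(\<lambda>l. rotate (length l - i) l) ` {l \<in> B0. i < length l} \<subseteq> {l \<in> B. i < length l \<and> l ! i = x}"
      proof safe
        fix l assume l: "l \<in> B0" "i < length l"
        then show "rotate (length l - i) l \<in> B" "i < length (rotate (length l - i) l)"
          by (auto simp: B0_def B_def rotate_based_loops)
        have "l \<noteq> []" using l by auto
        then show "rotate (length l - i) l ! i = x"
          using l by (simp add: nth_rotate hd_conv_nth B0_def)
      qed
    qed (auto simp: rotate_rotate)
    have "(\<integral>\<^sup>+l. (if i < length l \<and> l ! i = x then g l else 0) \<partial>count_space B) =
      (\<integral>\<^sup>+l. g (rotate i l) \<partial>count_space {l \<in> B. i < length l \<and> l ! i = x})"
      unfolding nn_integral_count_space_if by (simp add: g_def c_def count_list_rotate)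
    also have "\<dots> = (\<integral>\<^sup>+l. g l \<partial>count_space {l \<in> B0. i < length l})"
      by (rule nn_integral_bij_count_space[OF bij])
    also have "\<dots> = (\<integral>\<^sup>+l. (if i < length l then g l else 0) \<partial>count_space B0)"
      by (rule nn_integral_count_space_if[symmetric])
    finally show "(\<integral>\<^sup>+l. (if i < length l \<and> l ! i = x then g l else 0) \<partial>count_space B) = \<dots>" .
  qed
  also have "\<dots> = (\<integral>\<^sup>+l. (\<Sum>i. if i < length l then g l else 0) \<partial>count_space B0)"
    by (rule nn_integral_suminf[symmetric]) simp
  also have "\<dots> = (\<integral>\<^sup>+l. c l * w ^ length l \<partial>count_space B0)"
  proof (rule nn_integral_cong)
    fix l assume "l \<in> space (count_space B0)"
    then have "length l > 0" using cnt by (auto simp: B0_def)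
    have "(\<Sum>i. if i < length l then g l else 0) = of_nat (length l) * g l"
      by (subst suminf_finite[of "{..<length l}"]) auto
    also have "\<dots> = of_nat (length l) * (ennreal (1 / real (length l)) * (c l * w ^ length l))"
      by (simp add: g_def mult_ac)
    also have "\<dots> = c l * w ^ length l" by (rule mult_inv) fact
    finally show "(\<Sum>i. if i < length l then g l else 0) = c l * w ^ length l" .
  qed
  also have "\<dots> = (\<integral>\<^sup>+l. (\<Sum>j. if count_list l x = Suc j then c l * w ^ length l else 0) \<partial>count_space B0)"
  proof (rule nn_integral_cong)
    fix l assume "l \<in> space (count_space B0)"
    then have "count_list l x > 0" using cnt by (auto simp: B0_def)
    then obtain k where "count_list l x = Suc k" by (cases "count_list l x") auto
    then show "c l * w ^ length l = (\<Sum>j. if count_list l x = Suc j then c l * w ^ length l else 0)"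
      by (subst suminf_finite[of "{k}"]) auto
  qed
  also have "\<dots> = (\<Sum>j. \<integral>\<^sup>+l. (if count_list l x = Suc j then c l * w ^ length l else 0) \<partial>count_space B0)"
    by (rule nn_integral_suminf) simp
  also have "\<dots> = (\<Sum>j. ennreal (1 / real (Suc j)) * return_weight d w S x ^ Suc j)"
  proof (rule suminf_cong)
    fix j
    have "B0 = {l \<in> twalks d S x. l \<noteq> []}"
      unfolding B0_def B_def based_loops_hd_conv[symmetric] by auto
    then have eq: "{l \<in> B0. count_list l x = Suc j} = {l \<in> twalks d S x. count_list l x = Suc j}"
      by auto
    have "(\<integral>\<^sup>+l. (if count_list l x = Suc j then c l * w ^ length l else 0) \<partial>count_space B0) =
      (\<integral>\<^sup>+l. ennreal (1 / real (Suc j)) * w ^ length l \<partial>count_space {l \<in> B0. count_list l x = Suc j})"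
      unfolding nn_integral_count_space_if by (rule nn_integral_cong) (auto simp: c_def)
    also have "\<dots> = ennreal (1 / real (Suc j)) * wsum w {l \<in> B0. count_list l x = Suc j}"
      by (simp add: nn_integral_cmult wsum_eq_nn_integral)
    also have "\<dots> = ennreal (1 / real (Suc j)) * return_weight d w S x ^ Suc j"
      unfolding eq return_weight_def wsum_cwalks_count[OF assms] ..
    finally show "(\<integral>\<^sup>+l. (if count_list l x = Suc j then c l * w ^ length l else 0) \<partial>count_space B0) = \<dots>" .
  qed
  finally show ?thesis .
qed

section \<open>Loops crossing an edge\<close>

lemma suminf_ln_ennreal:
  assumes "0 \<le> R" "R < 1"
  shows "(\<Sum>j. ennreal (1 / real (Suc j)) * ennreal R ^ Suc j) = ennreal (- ln (1 - R))"
proof -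
  have "(\<lambda>n. - (- (R ^ n) / real n)) sums (- ln (1 - R))"
    using ln_series'[of "- R"] assms by (intro sums_minus) simp
  then have "(\<lambda>n. R ^ n / real n) sums (- ln (1 - R))" by simp
  then have "(\<lambda>n. R ^ Suc n / real (Suc n)) sums (- ln (1 - R))"
    using sums_Suc_iff[of "\<lambda>n. R ^ n / real n" "- ln (1 - R)"] by simp
  then have "(\<Sum>j. ennreal (R ^ Suc j / real (Suc j))) = ennreal (- ln (1 - R))"
    using assms by (intro suminf_ennreal_eq) auto
  moreover have "ennreal (1 / real (Suc j)) * ennreal R ^ Suc j = ennreal (R ^ Suc j / real (Suc j))" for j
    using assms by (simp add: ennreal_power ennreal_mult[symmetric] del: power_Suc of_nat_Suc)
  ultimately show ?thesis by presburger
qed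

lemma loop_mass_split:
  "loop_mass d w P = loop_mass d w (\<lambda>V. P V \<and> Q V) + loop_mass d w (\<lambda>V. P V \<and> \<not> Q V)"
proof -
  let ?f = "\<lambda>l. ennreal (1 / real (length l)) * w ^ length l"
  let ?B = "{l \<in> based_loops d. P (set l)}"
  have "loop_mass d w P = (\<integral>\<^sup>+l. (if Q (set l) then ?f l else 0) + (if \<not> Q (set l) then ?f l else 0) \<partial>count_space ?B)"
    unfolding loop_mass_def by (rule nn_integral_cong) auto
  also have "\<dots> = (\<integral>\<^sup>+l. (if Q (set l) then ?f l else 0) \<partial>count_space ?B) +
      (\<integral>\<^sup>+l. (if \<not> Q (set l) then ?f l else 0) \<partial>count_space ?B)"
    by (rule nn_integral_add) auto
  finally show ?thesis
    unfolding nn_integral_count_space_if loop_mass_def by (simp add: conj_assoc)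
qed

lemma loop_mass_mono:
  assumes "\<And>l. l \<in> based_loops d \<Longrightarrow> P (set l) \<Longrightarrow> Q (set l)"
  shows "loop_mass d w P \<le> loop_mass d w Q"
proof -
  let ?f = "\<lambda>l. ennreal (1 / real (length l)) * w ^ length l"
  have "loop_mass d w P = (\<integral>\<^sup>+l. (if P (set l) then ?f l else 0) \<partial>count_space (based_loops d))"
    by (simp add: loop_mass_def nn_integral_count_space_if)
  also have "\<dots> \<le> (\<integral>\<^sup>+l. (if Q (set l) then ?f l else 0) \<partial>count_space (based_loops d))"
    by (rule nn_integral_mono) (use assms in auto)
  also have "\<dots> = loop_mass d w Q"
    by (simp add: loop_mass_def nn_integral_count_space_if)
  finally show ?thesis .
qed

section \<open>Leaving a subtree\<close>

lemma tree_adj_leave_subtree: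
  assumes "tree_adj d a b" "a \<in> subtree d v" "b \<notin> subtree d v"
  shows "a = v \<and> b = tl v"
  using assms by (auto simp: tree_adj_def subtree_def suffix_Cons)

lemma walk_leave_subtree:
  assumes "successively (tree_adj d) m" "m \<noteq> []" "hd m \<in> subtree d v" "b \<in> set m" "b \<notin> subtree d v"
  shows "v \<in> set m \<and> tl v \<in> set m"
  using assms
proof (induction m)
  case (Cons a m)
  then have ne: "m \<noteq> []" by auto
  show ?case
  proof (cases "hd m \<in> subtree d v")
    case True
    then show ?thesis using Cons ne by (auto simp: successively_Cons)
  next
    case False
    then have "a = v \<and> hd m = tl v"
      using Cons.prems ne by (intro tree_adj_leave_subtree[of d]) (auto simp: successively_Cons)
    then show ?thesis using ne hd_in_set[OF ne] by auto
  qed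
qed simp

text \<open>Rotate the loop to start inside the subtree: the only way out is the edge from
  \<open>v\<close> to its parent.\<close>

lemma based_loop_cross:
  assumes l: "l \<in> based_loops d" and a: "a \<in> set l" "a \<in> subtree d v" and b: "b \<in> set l" "b \<notin> subtree d v"
  shows "v \<in> set l \<and> tl v \<in> set l"
proof -
  obtain i where i: "i < length l" "a = l ! i" using a(1) by (auto simp: in_set_conv_nth)
  have ne: "l \<noteq> []" using i by auto
  have "rotate i l \<in> based_loops d" by (rule rotate_based_loops[OF l])
  then have "v \<in> set (rotate i l) \<and> tl v \<in> set (rotate i l)"
    using a b i ne by (intro walk_leave_subtree) (auto simp: based_loops_def hd_rotate_conv_nth)
  then show ?thesis by simp
qed

lemma parent_in_subtree:
  assumes "v \<in> subtree d p" "v \<noteq> p"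
  shows "v \<in> tree_vertices d" "v \<noteq> []" "tl v \<in> subtree d p" "p \<in> tree_vertices d"
proof -
  show "v \<in> tree_vertices d" "v \<noteq> []" using assms by (auto simp: subtree_def)
  then show "tl v \<in> subtree d p"
    using assms tree_vertices_tl[of v d] by (cases v) (auto simp: subtree_def suffix_Cons)
  show "p \<in> tree_vertices d" using assms tree_vertices_suffix by (auto simp: subtree_def)
qed

text \<open>The loops through the parent of \<open>v\<close> that otherwise stay in the subtree of
  \<open>v\<close> suffice. A single excursion into that subtree has infinite weight, so already the
  first term of the series in \<open>loop_mass_through\<close> is infinite.\<close>

lemma loop_mass_cross_infinite:
  assumes v: "v \<in> subtree d p" "v \<noteq> p" and \<omega>: "1 < 4 * real (d - 1) * \<omega>\<^sup>2" "0 < \<omega>"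
  shows "loop_mass d (ennreal \<omega>) (\<lambda>V. v \<in> V \<and> tl v \<in> V \<and> V \<subseteq> subtree d p) = \<infinity>"
proof -
  note vV = parent_in_subtree[OF v]
  let ?u = "tl v" and ?w = "ennreal \<omega>"
  let ?S = "insert ?u (subtree d v)"
  have "?S - {?u} = subtree d v" using parent_notin_subtree[OF vV(2)] by auto
  then have up: "green d ?w (?S - {?u}) v = \<infinity>"
    using green_up_infinite[OF vV(1,2) \<omega>(1) less_imp_le[OF \<omega>(2)]] by (simp only: green_up_def)
  have "(\<infinity>::ennreal) = green d ?w (?S - {?u}) v" using up by simp
  also have "\<dots> \<le> (\<Sum>z | z \<in> ?S \<and> tree_adj d ?u z. green d ?w (?S - {?u}) z)"
    using tree_adj_sym[OF tree_adj_tl[OF vV(1,2)]] self_in_subtree[OF vV(1)]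
    by (intro member_le_sum[OF _ _ finite_tree_adj]) auto
  finally have R: "return_weight d ?w ?S ?u = \<infinity>"
    unfolding return_weight_eq using \<omega>(2) by (simp add: top_unique ennreal_mult_top)
  have "(\<infinity>::ennreal) = (\<Sum>j\<in>{0}. ennreal (1 / real (Suc j)) * return_weight d ?w ?S ?u ^ Suc j)"
    by (simp add: R)
  also have "\<dots> \<le> (\<Sum>j. ennreal (1 / real (Suc j)) * return_weight d ?w ?S ?u ^ Suc j)"
    by (rule sum_le_suminf) auto
  also have "\<dots> = loop_mass d ?w (\<lambda>V. ?u \<in> V \<and> V \<subseteq> ?S)"
    by (rule loop_mass_through[symmetric]) simp
  also have "\<dots> \<le> loop_mass d ?w (\<lambda>V. v \<in> V \<and> ?u \<in> V \<and> V \<subseteq> subtree d p)"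
  proof (rule loop_mass_mono)
    fix l assume l: "l \<in> based_loops d" "?u \<in> set l \<and> set l \<subseteq> ?S"
    obtain x y r where r: "l = x # y # r"
      using l(1) by (cases l rule: remdups_adj.cases) (auto simp: based_loops_def)
    then have "x \<noteq> y" using l by (auto simp: based_loops_def)
    then obtain a where "a \<in> set l" "a \<in> subtree d v"
      using l(2) r by (cases "x = ?u") auto
    then have "v \<in> set l"
      using based_loop_cross[OF l(1) _ _ _ parent_notin_subtree[OF vV(2)]] l(2) by blast
    moreover have "subtree d v \<subseteq> subtree d p"
      using v by (intro subtree_subset) (auto simp: subtree_def)
    ultimately show "v \<in> set l \<and> ?u \<in> set l \<and> set l \<subseteq> subtree d p"
      using l vV(3) by auto
  qed
  finally show ?thesis by (simp add: top_unique)
qed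

section \<open>Finite crossing masses\<close>

context walk_weight
begin

text \<open>
  \<open>q * escape_ratio p k\<close> is the weight of a round trip across the edge between the depths \<open>k - 1\<close>
  and \<open>k\<close> below \<open>p\<close>: one first passage upwards and one downwards, inside the subtree of \<open>p\<close>.
\<close>

definition escape_ratio :: "nat list \<Rightarrow> nat \<Rightarrow> real" where
  "escape_ratio p k = (if p = [] then 1 else (1 - q ^ k) / (1 - q ^ Suc k))"

lemma escape_ratio_bounds: "0 \<le> escape_ratio p k" "escape_ratio p k \<le> 1" "q * escape_ratio p k < 1"
proof -
  have qk: "q ^ Suc k \<le> q ^ k" "q ^ Suc k < 1" "q ^ k \<le> 1"
    using q_pos q_less_1 by (auto intro!: power_decreasing power_Suc_less_one power_le_one simp del: power_Suc)
  then show b: "0 \<le> escape_ratio p k" "escape_ratio p k \<le> 1"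
    by (auto simp: escape_ratio_def divide_le_eq simp del: power_Suc)
  have "q * escape_ratio p k \<le> q * 1" using b q_pos by (intro mult_left_mono) auto
  then show "q * escape_ratio p k < 1" using q_less_1 by simp
qed

text \<open>The two values differ by the excursions through the parent of \<open>v\<close>;
  \<open>loop_mass_cross\<close> compares them to isolate the loops crossing that edge.\<close>

lemma return_weight_values:
  assumes v: "v \<in> subtree d p" "v \<noteq> p"
  defines "k \<equiv> length v - length p"
  shows "return_weight d w (subtree d p) v =
      ennreal (\<omega>\<^sup>2 * ((real d - 1) * \<gamma> + \<gamma> * escape_ratio p k))" (is ?R1)
    and "return_weight d w (subtree d p - {tl v}) v = ennreal (\<omega>\<^sup>2 * ((real d - 1) * \<gamma>))" (is ?R2)
proof -
  note vV = parent_in_subtree[OF v]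
  have sub: "subtree d v \<subseteq> subtree d p"
    using v by (intro subtree_subset) (auto simp: subtree_def)
  have notch: "tl v \<notin> children d v"
    by (auto simp: children_def dest: arg_cong[of _ _ length])
  have N1: "{z. z \<in> subtree d p \<and> tree_adj d v z} = insert (tl v) (children d v)"
    using vV sub child_in_subtree[OF vV(1)] by (auto simp: tree_adj_iff[OF vV(1)])
  then have N2: "{z. z \<in> subtree d p - {tl v} \<and> tree_adj d v z} = children d v"
    using notch by blast
  have ch: "green d w S c = ennreal \<gamma>"
    if c: "c \<in> children d v" and S: "S = subtree d p - {v} \<or> S = subtree d p - {tl v} - {v}" for c S
  proof -
    have cV: "c \<in> subtree d v" "c \<in> tree_vertices d" "c \<noteq> []" "tl c = v"
      using child_in_subtree[OF vV(1) c] by auto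
    have "green d w S c = green_up d w c"
    proof (rule green_child[OF vV(1) c])
      show "a \<in> S" if "a \<in> subtree d c" for a
      proof -
        have "a \<in> subtree d v" using that cV subtree_subset[of v c d] by (auto simp: subtree_def)
        then show ?thesis
          using that S sub parent_notin_subtree[OF cV(3), of d] parent_notin_subtree[OF vV(2), of d] cV(4)
          by auto
      qed
    qed (use S in \<open>auto simp: subtree_def\<close>)
    then show ?thesis using green_up_value[OF cV(2,3)] by simp
  qed
  have cardv: "card (children d v) = d - 1" using vV(2) by (simp add: card_children)
  have sum: "(\<Sum>c\<in>children d v. ennreal \<gamma>) = ennreal ((real d - 1) * \<gamma>)"
    unfolding sum_constant cardv using real_d \<gamma>_pos d3 by (simp add: ennreal_mult ennreal_of_nat_eq_real_of_nat)
  have "green d w (subtree d p - {v}) (tl v) = green_down d w p v"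
    unfolding green_down_def
    by (rule green_local[OF tree_adj_tl[OF vV(1,2)]])
      (use self_in_subtree[OF vV(1)] in \<open>auto simp: tree_dir_parent[OF vV(2)] subtree_def\<close>)
  also have "\<dots> = ennreal (\<gamma> * escape_ratio p k)"
    unfolding escape_ratio_def k_def by (rule green_down_value[OF vV(4) v])
  finally have "(\<Sum>z | z \<in> subtree d p \<and> tree_adj d v z. green d w (subtree d p - {v}) z) =
    ennreal (\<gamma> * escape_ratio p k) + ennreal ((real d - 1) * \<gamma>)"
    unfolding N1 using notch ch sum by simp
  also have "\<dots> = ennreal (\<gamma> * escape_ratio p k + (real d - 1) * \<gamma>)"
    using \<gamma>_pos d3 escape_ratio_bounds by (intro ennreal_plus[symmetric]) auto
  also have "\<dots> = ennreal ((real d - 1) * \<gamma> + \<gamma> * escape_ratio p k)" by (simp add: add.commute)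
  finally have S1: "(\<Sum>z | z \<in> subtree d p \<and> tree_adj d v z. green d w (subtree d p - {v}) z) = \<dots>" .
  have w2: "w\<^sup>2 * ennreal X = ennreal (\<omega>\<^sup>2 * X)" if "0 \<le> X" for X
    using that \<omega>_pos by (simp add: ennreal_mult ennreal_power)
  show ?R1
    unfolding return_weight_eq S1 using \<gamma>_pos d3 escape_ratio_bounds by (intro w2) auto
  show ?R2
    unfolding return_weight_eq N2 using ch sum \<gamma>_pos d3 by (simp add: w2)
qed

text \<open>The crossing loops are those through \<open>v\<close> without those through
  \<open>v\<close> avoiding its parent. Both masses are logarithms, and a common factor
  \<open>\<gamma>\<close> cancels in the quotient of their arguments.\<close>

lemma loop_mass_cross:
  assumes v: "v \<in> subtree d p" "v \<noteq> p"
  defines "k \<equiv> length v - length p"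
  shows "loop_mass d w (\<lambda>V. v \<in> V \<and> tl v \<in> V \<and> V \<subseteq> subtree d p) = ennreal (- ln (1 - q * escape_ratio p k))"
proof -
  note vV = parent_in_subtree[OF v]
  define R1 where "R1 = \<omega>\<^sup>2 * ((real d - 1) * \<gamma> + \<gamma> * escape_ratio p k)"
  define R2 where "R2 = \<omega>\<^sup>2 * ((real d - 1) * \<gamma>)"
  have "\<gamma> * (1 - R2) = 1" using \<gamma>_eq by (simp add: R2_def algebra_simps power2_eq_square)
  then have R2: "1 - R2 = 1 / \<gamma>" using \<gamma>_pos by (simp add: field_simps)
  have "\<gamma> * (1 - R1) = \<gamma> * (1 - R2) - q * escape_ratio p k"
    by (simp add: R1_def R2_def q_def algebra_simps power2_eq_square)
  also have "\<dots> = 1 - q * escape_ratio p k" using R2 \<gamma>_pos by simp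
  finally have R1: "1 - R1 = (1 - q * escape_ratio p k) / \<gamma>" using \<gamma>_pos by (simp add: field_simps)
  have pos: "0 < 1 - R1" "0 < 1 - R2" unfolding R1 R2 using \<gamma>_pos escape_ratio_bounds(3) by auto
  have R0: "0 \<le> R1" "0 \<le> R2" using \<gamma>_pos d3 escape_ratio_bounds by (auto simp: R1_def R2_def)
  have m1: "loop_mass d w (\<lambda>V. v \<in> V \<and> V \<subseteq> subtree d p) = ennreal (- ln (1 - R1))"
    using v pos R0 suminf_ln_ennreal[of R1] return_weight_values(1)[OF v]
    by (subst loop_mass_through) (simp_all add: R1_def k_def)
  have "v \<in> subtree d p - {tl v}" using v vV(2) by (cases v) auto
  then have m2: "loop_mass d w (\<lambda>V. v \<in> V \<and> V \<subseteq> subtree d p - {tl v}) = ennreal (- ln (1 - R2))"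
    using pos R0 suminf_ln_ennreal[of R2] return_weight_values(2)[OF v]
    by (subst loop_mass_through) (simp_all add: R2_def k_def)
  let ?X = "loop_mass d w (\<lambda>V. v \<in> V \<and> tl v \<in> V \<and> V \<subseteq> subtree d p)"
  have "loop_mass d w (\<lambda>V. v \<in> V \<and> V \<subseteq> subtree d p) =
     ?X + loop_mass d w (\<lambda>V. v \<in> V \<and> V \<subseteq> subtree d p - {tl v})"
    by (subst loop_mass_split[where Q = "\<lambda>V. tl v \<in> V"])
      (rule arg_cong2[where f = "(+)"]; rule arg_cong[where f = "loop_mass d w"]; auto)
  then have eq: "ennreal (- ln (1 - R1)) = ?X + ennreal (- ln (1 - R2))" unfolding m1 m2 .
  have ln2: "0 \<le> - ln (1 - R2)" "0 \<le> - ln (1 - R1)" using pos R0 by auto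
  \<comment> \<open>Subtraction in \<open>ennreal\<close> is legitimate here because the subtracted
    mass is finite.\<close>
  have "?X = ?X + ennreal (- ln (1 - R2)) - ennreal (- ln (1 - R2))" by simp
  also have "\<dots> = ennreal (- ln (1 - R1) - - ln (1 - R2))"
    unfolding eq[symmetric] using ln2 by (subst ennreal_minus) auto
  also have "- ln (1 - R1) - - ln (1 - R2) = - ln (1 - q * escape_ratio p k)"
    unfolding R1 R2 using \<gamma>_pos escape_ratio_bounds(3)[of p k] by (simp add: ln_div)
  finally show ?thesis .
qed

end

section \<open>Independence and void probabilities of the loop soup\<close>

lemma loop_class:
  assumes "l \<in> based_loops d"
  shows "cyclic_shift d `` {l} \<in> loops d" "loop_vertices (cyclic_shift d `` {l}) = set l"
proof -
  show "cyclic_shift d `` {l} \<in> loops d"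
    using assms by (auto simp: loops_def intro: quotientI)
  show "loop_vertices (cyclic_shift d `` {l}) = set l"
    using assms by (force simp: loop_vertices_def cyclic_shift_def intro: exI[of _ 0])
qed

lemma loop_representative:
  assumes "c \<in> loops d"
  obtains l where "l \<in> based_loops d" "c = cyclic_shift d `` {l}" "loop_vertices c = set l"
  using assms loop_class by (auto simp: loops_def elim!: quotientE)

text \<open>The vertex set is constant on a class of cyclic shifts, so the pushforward is evaluated
  on based loops, where the two powers merge into one weight per step.\<close>

lemma emeasure_loop_measure:
  assumes "-1 < \<kappa>"
  shows "emeasure (loop_measure d \<kappa>) {c \<in> loops d. P (loop_vertices c)} =
    loop_mass d (ennreal (1 / ((1 + \<kappa>) * real d))) P"
proof -
  let ?f = "\<lambda>l. ennreal (1 / real (length l) * (1 / (1 + \<kappa>)) ^ length l * (1 / real d) ^ length l)"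
  have m: "(\<lambda>l. cyclic_shift d `` {l}) \<in> based_loop_measure d \<kappa> \<rightarrow>\<^sub>M count_space (loops d)"
    by (auto simp: based_loop_measure_def loops_def intro: quotientI)
  have "(\<lambda>l. cyclic_shift d `` {l}) -` {c \<in> loops d. P (loop_vertices c)} \<inter> based_loops d =
    {l \<in> based_loops d. P (set l)}"
    using loop_class by auto
  then have "emeasure (loop_measure d \<kappa>) {c \<in> loops d. P (loop_vertices c)} =
    emeasure (based_loop_measure d \<kappa>) {l \<in> based_loops d. P (set l)}"
    unfolding loop_measure_def
    by (subst emeasure_distr[OF m]) (auto simp: based_loop_measure_def space_point_measure)
  also have "\<dots> = (\<integral>\<^sup>+l. ?f l * indicator {l \<in> based_loops d. P (set l)} l \<partial>count_space (based_loops d))"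
    unfolding based_loop_measure_def point_measure_def by (subst emeasure_density) auto
  also have "\<dots> = (\<integral>\<^sup>+l. (if P (set l) then ?f l else 0) \<partial>count_space (based_loops d))"
    by (rule nn_integral_cong) (auto simp: indicator_def)
  also have "\<dots> = (\<integral>\<^sup>+l. ?f l \<partial>count_space {l \<in> based_loops d. P (set l)})"
    by (rule nn_integral_count_space_if)
  also have "\<dots> = loop_mass d (ennreal (1 / ((1 + \<kappa>) * real d))) P"
    unfolding loop_mass_def
  proof (rule nn_integral_cong)
    fix l
    have "1 / real (length l) * (1 / (1 + \<kappa>)) ^ length l * (1 / real d) ^ length l =
      1 / real (length l) * (1 / ((1 + \<kappa>) * real d)) ^ length l"
      by (simp add: power_divide power_mult_distrib)
    then have "?f l = ennreal (1 / real (length l) * (1 / ((1 + \<kappa>) * real d)) ^ length l)"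
      by (simp only:)
    also have "\<dots> = ennreal (1 / real (length l)) * ennreal ((1 / ((1 + \<kappa>) * real d)) ^ length l)"
      by (rule ennreal_mult') simp
    also have "ennreal ((1 / ((1 + \<kappa>) * real d)) ^ length l) = ennreal (1 / ((1 + \<kappa>) * real d)) ^ length l"
      using assms by (intro ennreal_power[symmetric]) simp
    finally show "?f l = ennreal (1 / real (length l)) * ennreal (1 / ((1 + \<kappa>) * real d)) ^ length l" .
  qed
  finally show ?thesis .
qed

definition hit :: "'a set \<Rightarrow> ('a \<Rightarrow> nat) \<Rightarrow> bool" where
  "hit A \<omega> \<longleftrightarrow> (\<exists>c\<in>A. 1 \<le> \<omega> c)"

lemma hit_mono: "hit A \<omega> \<Longrightarrow> A \<subseteq> B \<Longrightarrow> hit B \<omega>"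
  by (auto simp: hit_def)

locale soup =
  fixes d :: nat and \<alpha> \<kappa> :: real
  assumes \<alpha>_nonneg: "0 \<le> \<alpha>" and \<kappa>_gt: "-1 < \<kappa>"
begin

abbreviation "Q \<equiv> loop_soup d \<alpha> \<kappa>"

sublocale prob_space Q
  unfolding loop_soup_def by (rule prob_space_poisson_process) (fact loop_intensity)+

text \<open>The events decided by which loops in \<open>A\<close> are open, as events of the whole
  sample space; disjoint sets \<open>A\<close> give independent families.\<close>

definition local_sigma :: "nat list list set set \<Rightarrow> (nat list list set \<Rightarrow> nat) measure" where
  "local_sigma A = sigma (space Q) ((\<lambda>c. {\<omega> \<in> space Q. 1 \<le> \<omega> c}) ` A)"

lemma space_local_sigma [simp]: "space (local_sigma A) = space Q"
  unfolding local_sigma_def by (rule space_measure_of) auto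

lemma sets_local_sigma: "sets (local_sigma A) = sigma_sets (space Q) ((\<lambda>c. {\<omega> \<in> space Q. 1 \<le> \<omega> c}) ` A)"
  unfolding local_sigma_def by (rule sets_measure_of) auto

lemma local_sigma_mono: "A \<subseteq> B \<Longrightarrow> sets (local_sigma A) \<subseteq> sets (local_sigma B)"
  unfolding sets_local_sigma by (rule sigma_sets_mono') auto

lemma measurable_open [measurable]: "c \<in> loops d \<Longrightarrow> {\<omega> \<in> space Q. 1 \<le> \<omega> c} \<in> sets Q"
proof -
  assume "c \<in> loops d"
  then have "(\<lambda>\<omega>. \<omega> c) \<in> Q \<rightarrow>\<^sub>M count_space UNIV"
    unfolding loop_soup_def
    by (intro measurable_multiplicity loop_intensity) (simp_all add: space_scale_measure space_loop_measure)
  then show ?thesis by measurable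
qed

lemma local_sigma_events: "A \<subseteq> loops d \<Longrightarrow> sets (local_sigma A) \<subseteq> events"
  unfolding sets_local_sigma by (rule sets.sigma_sets_subset) (use measurable_open in auto)

lemma hit_local:
  assumes "A \<subseteq> B" "B \<subseteq> loops d"
  shows "{\<omega> \<in> space Q. hit A \<omega>} \<in> sets (local_sigma B)"
proof -
  have "countable A" using countable_subset[of A "loops d"] countable_loops assms by auto
  then have "(\<Union>c\<in>A. {\<omega> \<in> space Q. 1 \<le> \<omega> c}) \<in> sets (local_sigma B)"
    using assms by (intro sets.countable_UN'') (auto simp: sets_local_sigma)
  moreover have "(\<Union>c\<in>A. {\<omega> \<in> space Q. 1 \<le> \<omega> c}) = {\<omega> \<in> space Q. hit A \<omega>}"
    by (auto simp: hit_def)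
  ultimately show ?thesis by simp
qed

lemma hit_events: "A \<subseteq> loops d \<Longrightarrow> {\<omega> \<in> space Q. hit A \<omega>} \<in> events"
  using hit_local[of A A] local_sigma_events[of A] by auto

text \<open>Multiplicities of distinct loops are independent, and grouping independent generators
  into disjoint blocks keeps the generated sigma-algebras independent.\<close>

lemma indep_local:
  assumes "A \<subseteq> loops d" "B \<subseteq> loops d" "A \<inter> B = {}"
    and X: "X \<in> sets (local_sigma A)" and Y: "Y \<in> sets (local_sigma B)"
  shows "prob (X \<inter> Y) = prob X * prob Y"
proof -
  let ?M = "scale_measure (ennreal \<alpha>) (loop_measure d \<kappa>)"
  let ?E = "\<lambda>c. {{\<omega> \<in> space Q. 1 \<le> \<omega> c}}"
  let ?I = "\<lambda>b. if b then A else B"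
  have "indep_vars (\<lambda>c. measure_pmf (poisson (measure ?M {c}))) (\<lambda>c \<omega>. \<omega> c) (loops d)"
    using indep_multiplicities[OF loop_intensity, of \<alpha> d \<kappa>]
    by (simp add: loop_soup_def space_scale_measure space_loop_measure)
  then have "indep_sets (\<lambda>c. {(\<lambda>\<omega>. \<omega> c) -` A \<inter> space Q | A. A \<in> sets (measure_pmf (poisson (measure ?M {c})))}) (loops d)"
    unfolding indep_vars_def2 by blast
  then have ind: "indep_sets ?E (loops d)"
  proof (rule indep_sets_mono_sets)
    fix c
    have "{\<omega> \<in> space Q. 1 \<le> \<omega> c} = (\<lambda>\<omega>. \<omega> c) -` {1..} \<inter> space Q" by auto
    then show "?E c \<subseteq> {(\<lambda>\<omega>. \<omega> c) -` A \<inter> space Q | A. A \<in> sets (measure_pmf (poisson (measure ?M {c})))}"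
      by auto
  qed
  have "indep_sets (\<lambda>b. sigma_sets (space Q) (\<Union>c\<in>?I b. ?E c)) UNIV"
  proof (rule indep_sets_collect_sigma)
    show "indep_sets ?E (\<Union>b\<in>UNIV. ?I b)"
      by (rule indep_sets_mono_index[OF _ ind]) (use assms in \<open>auto simp: UNIV_bool\<close>)
  qed (use assms in \<open>auto simp: Int_stable_def disjoint_family_on_def\<close>)
  moreover have "(\<Union>c\<in>?I b. ?E c) = (\<lambda>c. {\<omega> \<in> space Q. 1 \<le> \<omega> c}) ` ?I b" for b
    by auto
  ultimately have "indep_sets (\<lambda>b. sets (local_sigma (?I b))) UNIV"
    unfolding sets_local_sigma by simp
  then have "prob (\<Inter>b\<in>UNIV. if b then X else Y) = (\<Prod>b\<in>UNIV. prob (if b then X else Y))"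
    by (rule indep_setsD) (use X Y in auto)
  then show ?thesis by (simp add: UNIV_bool Int_commute mult.commute)
qed

text \<open>Later \<open>X\<close> fixes an offspring set and the \<open>Y j\<close> concern the
  disjoint subtrees of the offspring.\<close>

lemma indep_local_INT:
  assumes "finite J" "K \<subseteq> loops d" "\<And>j. j \<in> J \<Longrightarrow> A j \<subseteq> loops d"
    and "\<And>j. j \<in> J \<Longrightarrow> K \<inter> A j = {}" "disjoint_family_on A J"
    and X: "X \<in> sets (local_sigma K)" and Y: "\<And>j. j \<in> J \<Longrightarrow> Y j \<in> sets (local_sigma (A j))"
  shows "prob (X \<inter> (\<Inter>j\<in>J. Y j)) = prob X * (\<Prod>j\<in>J. prob (Y j))"
  using assms
proof (induction J rule: finite_induct)
  case (insert j J)
  let ?B = "K \<union> (\<Union>i\<in>J. A i)"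
  have B: "?B \<subseteq> loops d" using insert.prems by auto
  have "X \<in> sets (local_sigma ?B)"
    using insert.prems local_sigma_mono[of K ?B] by auto
  moreover have "Y i \<in> sets (local_sigma ?B)" if "i \<in> J" for i
    using insert.prems(6)[of i] local_sigma_mono[of "A i" ?B] that by auto
  ultimately have XY: "X \<inter> (\<Inter>i\<in>J. Y i) \<in> sets (local_sigma ?B)"
    using insert.hyps by (cases "J = {}") auto
  have "A i \<inter> A j = {}" if "i \<in> J" for i
    using insert.prems(4) insert.hyps that by (auto simp: disjoint_family_on_def)
  then have dis: "?B \<inter> A j = {}" using insert.prems(3) by auto
  have "prob (X \<inter> (\<Inter>i\<in>insert j J. Y i)) = prob ((X \<inter> (\<Inter>i\<in>J. Y i)) \<inter> Y j)"
    by (rule arg_cong[where f = prob]) auto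
  also have "\<dots> = prob (X \<inter> (\<Inter>i\<in>J. Y i)) * prob (Y j)"
    by (rule indep_local[OF B _ dis XY]) (use insert.prems in auto)
  also have "prob (X \<inter> (\<Inter>i\<in>J. Y i)) = prob X * (\<Prod>i\<in>J. prob (Y i))"
    using insert.prems by (intro insert.IH) (auto simp: disjoint_family_on_def)
  finally show ?case using insert.hyps by (simp add: mult_ac)
qed simp

text \<open>The number of points in \<open>A\<close> is Poisson, or almost surely infinite when the
  mass is infinite and the intensity positive.\<close>

lemma prob_not_hit:
  fixes P :: "nat list set \<Rightarrow> bool"
  defines "A \<equiv> {c \<in> loops d. P (loop_vertices c)}"
  defines "m \<equiv> loop_mass d (ennreal (1 / ((1 + \<kappa>) * real d))) P"
  shows "m = ennreal r \<Longrightarrow> 0 \<le> r \<Longrightarrow> prob {\<omega> \<in> space Q. \<not> hit A \<omega>} = exp (- \<alpha> * r)"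
    and "m = \<infinity> \<Longrightarrow> 0 < \<alpha> \<Longrightarrow> prob {\<omega> \<in> space Q. \<not> hit A \<omega>} = 0"
proof -
  let ?M = "scale_measure (ennreal \<alpha>) (loop_measure d \<kappa>)"
  have A: "A \<subseteq> space ?M" by (auto simp: A_def space_scale_measure space_loop_measure)
  have em: "emeasure ?M A = ennreal \<alpha> * m"
    unfolding m_def A_def by (simp only: emeasure_scale_measure emeasure_loop_measure[OF \<kappa>_gt])
  have cA: "countable A" using countable_loops[of d] by (rule countable_subset[rotated]) (auto simp: A_def)
  have iff: "points_in A \<omega> = 0 \<longleftrightarrow> \<not> hit A \<omega>" for \<omega>
    unfolding points_in_def by (subst nn_integral_0_iff_AE) (auto simp: AE_count_space hit_def Suc_le_eq)
  show "prob {\<omega> \<in> space Q. \<not> hit A \<omega>} = exp (- \<alpha> * r)" if "m = ennreal r" "0 \<le> r"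
  proof -
    have em': "emeasure ?M A = ennreal (\<alpha> * r)" using em that \<alpha>_nonneg by (simp add: ennreal_mult)
    then have "measure ?M A = \<alpha> * r" using that \<alpha>_nonneg by (simp add: measure_def)
    moreover have "prob {\<omega> \<in> space Q. points_in A \<omega> = of_nat 0} = pmf (poisson (measure ?M A)) 0"
      unfolding loop_soup_def using em'
      by (intro poisson_process_count loop_intensity A) auto
    ultimately show ?thesis
      using that \<alpha>_nonneg iff by (simp add: pmf_poisson_nonneg)
  qed
  show "prob {\<omega> \<in> space Q. \<not> hit A \<omega>} = 0" if "m = \<infinity>" "0 < \<alpha>"
  proof -
    have "emeasure ?M A = \<infinity>" using em that by (simp add: ennreal_mult_top)
    then have "AE \<omega> in Q. points_in A \<omega> = \<infinity>"
      unfolding loop_soup_def by (intro poisson_process_infinite loop_intensity A)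
    moreover have "\<not> \<not> hit A \<omega>" if "points_in A \<omega> = \<infinity>" for \<omega>
      using iff[of \<omega>] that by auto
    ultimately have "AE \<omega> in Q. \<not> \<not> hit A \<omega>"
      by (rule eventually_mono)
    moreover have "{\<omega> \<in> space Q. \<not> hit A \<omega>} \<in> events"
      by (intro sets.sets_Collect_neg hit_events) (auto simp: A_def)
    ultimately show ?thesis by (simp only: prob_Collect_eq_0)
  qed
qed

end

section \<open>Covered paths and the renewal equation\<close>

text \<open>Edges are named by their lower endpoint. A loop visiting both \<open>v\<close> and its
  parent must use the edge between them, so these loops cover that edge.\<close>

definition cross :: "nat \<Rightarrow> nat list \<Rightarrow> nat list \<Rightarrow> nat list list set set" where
  "cross d p v = {c \<in> loops d. v \<in> loop_vertices c \<and> tl v \<in> loop_vertices c \<and> loop_vertices c \<subseteq> subtree d p}"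

definition loops_in :: "nat \<Rightarrow> nat list \<Rightarrow> nat list list set set" where
  "loops_in d p = {c \<in> loops d. loop_vertices c \<subseteq> subtree d p}"

definition below :: "nat list \<Rightarrow> nat list \<Rightarrow> nat list set" where
  "below p v = {u. suffix u v \<and> suffix p u \<and> u \<noteq> p}"

text \<open>Only loops inside the subtree of \<open>p\<close> count, which makes the event local to
  that subtree; for the root this is no restriction.\<close>

definition conn :: "nat \<Rightarrow> nat list \<Rightarrow> nat list \<Rightarrow> (nat list list set \<Rightarrow> nat) \<Rightarrow> bool" where
  "conn d p v \<omega> \<longleftrightarrow> (\<forall>u\<in>below p v. hit (cross d p u) \<omega>)"

lemma finite_below [simp]: "finite (below p v)"
proof -
  have "below p v \<subseteq> set (suffixes v)" by (auto simp: below_def)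
  then show ?thesis by (rule finite_subset) simp
qed

lemma below_subtree: "u \<in> below p v \<Longrightarrow> v \<in> subtree d p \<Longrightarrow> u \<in> subtree d p \<and> u \<noteq> p \<and> v \<in> subtree d u"
  using tree_vertices_suffix by (auto simp: below_def subtree_def)

lemma below_self [simp]: "below p p = {}"
  by (auto simp: below_def suffix_order.antisym)

lemma below_Cons: "suffix p v \<Longrightarrow> below p (x # v) = insert (x # v) (below p v)"
  by (auto simp: below_def suffix_Cons dest: suffix_length_le)

lemma below_subset: "suffix p u \<Longrightarrow> below u v \<subseteq> below p v"
  by (auto simp: below_def intro: suffix_order.trans suffix_order.antisym)

lemma cross_mono: "suffix p u \<Longrightarrow> cross d u v \<subseteq> cross d p v"
  using subtree_subset[of p u d] by (auto simp: cross_def)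

lemma cross_subset_loops: "cross d p v \<subseteq> loops d"
  by (auto simp: cross_def)

lemma conn_refl [simp]: "conn d p p \<omega>"
  by (simp add: conn_def)

lemma conn_Cons: "suffix p v \<Longrightarrow> conn d p (x # v) \<omega> \<longleftrightarrow> hit (cross d p (x # v)) \<omega> \<and> conn d p v \<omega>"
  by (simp add: conn_def below_Cons)

lemma conn_suffix: "conn d p v \<omega> \<Longrightarrow> suffix u v \<Longrightarrow> conn d p u \<omega>"
  by (auto simp: conn_def below_def intro: suffix_order.trans)

lemma conn_trans:
  assumes "conn d p u \<omega>" "conn d u v \<omega>" "suffix p u" "suffix u v"
  shows "conn d p v \<omega>"
  unfolding conn_def
proof
  fix w assume w: "w \<in> below p v"
  show "hit (cross d p w) \<omega>"
  proof (cases "suffix w u")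
    case True
    then show ?thesis using assms(1) w by (auto simp: conn_def below_def)
  next
    case False
    then have "w \<in> below u v"
      using w assms(4) suffix_same_cases[of w v u] by (auto simp: below_def)
    then show ?thesis
      using assms(2) hit_mono[OF _ cross_mono[OF assms(3)]] by (simp add: conn_def)
  qed
qed

text \<open>A loop that meets the subtree of \<open>u\<close> and does not use the edge above
  \<open>u\<close> cannot leave that subtree. This is the regeneration property.\<close>

lemma cross_restrict:
  assumes c: "c \<in> cross d p v" "c \<notin> cross d p u" and u: "v \<in> subtree d u"
  shows "c \<in> cross d u v"
proof -
  obtain l where l: "l \<in> based_loops d" "loop_vertices c = set l"
    using c(1) by (auto simp: cross_def elim: loop_representative)
  have "set l \<subseteq> subtree d u"
  proof (rule ccontr)
    assume "\<not> set l \<subseteq> subtree d u"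
    then obtain b where "b \<in> set l" "b \<notin> subtree d u" by auto
    then have "u \<in> set l \<and> tl u \<in> set l"
      using c(1) l u by (intro based_loop_cross[OF l(1), of v]) (auto simp: cross_def)
    then show False using c l by (auto simp: cross_def)
  qed
  then show ?thesis using c(1) l by (auto simp: cross_def)
qed

lemma hit_cross_restrict:
  assumes "\<not> hit (cross d p u) \<omega>" "v \<in> subtree d u" "hit (cross d p v) \<omega>"
  shows "hit (cross d u v) \<omega>"
  using assms cross_restrict[of _ d p v u] by (auto simp: hit_def)

lemma cross_disjoint_loops_in: "u \<noteq> [] \<Longrightarrow> cross d p u \<inter> loops_in d u = {}"
  using parent_notin_subtree[of u d] by (auto simp: cross_def loops_in_def)

section \<open>Regeneration at the last uncovered edge\<close>

context soup
begin

lemma conn_local: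
  assumes "\<And>u. u \<in> below p v \<Longrightarrow> cross d p u \<subseteq> B" "B \<subseteq> loops d"
  shows "{\<omega> \<in> space Q. conn d p v \<omega>} \<in> sets (local_sigma B)"
proof -
  have "{\<omega> \<in> space (local_sigma B). \<forall>u\<in>below p v. hit (cross d p u) \<omega>} \<in> sets (local_sigma B)"
    by (intro sets.sets_Collect_finite_All) (use hit_local assms in auto)
  then show ?thesis by (simp add: conn_def)
qed

lemma conn_local_loops_in: "{\<omega> \<in> space Q. conn d p v \<omega>} \<in> sets (local_sigma (loops_in d p))"
  by (rule conn_local) (auto simp: cross_def loops_in_def)

lemma conn_events: "{\<omega> \<in> space Q. conn d p v \<omega>} \<in> events"
  using conn_local_loops_in[of p v] local_sigma_events[of "loops_in d p"] by (auto simp: loops_in_def)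

text \<open>If \<open>v\<close> is not connected to \<open>p\<close>, let \<open>u\<close> mark the
  lowest uncovered edge. The edges below it are then covered by loops inside the subtree of
  \<open>u\<close>, and these are independent of the loops crossing the edge above
  \<open>u\<close>.\<close>

lemma conn_last_closed:
  assumes v: "v \<in> subtree d p"
  shows "1 = prob {\<omega> \<in> space Q. conn d p v \<omega>} +
    (\<Sum>u\<in>below p v. prob {\<omega> \<in> space Q. \<not> hit (cross d p u) \<omega>} * prob {\<omega> \<in> space Q. conn d u v \<omega>})"
proof -
  let ?C = "\<lambda>p. {\<omega> \<in> space Q. conn d p v \<omega>}"
  let ?N = "\<lambda>u. {\<omega> \<in> space Q. \<not> hit (cross d p u) \<omega>}"
  let ?L = "\<lambda>u. ?N u \<inter> ?C u"
  have Nloc: "?N u \<in> sets (local_sigma (cross d p u))" for u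
    using sets.compl_sets[OF hit_local[OF order_refl cross_subset_loops]]
    by (simp add: set_diff_eq) (smt (verit) Collect_cong)
  have Nev: "?N u \<in> events" for u using Nloc local_sigma_events[OF cross_subset_loops] by blast
  have Lev: "?L u \<in> events" for u using Nev conn_events by blast
  have L: "prob (?L u) = prob (?N u) * prob (?C u)" if "u \<in> below p v" for u
  proof (rule indep_local[OF cross_subset_loops _ _ Nloc conn_local_loops_in])
    show "cross d p u \<inter> loops_in d u = {}"
      using that by (intro cross_disjoint_loops_in) (auto simp: below_def)
  qed (auto simp: loops_in_def)
  have cov: "space Q = ?C p \<union> (\<Union>u\<in>below p v. ?L u)"
  proof (intro equalityI subsetI)
    fix \<omega> assume \<omega>: "\<omega> \<in> space Q"
    show "\<omega> \<in> ?C p \<union> (\<Union>u\<in>below p v. ?L u)"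
    proof (cases "conn d p v \<omega>")
      case False
      \<comment> \<open>Vertices are words, so the lowest uncovered edge has the longest lower
        endpoint.\<close>
      let ?B = "{u \<in> below p v. \<not> hit (cross d p u) \<omega>}"
      have "finite ?B" "?B \<noteq> {}" using False by (auto simp: conn_def)
      then have "Max (length ` ?B) \<in> length ` ?B" by (intro Max_in) auto
      then obtain u where u: "u \<in> ?B" "length u = Max (length ` ?B)" by auto
      then have max: "length u' \<le> length u" if "u' \<in> ?B" for u'
        using that \<open>finite ?B\<close> by simp
      have "hit (cross d u w) \<omega>" if w: "w \<in> below u v" for w
      proof (rule hit_cross_restrict)
        show "\<not> hit (cross d p u) \<omega>" using u by simp
        show "w \<in> subtree d u"
          using below_subtree[OF w] u below_subtree[of u p v d] v by auto
        have "length u < length w"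
          using w by (auto simp: below_def suffix_def)
        moreover have "w \<in> below p v" using w u below_subset[of p u v] by (auto simp: below_def)
        ultimately show "hit (cross d p w) \<omega>" using max[of w] by auto
      qed
      then have "conn d u v \<omega>" by (simp add: conn_def)
      then show ?thesis using u \<omega> by auto
    qed (use \<omega> in auto)
  qed auto
  \<comment> \<open>For \<open>w\<close> below \<open>u\<close>, connection from \<open>u\<close> to
    \<open>v\<close> covers the edge above \<open>w\<close>, which the event for \<open>w\<close>
    leaves uncovered.\<close>
  have disj: "?L u \<inter> ?L w = {}" if uw: "u \<in> below p v" "w \<in> below p v" "u \<noteq> w" for u w
  proof -
    have *: "?L u \<inter> ?L w = {}" if uw: "u \<in> below p v" "w \<in> below u v" for u w
    proof -
      have "cross d u w \<subseteq> cross d p w" using uw by (intro cross_mono) (auto simp: below_def)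
      then show ?thesis using uw hit_mono by (fastforce simp: conn_def)
    qed
    have "w \<in> below u v \<or> u \<in> below w v"
      using uw suffix_same_cases[of u v w] by (auto simp: below_def)
    then show ?thesis using *[of u w] *[of w u] uw by auto
  qed
  have "1 = prob (?C p \<union> (\<Union>u\<in>below p v. ?L u))"
    using cov prob_space by simp
  also have "\<dots> = prob (?C p) + prob (\<Union>u\<in>below p v. ?L u)"
    using Lev conn_events by (intro finite_measure_Union) (auto simp: conn_def)
  also have "prob (\<Union>u\<in>below p v. ?L u) = (\<Sum>u\<in>below p v. prob (?L u))"
    using Lev disj by (intro finite_measure_finite_Union) (auto simp: disjoint_family_on_def)
  also have "\<dots> = (\<Sum>u\<in>below p v. prob (?N u) * prob (?C u))"
    by (rule sum.cong) (auto simp: L)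
  finally show ?thesis .
qed

end

section \<open>Uncovered-edge probabilities and the renewal sequence\<close>

locale tree_soup = soup d \<alpha> \<kappa> + walk_weight d \<omega> \<gamma>
  for d :: nat and \<alpha> \<kappa> \<omega> \<gamma> :: real +
  assumes \<omega>_eq: "\<omega> = 1 / ((1 + \<kappa>) * real d)"
begin

text \<open>For \<open>k > 0\<close>, the probability that the edge between depths
  \<open>k - 1\<close> and \<open>k\<close> below a non-root vertex is not covered from inside its
  subtree. The value 1 at \<open>k = 0\<close> supplies the initial term of the renewal sum.\<close>

definition closed_prob :: "nat \<Rightarrow> real" where
  "closed_prob k = (1 - q) powr \<alpha> * (1 - q ^ Suc k) powr (- \<alpha>)"

lemma q_power_less: "q ^ Suc k < 1"
  using q_pos q_less_1 by (simp add: power_Suc_less_one del: power_Suc)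

lemma closed_prob_0: "closed_prob 0 = 1"
  using q_less_1 by (simp add: closed_prob_def powr_minus)

lemma prob_closed:
  assumes v: "v \<in> subtree d p" "v \<noteq> p"
  shows "prob {\<omega> \<in> space Q. \<not> hit (cross d p v) \<omega>} =
    (if p = [] then (1 - q) powr \<alpha> else closed_prob (length v - length p))"
proof -
  let ?e = "q * escape_ratio p (length v - length p)"
  have e: "0 \<le> ?e" "?e < 1" using escape_ratio_bounds q_pos by auto
  have "prob {\<omega> \<in> space Q. \<not> hit (cross d p v) \<omega>} = exp (- \<alpha> * - ln (1 - ?e))"
    unfolding cross_def
    by (rule prob_not_hit(1)) (use loop_mass_cross[OF v] e in \<open>auto simp flip: \<omega>_eq\<close>)
  also have "\<dots> = (1 - ?e) powr \<alpha>" using e by (simp add: powr_def)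
  also have "\<dots> = (if p = [] then (1 - q) powr \<alpha> else closed_prob (length v - length p))"
  proof (cases "p = []")
    case False
    let ?k = "length v - length p"
    have "1 - ?e = (1 - q) / (1 - q ^ Suc ?k)"
      using q_power_less[of ?k] False by (simp add: escape_ratio_def field_simps)
    then show ?thesis
      using False q_less_1 q_power_less[of ?k]
      by (simp add: closed_prob_def powr_divide powr_minus_divide del: power_Suc)
  qed (simp add: escape_ratio_def)
  finally show ?thesis .
qed

lemma sum_below:
  assumes "suffix p v"
  shows "(\<Sum>u\<in>below p v. f (length u - length p) (length v - length u)) =
    (\<Sum>k=1..length v - length p. f k (length v - length p - k))"
  using assms
proof -
  have "bij_betw (\<lambda>u. length u - length p) (below p v) {1..length v - length p}"
  proof (rule bij_betw_byWitness[where f' = "\<lambda>k. drop (length v - length p - k) v"])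
    show "\<forall>u\<in>below p v. drop (length v - length p - (length u - length p)) v = u"
      using suffix_length_le by (auto simp: below_def suffix_def)
    show "\<forall>k\<in>{1..length v - length p}. length (drop (length v - length p - k) v) - length p = k"
      using suffix_length_le[OF assms] by auto
    show "(\<lambda>u. length u - length p) ` below p v \<subseteq> {1..length v - length p}"
      by (auto simp: below_def suffix_def Suc_le_eq)
    show "(\<lambda>k. drop (length v - length p - k) v) ` {1..length v - length p} \<subseteq> below p v"
    proof safe
      fix k assume k: "k \<in> {1..length v - length p}"
      obtain r where r: "v = r @ p" using assms by (auto simp: suffix_def)
      then have "drop (length v - length p - k) v = drop (length r - k) r @ p" using k by simp
      moreover have "drop (length r - k) r \<noteq> []" using k r by auto
      ultimately have "suffix p (drop (length v - length p - k) v)" "drop (length v - length p - k) v \<noteq> p"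
        by (auto simp: suffix_def)
      then show "drop (length v - length p - k) v \<in> below p v"
        using suffix_drop[of "length v - length p - k" v] by (simp add: below_def)
    qed
  qed
  from sum.reindex_bij_betw[OF this, of "\<lambda>k. f k (length v - length p - k)"]
  have "(\<Sum>k=1..length v - length p. f k (length v - length p - k)) =
    (\<Sum>u\<in>below p v. f (length u - length p) (length v - length p - (length u - length p)))" ..
  also have "\<dots> = (\<Sum>u\<in>below p v. f (length u - length p) (length v - length u))"
  proof (rule sum.cong[OF refl])
    fix u assume "u \<in> below p v"
    then have "length p \<le> length u" "length u \<le> length v"
      using suffix_length_le by (auto simp: below_def)
    then show "f (length u - length p) (length v - length p - (length u - length p)) =
      f (length u - length p) (length v - length u)" by simp
  qed
  finally show ?thesis ..
qed

text \<open>By \<open>prob_conn\<close> below, any other path of length \<open>n\<close> gives the same value.\<close>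

definition conn_prob :: "nat \<Rightarrow> real" where
  "conn_prob n = prob {\<omega> \<in> space Q. conn d [0] (replicate n 0 @ [0]) \<omega>}"

lemma replicate_in_subtree: "replicate n 0 @ [0] \<in> subtree d [0]"
proof -
  have "replicate n 0 @ [0] \<in> tree_vertices d"
    using d3 by (induction n) (auto simp: tree_vertices_Cons_iff tree_vertices.root)
  then show ?thesis by (auto simp: subtree_def suffix_def)
qed

text \<open>\<open>conn_last_closed\<close> computes the probability from shorter paths with
  coefficients depending only on depth, so induction on the length takes the place of tree
  automorphisms.\<close>

lemma prob_conn:
  assumes "v \<in> subtree d p" "p \<noteq> []"
  shows "prob {\<omega> \<in> space Q. conn d p v \<omega>} = conn_prob (length v - length p)"
  using assms
proof (induction "length v - length p" arbitrary: p v rule: less_induct)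
  case less
  \<comment> \<open>Stated for arbitrary endpoints, since it is applied both to the given path and
    to the reference path in \<open>conn_prob\<close>.\<close>
  have eq: "prob {\<omega> \<in> space Q. conn d p v \<omega>} =
    1 - (\<Sum>k=1..length v - length p. closed_prob k * conn_prob (length v - length p - k))"
    if IH: "\<And>p' v'. length v' - length p' < length v - length p \<Longrightarrow> v' \<in> subtree d p' \<Longrightarrow> p' \<noteq> [] \<Longrightarrow>
      prob {\<omega> \<in> space Q. conn d p' v' \<omega>} = conn_prob (length v' - length p')"
      and v: "v \<in> subtree d p" "p \<noteq> []" for p v
  proof -
    have "(\<Sum>u\<in>below p v. prob {\<omega> \<in> space Q. \<not> hit (cross d p u) \<omega>} * prob {\<omega> \<in> space Q. conn d u v \<omega>}) =
      (\<Sum>u\<in>below p v. closed_prob (length u - length p) * conn_prob (length v - length u))"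
    proof (intro sum.cong refl arg_cong2[where f = "(*)"])
      fix u assume u: "u \<in> below p v"
      note ub = below_subtree[OF u v(1)]
      then show "prob {\<omega> \<in> space Q. \<not> hit (cross d p u) \<omega>} = closed_prob (length u - length p)"
        using prob_closed[of u p] v(2) by auto
      have "length p < length u" "length u \<le> length v" "u \<noteq> []"
        using u suffix_length_le by (auto simp: below_def suffix_def)
      then show "prob {\<omega> \<in> space Q. conn d u v \<omega>} = conn_prob (length v - length u)"
        using ub by (intro IH) auto
    qed
    also have "\<dots> = (\<Sum>k=1..length v - length p. closed_prob k * conn_prob (length v - length p - k))"
      using v(1) by (intro sum_below) (auto simp: subtree_def)
    finally show ?thesis using conn_last_closed[OF v(1)] by simp
  qed
  let ?n = "length v - length p"
  have "prob {\<omega> \<in> space Q. conn d p v \<omega>} = 1 - (\<Sum>k=1..?n. closed_prob k * conn_prob (?n - k))"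
    using less by (intro eq) auto
  also have "\<dots> = conn_prob ?n"
    unfolding conn_prob_def[of ?n]
    by (subst eq[OF _ replicate_in_subtree]) (use less in auto)
  finally show ?case .
qed

lemma conn_prob_renewal: "(\<Sum>k\<le>n. closed_prob k * conn_prob (n - k)) = 1"
proof -
  let ?v = "replicate n 0 @ [0 :: nat]"
  note v = replicate_in_subtree[of n]
  have "(\<Sum>u\<in>below [0] ?v. prob {\<omega> \<in> space Q. \<not> hit (cross d [0] u) \<omega>} * prob {\<omega> \<in> space Q. conn d u ?v \<omega>}) =
      (\<Sum>u\<in>below [0] ?v. closed_prob (length u - length [0 :: nat]) * conn_prob (length ?v - length u))"
  proof (intro sum.cong refl arg_cong2[where f = "(*)"])
    fix u assume u: "u \<in> below [0] ?v"
    note ub = below_subtree[OF u v]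
    then show "prob {\<omega> \<in> space Q. \<not> hit (cross d [0] u) \<omega>} = closed_prob (length u - length [0 :: nat])"
      using prob_closed[of u "[0]"] by auto
    show "prob {\<omega> \<in> space Q. conn d u ?v \<omega>} = conn_prob (length ?v - length u)"
      using ub u by (intro prob_conn) (auto simp: below_def)
  qed
  also have "\<dots> = (\<Sum>k=1..length ?v - length [0 :: nat]. closed_prob k * conn_prob (length ?v - length [0 :: nat] - k))"
    by (rule sum_below) (auto simp: suffix_def)
  finally have "1 = conn_prob n + (\<Sum>k=1..n. closed_prob k * conn_prob (n - k))"
    using conn_last_closed[OF v] by (simp add: conn_prob_def[of n])
  then show ?thesis
    by (simp add: atMost_atLeast0 sum.atLeast_Suc_atMost closed_prob_0)
qed

text \<open>Seen from the root, all edges are uncovered with equal probability, so the convolution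
  reduces to a plain sum.\<close>

lemma prob_conn_root:
  assumes v: "v \<in> tree_vertices d"
  shows "prob {\<omega> \<in> space Q. conn d [] v \<omega>} = 1 - (1 - q) powr \<alpha> * (\<Sum>k<length v. conn_prob k)"
proof -
  have vs: "v \<in> subtree d []" using v by (simp add: subtree_def)
  have "(\<Sum>u\<in>below [] v. prob {\<omega> \<in> space Q. \<not> hit (cross d [] u) \<omega>} * prob {\<omega> \<in> space Q. conn d u v \<omega>}) =
      (\<Sum>u\<in>below [] v. (1 - q) powr \<alpha> * conn_prob (length v - length u))"
  proof (intro sum.cong refl arg_cong2[where f = "(*)"])
    fix u assume u: "u \<in> below [] v"
    note ub = below_subtree[OF u vs]
    then show "prob {\<omega> \<in> space Q. \<not> hit (cross d [] u) \<omega>} = (1 - q) powr \<alpha>"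
      using prob_closed[of u "[]"] by auto
    show "prob {\<omega> \<in> space Q. conn d u v \<omega>} = conn_prob (length v - length u)"
      using ub u by (intro prob_conn) (auto simp: below_def)
  qed
  also have "\<dots> = (\<Sum>k=1..length v. (1 - q) powr \<alpha> * conn_prob (length v - k))"
    using sum_below[of "[]" v "\<lambda>_ k. (1 - q) powr \<alpha> * conn_prob k"] by simp
  also have "\<dots> = (1 - q) powr \<alpha> * (\<Sum>k=1..length v. conn_prob (length v - k))"
    by (simp add: sum_distrib_left)
  also have "(\<Sum>k=1..length v. conn_prob (length v - k)) = (\<Sum>k<length v. conn_prob k)"
    by (rule sum.reindex_bij_witness[where i = "\<lambda>k. length v - k" and j = "\<lambda>k. length v - k"]) auto
  finally show ?thesis using conn_last_closed[OF vs] by simp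
qed

end

section \<open>Renewal sequences\<close>

text \<open>
  A renewal sequence \<open>p\<close> whose kernel is \<open>c (1 + b\<^sub>k)\<close>: its generating function is
  \<open>P(s) = 1 / (c (1 - (s - 1) D(s)))\<close> with \<open>D(s) = \<Sum> b\<^sub>k s\<^sup>k\<close>.
\<close>

locale renewal =
  fixes p b :: "nat \<Rightarrow> real" and c :: real
  assumes p_nonneg: "0 \<le> p n" and b_nonneg: "0 \<le> b n" and c_pos: "0 < c"
    and renewal: "(\<Sum>k\<le>n. c * (1 + b k) * p (n - k)) = 1"
begin

definition conv :: "nat \<Rightarrow> real" where
  "conv n = (\<Sum>k\<le>n. b k * p (n - k))"

lemma conv_nonneg: "0 \<le> conv n"
  unfolding conv_def by (intro sum_nonneg mult_nonneg_nonneg p_nonneg b_nonneg)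

lemma sum_p_conv: "c * ((\<Sum>k\<le>n. p k) + conv n) = 1"
proof -
  have "(\<Sum>k\<le>n. p (n - k)) = (\<Sum>k\<le>n. p k)"
    by (rule sum.nat_diff_reindex[of p "Suc n", simplified lessThan_Suc_atMost, simplified])
  moreover have "c * ((\<Sum>k\<le>n. p (n - k)) + conv n) = (\<Sum>k\<le>n. c * (1 + b k) * p (n - k))"
    by (simp add: conv_def sum_distrib_left sum.distrib algebra_simps)
  ultimately show ?thesis using renewal[of n] by simp
qed

text \<open>Together with \<open>p_0\<close> this is the coefficientwise form of P(s) = 1/c + (s -
  1) D(s) P(s), obtained by differencing the renewal equation.\<close>

lemma p_Suc: "p (Suc n) = conv n - conv (Suc n)"
proof -
  have "(\<Sum>k\<le>Suc n. p k) + conv (Suc n) = (\<Sum>k\<le>n. p k) + conv n"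
    using sum_p_conv[of n] sum_p_conv[of "Suc n"] c_pos by (metis mult_left_cancel less_irrefl)
  then show ?thesis by simp
qed

lemma p_0: "p 0 + conv 0 = 1 / c"
  using sum_p_conv[of 0] c_pos by (simp add: field_simps)

lemma p_0_pos: "0 < p 0"
proof -
  have "c * (1 + b 0) * p 0 = 1" using renewal[of 0] by simp
  then have "p 0 \<noteq> 0" by auto
  then show ?thesis using p_nonneg[of 0] by simp
qed

lemma conv_sums:
  assumes "0 \<le> s" "summable (\<lambda>n. b n * s ^ n)" "summable (\<lambda>n. p n * s ^ n)"
  shows "(\<lambda>n. conv n * s ^ n) sums ((\<Sum>n. b n * s ^ n) * (\<Sum>n. p n * s ^ n))"
proof -
  have "(\<lambda>n. \<Sum>k\<le>n. (b k * s ^ k) * (p (n - k) * s ^ (n - k))) sums ((\<Sum>n. b n * s ^ n) * (\<Sum>n. p n * s ^ n))"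
    using assms b_nonneg p_nonneg by (intro Cauchy_product_sums) auto
  moreover have "(\<Sum>k\<le>n. (b k * s ^ k) * (p (n - k) * s ^ (n - k))) = conv n * s ^ n" for n
    unfolding conv_def sum_distrib_right
  proof (rule sum.cong[OF refl])
    fix k assume "k \<in> {..n}"
    then have "s ^ n = s ^ k * s ^ (n - k)" by (simp flip: power_add)
    then show "b k * s ^ k * (p (n - k) * s ^ (n - k)) = b k * p (n - k) * s ^ n" by simp
  qed
  ultimately show ?thesis by simp
qed

text \<open>Convergence of P(s) is the claim, so the functional equation is replaced by inequalities
  between partial sums.\<close>

lemma subcritical:
  assumes s: "1 \<le> s" and b: "summable (\<lambda>n. b n * s ^ n)" and D: "(s - 1) * (\<Sum>n. b n * s ^ n) < 1"
  shows "summable (\<lambda>n. p n * s ^ n)"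
proof -
  define D where "D = (\<Sum>n. b n * s ^ n)"
  define X where "X N = (\<Sum>n\<le>N. conv n * s ^ n)" for N
  define P where "P N = (\<Sum>n\<le>N. p n * s ^ n)" for N
  \<comment> \<open>The coefficient identity summed up to \<open>N\<close>; the index shift explains
    \<open>X (N - 1)\<close> next to \<open>X N\<close>.\<close>
  have PX: "P N = 1 / c + s * X (N - 1) - X N" if "N > 0" for N
    using that
  proof (induction N rule: nat_induct_non_zero)
    case 1
    show ?case using p_0 by (simp add: P_def X_def p_Suc algebra_simps)
  next
    case (Suc N)
    have "P (Suc N) = P N + p (Suc N) * s ^ Suc N" by (simp add: P_def)
    also have "\<dots> = 1 / c + s * (X (N - 1) + conv N * s ^ N) - (X N + conv (Suc N) * s ^ Suc N)"
      unfolding Suc.IH p_Suc by (simp add: algebra_simps)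
    also have "X (N - 1) + conv N * s ^ N = X N"
      using Suc.hyps by (cases N) (auto simp: X_def)
    also have "X N + conv (Suc N) * s ^ Suc N = X (Suc N)" by (simp add: X_def)
    finally show ?case by simp
  qed
  \<comment> \<open>The convolution runs over a triangle of index pairs, which is enlarged to a
    square.\<close>
  have XP: "X N \<le> D * P N" for N
  proof -
    have "X N = (\<Sum>n\<le>N. \<Sum>k\<le>n. (b k * s ^ k) * (p (n - k) * s ^ (n - k)))"
      unfolding X_def conv_def sum_distrib_right
    proof (intro sum.cong refl)
      fix n k :: nat assume "k \<in> {..n}"
      then have "s ^ n = s ^ k * s ^ (n - k)" by (simp flip: power_add)
      then show "b k * p (n - k) * s ^ n = b k * s ^ k * (p (n - k) * s ^ (n - k))" by simp
    qed
    also have "\<dots> = (\<Sum>(k, j) | k + j \<le> N. (b k * s ^ k) * (p j * s ^ j))"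
      by (rule sum.triangle_reindex_eq[symmetric, of "\<lambda>k j. (b k * s ^ k) * (p j * s ^ j)"])
    also have "\<dots> \<le> (\<Sum>(k, j) \<in> {..N} \<times> {..N}. (b k * s ^ k) * (p j * s ^ j))"
      by (rule sum_mono2) (use s b_nonneg p_nonneg in auto)
    also have "\<dots> = (\<Sum>k\<le>N. b k * s ^ k) * P N"
      by (simp add: P_def sum_product sum.cartesian_product)
    also have "\<dots> \<le> D * P N"
      unfolding D_def P_def using s b_nonneg p_nonneg b
      by (intro mult_right_mono sum_le_suminf sum_nonneg) auto
    finally show ?thesis .
  qed
  \<comment> \<open>\<open>P N \<le> P (Suc N) \<le> 1 / c + (s - 1) * D * P N\<close> is solved for
    \<open>P N\<close>, using \<open>(s - 1) * D < 1\<close>.\<close>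
  have bound: "P N \<le> 1 / c / (1 - (s - 1) * D)" for N
  proof -
    have "P N \<le> P (Suc N)" unfolding P_def using s p_nonneg by (intro sum_mono2) auto
    have "X N \<le> X (Suc N)" unfolding X_def using s conv_nonneg by (intro sum_mono2) auto
    have "P N \<le> P (Suc N)" by fact
    also have "P (Suc N) = 1 / c + s * X N - X (Suc N)" using PX[of "Suc N"] by simp
    also have "\<dots> \<le> 1 / c + (s - 1) * X N" using \<open>X N \<le> X (Suc N)\<close> by (simp add: algebra_simps)
    also have "\<dots> \<le> 1 / c + (s - 1) * (D * P N)" using XP[of N] s by (intro add_left_mono mult_left_mono) auto
    finally have "P N * (1 - (s - 1) * D) \<le> 1 / c" by (simp add: algebra_simps)
    then show ?thesis using D unfolding D_def[symmetric] by (subst pos_le_divide_eq) auto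
  qed
  show ?thesis
  proof (rule summableI_nonneg_bounded)
    show "0 \<le> p n * s ^ n" for n using s p_nonneg by simp
    show "(\<Sum>n<N. p n * s ^ n) \<le> 1 / c / (1 - (s - 1) * D)" for N
    proof -
      have "(\<Sum>n<N. p n * s ^ n) \<le> P N" unfolding P_def using s p_nonneg by (intro sum_mono2) auto
      then show ?thesis using bound[of N] by linarith
    qed
  qed
qed

text \<open>The bracket equals \<open>c * (p n + conv n)\<close>, and both parts are summable
  against \<open>s ^ n\<close>.\<close>

lemma subcritical_delayed:
  assumes s: "1 \<le> s" and b: "summable (\<lambda>n. b n * s ^ n)" and D: "(s - 1) * (\<Sum>n. b n * s ^ n) < 1"
  shows "(\<lambda>n. (1 - c * (\<Sum>k<n. p k)) * s ^ n) \<longlonglongrightarrow> 0"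
proof -
  note p = subcritical[OF assms]
  have tail: "1 - c * (\<Sum>k<n. p k) = c * (p n + conv n)" for n
    using sum_p_conv[of n] by (simp add: algebra_simps flip: lessThan_Suc_atMost)
  then have eq: "(\<lambda>n. (1 - c * (\<Sum>k<n. p k)) * s ^ n) = (\<lambda>n. c * (p n * s ^ n + conv n * s ^ n))"
    unfolding tail by (simp add: algebra_simps)
  have "summable (\<lambda>n. c * (p n * s ^ n + conv n * s ^ n))"
    using p conv_sums[OF _ b p] s by (intro summable_mult summable_add) (auto simp: sums_iff)
  then show ?thesis unfolding eq by (rule summable_LIMSEQ_zero)
qed

text \<open>If \<open>p n * s ^ n\<close> never exceeded 1, P(t) would converge for 1 < t < s, and
  P(t) (1 - (t - 1) D(t)) = 1/c > 0 would keep (t - 1) D(t) at most 1. Partial sums of D allow the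
  limit t -> s even when D(s) diverges.\<close>

lemma supercritical:
  assumes s: "1 < s" and b: "\<And>t. 0 \<le> t \<Longrightarrow> t < s \<Longrightarrow> summable (\<lambda>n. b n * t ^ n)"
    and D: "1 < (s - 1) * (\<Sum>k<N. b k * s ^ k)"
  shows "\<exists>n. 1 < p n * s ^ n"
proof (rule ccontr)
  assume "\<nexists>n. 1 < p n * s ^ n"
  then have ps: "p n * s ^ n \<le> 1" for n by (simp add: not_less)
  have less: "(t - 1) * (\<Sum>k<N. b k * t ^ k) \<le> 1" if t: "1 < t" "t < s" for t
  proof -
    define P where "P = (\<Sum>n. p n * t ^ n)"
    define D where "D = (\<Sum>n. b n * t ^ n)"
    have bt: "summable (\<lambda>n. b n * t ^ n)" using b t by simp
    have pt: "summable (\<lambda>n. p n * t ^ n)"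
    proof (rule summable_comparison_test[OF _ summable_geometric[of "t / s"]])
      show "\<exists>N. \<forall>n\<ge>N. norm (p n * t ^ n) \<le> (t / s) ^ n"
      proof (intro exI allI impI)
        fix n
        have "p n * t ^ n = (p n * s ^ n) * (t / s) ^ n" using s by (simp add: power_divide)
        also have "\<dots> \<le> 1 * (t / s) ^ n" using ps[of n] t by (intro mult_right_mono) auto
        finally show "norm (p n * t ^ n) \<le> (t / s) ^ n" using p_nonneg t by simp
      qed
    qed (use t in auto)
    have X: "(\<lambda>n. conv n * t ^ n) sums (D * P)"
      unfolding D_def P_def using t bt pt by (intro conv_sums) auto
    have "(\<lambda>n. p (Suc n) * t ^ Suc n) sums (P - p 0)"
      using sums_Suc_imp summable_sums[OF pt] sums_Suc_iff[of "\<lambda>n. p n * t ^ n" "P - p 0"] by (simp add: P_def)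
    moreover have "(\<lambda>n. conv (Suc n) * t ^ Suc n) sums (D * P - conv 0)"
      using X sums_Suc_iff[of "\<lambda>n. conv n * t ^ n" "D * P - conv 0"] by simp
    then have "(\<lambda>n. t * (conv n * t ^ n) - conv (Suc n) * t ^ Suc n) sums (t * (D * P) - (D * P - conv 0))"
      using X by (intro sums_diff sums_mult)
    moreover have "t * (conv n * t ^ n) - conv (Suc n) * t ^ Suc n = p (Suc n) * t ^ Suc n" for n
      by (simp add: p_Suc algebra_simps)
    ultimately have "P - p 0 = t * (D * P) - (D * P - conv 0)"
      using sums_unique2 by fastforce
    then have "P * (1 - (t - 1) * D) = 1 / c" using p_0 by (simp add: algebra_simps)
    then have "0 < P * (1 - (t - 1) * D)" using c_pos by simp
    moreover have "0 < P"
      unfolding P_def by (rule suminf_pos2[OF pt, of 0]) (use p_nonneg p_0_pos t in auto)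
    ultimately have "(t - 1) * D \<le> 1" by (simp add: zero_less_mult_iff)
    moreover have "(\<Sum>k<N. b k * t ^ k) \<le> D"
      unfolding D_def using bt b_nonneg t by (intro sum_le_suminf) auto
    then have "(t - 1) * (\<Sum>k<N. b k * t ^ k) \<le> (t - 1) * D" using t by (intro mult_left_mono) auto
    ultimately show ?thesis by linarith
  qed
  have "((\<lambda>t. (t - 1) * (\<Sum>k<N. b k * t ^ k)) \<longlongrightarrow> (s - 1) * (\<Sum>k<N. b k * s ^ k)) (at_left s)"
    by (intro tendsto_intros)
  moreover have "eventually (\<lambda>t. (t - 1) * (\<Sum>k<N. b k * t ^ k) \<le> 1) (at_left s)"
    using eventually_at_left_real[OF s] by (rule eventually_mono) (use less in auto)
  ultimately have "(s - 1) * (\<Sum>k<N. b k * s ^ k) \<le> 1"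
    by (rule tendsto_upperbound) simp
  then show False using D by simp
qed

end

section \<open>Clusters and the block branching process\<close>

lemma loop_vertices_subset: "c \<in> loops d \<Longrightarrow> loop_vertices c \<subseteq> tree_vertices d \<and> loop_vertices c \<noteq> {}"
  by (elim loop_representative) (auto simp: based_loops_def)

lemma successively_last:
  assumes "successively R cs" "cs \<noteq> []" "P (hd cs)"
    and "\<And>c c'. c' \<in> set cs \<Longrightarrow> R c c' \<Longrightarrow> P c \<Longrightarrow> P c'"
  shows "P (last cs)"
  using assms by (induction cs) (auto simp: successively_Cons split: if_splits)

text \<open>Every open loop lies entirely inside or entirely outside the subtree below an uncovered
  edge, so a chain of intersecting loops from the root never enters it.\<close>

lemma loop_connected_conn:
  assumes v: "v \<in> tree_vertices d" and lc: "loop_connected d \<omega> [] v"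
  shows "conn d [] v \<omega>"
proof (cases "v = []")
  case False
  then obtain cs where cs: "cs \<noteq> []" "set cs \<subseteq> open_loops d \<omega>" "[] \<in> loop_vertices (hd cs)"
    "v \<in> loop_vertices (last cs)" "successively (\<lambda>c c'. loop_vertices c \<inter> loop_vertices c' \<noteq> {}) cs"
    using lc by (auto simp: loop_connected_def)
  show ?thesis
    unfolding conn_def
  proof (intro ballI, rule ccontr)
    fix u assume u: "u \<in> below [] v" and no: "\<not> hit (cross d [] u) \<omega>"
    have dich: "loop_vertices c \<subseteq> subtree d u \<or> loop_vertices c \<inter> subtree d u = {}" if c: "c \<in> set cs" for c
    proof (rule ccontr)
      assume "\<not> ?thesis"
      then obtain a b where ab: "a \<in> loop_vertices c" "a \<in> subtree d u" "b \<in> loop_vertices c" "b \<notin> subtree d u"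
        by auto
      have cl: "c \<in> loops d" "1 \<le> \<omega> c" using c cs(2) by (auto simp: open_loops_def)
      obtain l where l: "l \<in> based_loops d" "c = cyclic_shift d `` {l}" "loop_vertices c = set l"
        by (rule loop_representative[OF cl(1)])
      have "u \<in> loop_vertices c \<and> tl u \<in> loop_vertices c"
        using based_loop_cross[OF l(1), of a u b] ab l(3) by simp
      then have "c \<in> cross d [] u"
        using cl(1) loop_vertices_subset[OF cl(1)] by (auto simp: cross_def subtree_def)
      then show False using no cl(2) by (auto simp: hit_def)
    qed
    have "loop_vertices (last cs) \<inter> subtree d u = {}"
    proof (rule successively_last[OF cs(5,1)])
      have "[] \<notin> subtree d u" using u by (auto simp: below_def subtree_def)
      then show "loop_vertices (hd cs) \<inter> subtree d u = {}"
        using dich[of "hd cs"] cs(1,3) by auto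
    qed (use dich in blast)
    moreover have "v \<in> subtree d u" using u v by (auto simp: below_def subtree_def)
    ultimately show False using cs(4) by auto
  qed
qed simp

lemma conn_loop_connected:
  assumes "v \<in> tree_vertices d" "conn d [] v \<omega>"
  shows "loop_connected d \<omega> [] v"
  using assms
proof (induction v rule: list.induct)
  case (Cons x v)
  then have v: "loop_connected d \<omega> [] v" and "hit (cross d [] (x # v)) \<omega>"
    by (auto simp: conn_Cons tree_vertices_Cons_iff)
  then obtain c where c: "c \<in> open_loops d \<omega>" "x # v \<in> loop_vertices c" "v \<in> loop_vertices c"
    by (auto simp: hit_def cross_def open_loops_def)
  show ?case
  proof (cases "v = []")
    case True
    then show ?thesis using c unfolding loop_connected_def by (intro disjI2 exI[of _ "[c]"]) auto
  next
    case False
    then obtain cs where cs: "cs \<noteq> []" "set cs \<subseteq> open_loops d \<omega>" "[] \<in> loop_vertices (hd cs)"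
      "v \<in> loop_vertices (last cs)" "successively (\<lambda>c c'. loop_vertices c \<inter> loop_vertices c' \<noteq> {}) cs"
      using v by (auto simp: loop_connected_def)
    then show ?thesis
      using c unfolding loop_connected_def
      by (intro disjI2 exI[of _ "cs @ [c]"]) (auto simp: successively_append_iff)
  qed
qed (simp add: loop_connected_def)

lemma cluster_eq: "cluster d \<omega> [] = {v \<in> tree_vertices d. conn d [] v \<omega>}"
  using loop_connected_conn conn_loop_connected by (auto simp: cluster_def)

section \<open>Levels of the tree\<close>

definition level :: "nat \<Rightarrow> nat \<Rightarrow> nat list \<Rightarrow> nat list set" where
  "level d n x = {y \<in> subtree d x. length y = length x + n}"

lemma level_eq:
  assumes x: "x \<in> tree_vertices d" "x \<noteq> []"
  shows "level d n x = (\<lambda>q. q @ x) ` {q. set q \<subseteq> {..<d - 1} \<and> length q = n}"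
proof -
  have "q @ x \<in> tree_vertices d \<longleftrightarrow> set q \<subseteq> {..<d - 1}" for q
    using x by (induction q) (auto simp: tree_vertices_Cons_iff)
  then show ?thesis by (auto simp: level_def subtree_def suffix_def)
qed

lemma card_level: "x \<in> tree_vertices d \<Longrightarrow> x \<noteq> [] \<Longrightarrow> card (level d n x) = (d - 1) ^ n"
  by (simp add: level_eq card_image inj_on_def card_lists_length_eq)

lemma finite_tree_vertices_length: "finite {v \<in> tree_vertices d. length v \<le> n}"
proof -
  have "set v \<subseteq> {..d}" if "v \<in> tree_vertices d" for v
    using that by (induction rule: tree_vertices.induct) (auto split: if_splits)
  then have "{v \<in> tree_vertices d. length v \<le> n} \<subseteq> {v. set v \<subseteq> {..d} \<and> length v \<le> n}" by auto
  then show ?thesis by (rule finite_subset) (simp add: finite_lists_length_le)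
qed

lemma finite_level [simp]: "finite (level d n x)"
  by (rule finite_subset[OF _ finite_tree_vertices_length[of d "length x + n"]])
    (auto simp: level_def subtree_def)

lemma card_level_root: "card (level d (Suc n) []) \<le> d * (d - 1) ^ n"
proof -
  have "level d (Suc n) [] \<subseteq> (\<Union>i<d. level d n [i])"
  proof
    fix v assume v: "v \<in> level d (Suc n) []"
    then obtain q i where q: "v = q @ [i]" by (cases v rule: rev_cases) (auto simp: level_def)
    have "[i] \<in> tree_vertices d" using v q tree_vertices_suffix[of v d "[i]"] by (auto simp: level_def subtree_def suffix_def)
    then have "i < d" by (simp add: tree_vertices_Cons_iff)
    moreover have "v \<in> level d n [i]" using v q by (auto simp: level_def subtree_def suffix_def)
    ultimately show "v \<in> (\<Union>i<d. level d n [i])" by auto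
  qed
  then have "card (level d (Suc n) []) \<le> card (\<Union>i<d. level d n [i])"
    by (intro card_mono) auto
  also have "\<dots> \<le> (\<Sum>i<d. card (level d n [i]))" by (rule card_UN_le) simp
  also have "\<dots> = d * (d - 1) ^ n"
    by (simp add: card_level tree_vertices_Cons_iff tree_vertices.root)
  finally show ?thesis .
qed

lemma infinite_clusterI:
  assumes "\<And>m. \<exists>v. m \<le> length v \<and> v \<in> cluster d \<omega> []"
  shows "infinite (cluster d \<omega> [])"
proof
  assume fin: "finite (cluster d \<omega> [])"
  obtain v where v: "Suc (Max (length ` cluster d \<omega> [])) \<le> length v" "v \<in> cluster d \<omega> []"
    using assms by blast
  have "length v \<le> Max (length ` cluster d \<omega> [])" using fin v(2) by simp
  then show False using v(1) by simp
qed

lemma infinite_cluster_level: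
  assumes "infinite (cluster d \<omega> [])"
  shows "\<exists>v\<in>level d n []. conn d [] v \<omega>"
proof -
  have "\<not> cluster d \<omega> [] \<subseteq> {v \<in> tree_vertices d. length v \<le> n}"
    using assms finite_tree_vertices_length finite_subset by blast
  then obtain v where "v \<in> cluster d \<omega> []" "v \<notin> {v \<in> tree_vertices d. length v \<le> n}" by blast
  then have v: "v \<in> tree_vertices d" "conn d [] v \<omega>" "n < length v"
    by (auto simp: cluster_eq)
  let ?u = "drop (length v - n) v"
  have "suffix ?u v" by (rule suffix_drop)
  then have "?u \<in> level d n []" "conn d [] ?u \<omega>"
    using v tree_vertices_suffix conn_suffix by (auto simp: level_def subtree_def)
  then show ?thesis by blast
qed

text \<open>The linear term carries the mean offspring number; a small \<open>\<delta>\<close>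
  absorbs the quadratic error in the survival recursion.\<close>

lemma power_one_minus_le:
  fixes \<delta> :: real
  assumes "0 \<le> \<delta>" "\<delta> \<le> 1"
  shows "(1 - \<delta>) ^ k \<le> 1 - real k * \<delta> + (real k)\<^sup>2 * \<delta>\<^sup>2"
proof (induction k)
  case (Suc k)
  have "(1 - \<delta>) ^ Suc k \<le> (1 - real k * \<delta> + (real k)\<^sup>2 * \<delta>\<^sup>2) * (1 - \<delta>)"
    using mult_left_mono[OF Suc, of "1 - \<delta>"] assms by (simp add: mult.commute)
  also have "\<dots> = 1 - real (Suc k) * \<delta> + (real k + (real k)\<^sup>2) * \<delta>\<^sup>2 - (real k)\<^sup>2 * \<delta>\<^sup>2 * \<delta>"
    by (simp add: algebra_simps power2_eq_square)
  also have "\<dots> \<le> 1 - real (Suc k) * \<delta> + (real k + (real k)\<^sup>2) * \<delta>\<^sup>2"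
    using assms by simp
  also have "\<dots> \<le> 1 - real (Suc k) * \<delta> + (real (Suc k))\<^sup>2 * \<delta>\<^sup>2"
    by (intro add_left_mono mult_right_mono) (auto simp: power2_eq_square algebra_simps)
  finally show ?case .
qed simp

text \<open>The block Galton--Watson process: from \<open>x\<close> one keeps the descendants \<open>n\<close> levels below that are
  reached by loops inside the subtree of \<open>x\<close>, and restarts in their disjoint subtrees.\<close>

primrec survives :: "nat \<Rightarrow> nat \<Rightarrow> nat \<Rightarrow> nat list \<Rightarrow> (nat list list set \<Rightarrow> nat) \<Rightarrow> bool" where
  "survives d n 0 x \<omega> \<longleftrightarrow> True"
| "survives d n (Suc m) x \<omega> \<longleftrightarrow> (\<exists>y\<in>level d n x. conn d x y \<omega> \<and> survives d n m y \<omega>)"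

lemma survives_conn:
  assumes "survives d n m x \<omega>" "x \<in> tree_vertices d"
  shows "\<exists>v\<in>subtree d x. length v = length x + m * n \<and> conn d x v \<omega>"
  using assms
proof (induction m arbitrary: x)
  case 0
  then show ?case using self_in_subtree by (intro bexI[of _ x]) auto
next
  case (Suc m)
  then obtain y where y: "y \<in> level d n x" "conn d x y \<omega>" "survives d n m y \<omega>" by auto
  then have "y \<in> tree_vertices d" "suffix x y" "length y = length x + n"
    by (auto simp: level_def subtree_def)
  moreover obtain v where v: "v \<in> subtree d y" "length v = length y + m * n" "conn d y v \<omega>"
    using Suc.IH[OF y(3)] calculation by blast
  ultimately show ?case
    using conn_trans[OF y(2) v(3)] subtree_subset[of x y d]
    by (intro bexI[of _ v]) (auto simp: subtree_def)
qed

section \<open>Branching recursion for the block process\<close>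

context soup
begin

lemma loops_in_mono: "suffix x y \<Longrightarrow> loops_in d y \<subseteq> loops_in d x"
  using subtree_subset[of x y d] by (auto simp: loops_in_def)

lemma survives_local: "{\<omega> \<in> space Q. survives d n m x \<omega>} \<in> sets (local_sigma (loops_in d x))"
proof (induction m arbitrary: x)
  case 0
  then show ?case using sets.top[of "local_sigma (loops_in d x)"] by simp
next
  case (Suc m)
  have "{\<omega> \<in> space Q. conn d x y \<omega>} \<inter> {\<omega> \<in> space Q. survives d n m y \<omega>} \<in> sets (local_sigma (loops_in d x))"
    if "y \<in> level d n x" for y
    using Suc[of y] local_sigma_mono[OF loops_in_mono[of x y]] that conn_local_loops_in
    by (intro sets.Int) (auto simp: level_def subtree_def)
  then have "(\<Union>y\<in>level d n x. {\<omega> \<in> space Q. conn d x y \<omega>} \<inter> {\<omega> \<in> space Q. survives d n m y \<omega>})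
    \<in> sets (local_sigma (loops_in d x))"
    by (intro sets.finite_UN) auto
  moreover have "(\<Union>y\<in>level d n x. {\<omega> \<in> space Q. conn d x y \<omega>} \<inter> {\<omega> \<in> space Q. survives d n m y \<omega>}) =
    {\<omega> \<in> space Q. survives d n (Suc m) x \<omega>}"
    by auto
  ultimately show ?case by simp
qed

lemma survives_events: "{\<omega> \<in> space Q. survives d n m x \<omega>} \<in> events"
  using survives_local local_sigma_events[of "loops_in d x"] by (auto simp: loops_in_def)

definition offspring :: "nat \<Rightarrow> nat list \<Rightarrow> (nat list list set \<Rightarrow> nat) \<Rightarrow> nat list set" where
  "offspring n x \<omega> = {y \<in> level d n x. conn d x y \<omega>}"

text \<open>Survival beyond different offspring depends on loops in disjoint subtrees, and none of
  these loops takes part in deciding the offspring set.\<close>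

lemma prob_not_survives:
  assumes x: "x \<in> tree_vertices d"
  shows "prob {\<omega> \<in> space Q. \<not> survives d n (Suc m) x \<omega>} =
    (\<Sum>A\<in>Pow (level d n x). prob {\<omega> \<in> space Q. offspring n x \<omega> = A} *
       (\<Prod>y\<in>A. prob {\<omega> \<in> space Q. \<not> survives d n m y \<omega>}))"
proof -
  let ?Y = "level d n x"
  let ?K = "\<Union>y\<in>?Y. \<Union>u\<in>below x y. cross d x u"
  let ?X = "\<lambda>A. {\<omega> \<in> space Q. offspring n x \<omega> = A}"
  let ?S = "\<lambda>y. {\<omega> \<in> space Q. \<not> survives d n m y \<omega>}"
  have K: "?K \<subseteq> loops d" using cross_subset_loops by blast
  have conn_K: "{\<omega> \<in> space Q. conn d x y \<omega>} \<in> sets (local_sigma ?K)" if "y \<in> ?Y" for y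
    using that K by (intro conn_local) auto
  have X: "?X A \<in> sets (local_sigma ?K)" if "A \<subseteq> ?Y" for A
  proof -
    have "{\<omega> \<in> space (local_sigma ?K). \<forall>y\<in>?Y. conn d x y \<omega> \<longleftrightarrow> y \<in> A} \<in> sets (local_sigma ?K)"
    proof (rule sets.sets_Collect_finite_All[OF _ finite_level])
      fix y assume y: "y \<in> ?Y"
      show "{\<omega> \<in> space (local_sigma ?K). conn d x y \<omega> \<longleftrightarrow> y \<in> A} \<in> sets (local_sigma ?K)"
        using conn_K[OF y] sets.sets_Collect_neg[of "local_sigma ?K" "conn d x y"] by (cases "y \<in> A") auto
    qed
    moreover have "?X A = {\<omega> \<in> space (local_sigma ?K). \<forall>y\<in>?Y. conn d x y \<omega> \<longleftrightarrow> y \<in> A}"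
      using that by (auto simp: offspring_def)
    ultimately show ?thesis by simp
  qed
  have S: "?S y \<in> sets (local_sigma (loops_in d y))" for y
    using sets.sets_Collect_neg[of "local_sigma (loops_in d y)" "survives d n m y"] survives_local by simp
  have Xev: "?X A \<in> events" if "A \<subseteq> ?Y" for A using X[OF that] local_sigma_events[OF K] by blast
  have Sev: "?S y \<in> events" for y
    using S[of y] local_sigma_events[of "loops_in d y"] by (auto simp: loops_in_def)
  have indep: "prob (?X A \<inter> (\<Inter>y\<in>A. ?S y)) = prob (?X A) * (\<Prod>y\<in>A. prob (?S y))" if A: "A \<subseteq> ?Y" for A
  proof (rule indep_local_INT[OF _ K _ _ _ X[OF A] S])
    show "finite A" by (rule finite_subset[OF A finite_level])
    show "loops_in d y \<subseteq> loops d" for y by (auto simp: loops_in_def)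
    \<comment> \<open>A loop in \<open>?K\<close> contains some \<open>tl u\<close> strictly above
      the offspring level, so it is not contained in the subtree of an offspring.\<close>
    show "?K \<inter> loops_in d y = {}" if "y \<in> A" for y
    proof -
      have "tl u \<notin> subtree d y" if "z \<in> ?Y" "u \<in> below x z" for u z
      proof
        assume "tl u \<in> subtree d y"
        then have "length y \<le> length (tl u)" by (auto simp: subtree_def dest: suffix_length_le)
        moreover have "length y = length x + n" "length z = length x + n"
          using \<open>y \<in> A\<close> A that by (auto simp: level_def)
        moreover have "length u \<le> length z" "length u > 0"
          using that suffix_length_le by (auto simp: below_def)
        ultimately show False using length_tl[of u] by linarith
      qed
      then show ?thesis by (fastforce simp: cross_def loops_in_def)
    qed
    show "disjoint_family_on (loops_in d) A"
    proof (unfold disjoint_family_on_def, intro ballI impI)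
      fix y z assume "y \<in> A" "z \<in> A" "y \<noteq> z"
      then have "y \<in> level d n x" "z \<in> level d n x" using A by auto
      then have "subtree d y \<inter> subtree d z = {}"
        using \<open>y \<noteq> z\<close> by (intro subtree_disjoint) (auto simp: level_def)
      then show "loops_in d y \<inter> loops_in d z = {}"
        using loop_vertices_subset by (fastforce simp: loops_in_def)
    qed
  qed
  have "prob {\<omega> \<in> space Q. \<not> survives d n (Suc m) x \<omega>} = prob (\<Union>A\<in>Pow ?Y. ?X A \<inter> (\<Inter>y\<in>A. ?S y))"
    by (rule arg_cong[where f = prob]) (auto simp: offspring_def)
  also have "\<dots> = (\<Sum>A\<in>Pow ?Y. prob (?X A \<inter> (\<Inter>y\<in>A. ?S y)))"
  proof (rule finite_measure_finite_Union)
    show "(\<lambda>A. ?X A \<inter> (\<Inter>y\<in>A. ?S y)) ` Pow ?Y \<subseteq> events"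
    proof safe
      fix A assume A: "A \<subseteq> ?Y"
      have "finite A" by (rule finite_subset[OF A finite_level])
      then show "?X A \<inter> (\<Inter>y\<in>A. ?S y) \<in> events"
        using Xev[OF A] Sev by (cases "A = {}") auto
    qed
  qed (auto simp: disjoint_family_on_def)
  also have "\<dots> = (\<Sum>A\<in>Pow ?Y. prob (?X A) * (\<Prod>y\<in>A. prob (?S y)))"
  proof (rule sum.cong[OF refl])
    fix A assume "A \<in> Pow ?Y"
    then have "A \<subseteq> ?Y" by simp
    then show "prob (?X A \<inter> (\<Inter>y\<in>A. ?S y)) = prob (?X A) * (\<Prod>y\<in>A. prob (?S y))" by (rule indep)
  qed
  finally show ?thesis .
qed

lemma offspring_event: "A \<subseteq> level d n x \<Longrightarrow> {\<omega> \<in> space Q. offspring n x \<omega> = A} \<in> events"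
proof -
  assume A: "A \<subseteq> level d n x"
  have "{\<omega> \<in> space Q. \<forall>y\<in>level d n x. conn d x y \<omega> \<longleftrightarrow> y \<in> A} \<in> events"
  proof (rule sets.sets_Collect_finite_All[OF _ finite_level])
    fix y
    show "{\<omega> \<in> space Q. conn d x y \<omega> \<longleftrightarrow> y \<in> A} \<in> events"
      using conn_events[of x y] sets.sets_Collect_neg[of Q "conn d x y"] by (cases "y \<in> A") auto
  qed
  moreover have "{\<omega> \<in> space Q. offspring n x \<omega> = A} = {\<omega> \<in> space Q. \<forall>y\<in>level d n x. conn d x y \<omega> \<longleftrightarrow> y \<in> A}"
    using A by (auto simp: offspring_def)
  ultimately show ?thesis by simp
qed

lemma sum_offspring_prob:
  assumes "Z \<subseteq> Pow (level d n x)"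
  shows "(\<Sum>A\<in>Z. prob {\<omega> \<in> space Q. offspring n x \<omega> = A}) = prob {\<omega> \<in> space Q. offspring n x \<omega> \<in> Z}"
proof -
  have "finite Z" by (rule finite_subset[OF assms]) simp
  have "prob {\<omega> \<in> space Q. offspring n x \<omega> \<in> Z} = prob (\<Union>A\<in>Z. {\<omega> \<in> space Q. offspring n x \<omega> = A})"
    by (rule arg_cong[where f = prob]) auto
  also have "\<dots> = (\<Sum>A\<in>Z. prob {\<omega> \<in> space Q. offspring n x \<omega> = A})"
    using \<open>finite Z\<close> assms offspring_event
    by (intro finite_measure_finite_Union) (auto simp: disjoint_family_on_def)
  finally show ?thesis ..
qed

lemma mean_offspring:
  "(\<Sum>A\<in>Pow (level d n x). prob {\<omega> \<in> space Q. offspring n x \<omega> = A} * real (card A)) =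
    (\<Sum>y\<in>level d n x. prob {\<omega> \<in> space Q. conn d x y \<omega>})"
proof -
  let ?Y = "level d n x" and ?p = "\<lambda>A. prob {\<omega> \<in> space Q. offspring n x \<omega> = A}"
  have "(\<Sum>A\<in>Pow ?Y. ?p A * real (card A)) = (\<Sum>A\<in>Pow ?Y. \<Sum>y\<in>?Y. if y \<in> A then ?p A else 0)"
  proof (rule sum.cong[OF refl])
    fix A assume "A \<in> Pow ?Y"
    then have "?Y \<inter> {y. y \<in> A} = A" by auto
    then show "?p A * real (card A) = (\<Sum>y\<in>?Y. if y \<in> A then ?p A else 0)"
      by (simp add: sum.If_cases)
  qed
  also have "\<dots> = (\<Sum>y\<in>?Y. \<Sum>A\<in>Pow ?Y. if y \<in> A then ?p A else 0)" by (rule sum.swap)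
  also have "\<dots> = (\<Sum>y\<in>?Y. \<Sum>A\<in>{A \<in> Pow ?Y. y \<in> A}. ?p A)"
    by (intro sum.cong refl sum.inter_filter[symmetric]) auto
  also have "\<dots> = (\<Sum>y\<in>?Y. prob {\<omega> \<in> space Q. offspring n x \<omega> \<in> {A \<in> Pow ?Y. y \<in> A}})"
    by (intro sum.cong refl sum_offspring_prob) auto
  also have "\<dots> = (\<Sum>y\<in>?Y. prob {\<omega> \<in> space Q. conn d x y \<omega>})"
    by (intro sum.cong refl arg_cong[where f = prob]) (auto simp: offspring_def)
  finally show ?thesis .
qed

end

section \<open>Second-order survival bound and first-moment extinction bound\<close>

context tree_soup
begin

text \<open>With K = (d - 1)^n, if each offspring survives with probability at least
  \<open>\<delta>\<close>, the parent survives with probability at least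
  \<open>K * conn_prob n * \<delta> - K\<^sup>2 * \<delta>\<^sup>2\<close>. The third hypothesis
  makes this at least \<open>\<delta>\<close> again.\<close>

lemma prob_survives_ge:
  assumes \<delta>: "0 \<le> \<delta>" "\<delta> \<le> 1" "\<delta> \<le> real ((d - 1) ^ n) * conn_prob n * \<delta> - (real ((d - 1) ^ n))\<^sup>2 * \<delta>\<^sup>2"
    and x: "x \<in> tree_vertices d" "x \<noteq> []"
  shows "\<delta> \<le> prob {\<omega> \<in> space Q. survives d n m x \<omega>}"
  using x
proof (induction m arbitrary: x)
  case 0
  then show ?case using \<delta> prob_space by simp
next
  case (Suc m)
  let ?Y = "level d n x" and ?p = "\<lambda>A. prob {\<omega> \<in> space Q. offspring n x \<omega> = A}"
  define K where "K = real ((d - 1) ^ n)"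
  have K: "real (card ?Y) = K" using Suc.prems by (simp add: card_level K_def)
  have compl: "prob {\<omega> \<in> space Q. \<not> survives d n j y \<omega>} = 1 - prob {\<omega> \<in> space Q. survives d n j y \<omega>}" for j y
    using prob_neg[OF survives_events] by simp
  have "prob {\<omega> \<in> space Q. \<not> survives d n (Suc m) x \<omega>} =
    (\<Sum>A\<in>Pow ?Y. ?p A * (\<Prod>y\<in>A. prob {\<omega> \<in> space Q. \<not> survives d n m y \<omega>}))"
    by (rule prob_not_survives[OF Suc.prems(1)])
  also have "\<dots> \<le> (\<Sum>A\<in>Pow ?Y. ?p A * (1 - real (card A) * \<delta> + K\<^sup>2 * \<delta>\<^sup>2))"
  proof (intro sum_mono mult_left_mono)
    fix A assume A: "A \<in> Pow ?Y"
    then have "card A \<le> card ?Y" by (intro card_mono) auto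
    then have cA: "real (card A) \<le> K" using K by linarith
    have "(\<Prod>y\<in>A. prob {\<omega> \<in> space Q. \<not> survives d n m y \<omega>}) \<le> (\<Prod>y\<in>A. 1 - \<delta>)"
    proof (rule prod_mono, safe)
      fix y assume "y \<in> A"
      then have "y \<in> tree_vertices d" "y \<noteq> []"
        using A Suc.prems(2) by (auto simp: level_def subtree_def)
      then show "prob {\<omega> \<in> space Q. \<not> survives d n m y \<omega>} \<le> 1 - \<delta>"
        unfolding compl using Suc.IH by simp
    qed simp
    also have "\<dots> = (1 - \<delta>) ^ card A" by simp
    also have "\<dots> \<le> 1 - real (card A) * \<delta> + (real (card A))\<^sup>2 * \<delta>\<^sup>2"
      by (rule power_one_minus_le[OF \<delta>(1,2)])
    also have "\<dots> \<le> 1 - real (card A) * \<delta> + K\<^sup>2 * \<delta>\<^sup>2"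
      using cA by (intro add_left_mono mult_right_mono power_mono) auto
    finally show "(\<Prod>y\<in>A. prob {\<omega> \<in> space Q. \<not> survives d n m y \<omega>}) \<le> \<dots>" .
  qed simp
  also have "\<dots> = (\<Sum>A\<in>Pow ?Y. ?p A) * (1 + K\<^sup>2 * \<delta>\<^sup>2) - (\<Sum>A\<in>Pow ?Y. ?p A * real (card A)) * \<delta>"
    unfolding sum_distrib_right sum_subtractf[symmetric]
    by (intro sum.cong refl) (auto simp: algebra_simps)
  also have "(\<Sum>A\<in>Pow ?Y. ?p A) = 1"
    by (subst sum_offspring_prob) (auto simp: offspring_def prob_space)
  also have "(\<Sum>A\<in>Pow ?Y. ?p A * real (card A)) = K * conn_prob n"
  proof -
    have "prob {\<omega> \<in> space Q. conn d x y \<omega>} = conn_prob n" if "y \<in> ?Y" for y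
      using that Suc.prems(2) prob_conn[of y x] by (auto simp: level_def)
    then show ?thesis unfolding mean_offspring by (simp add: K)
  qed
  finally show ?case using \<delta>(3) unfolding compl K_def by simp
qed

lemma prob_reach_infinity_pos:
  assumes n: "1 < real ((d - 1) ^ n) * conn_prob n" and x: "x \<in> tree_vertices d" "x \<noteq> []"
  shows "0 < prob {\<omega> \<in> space Q. \<forall>m. \<exists>v\<in>subtree d x. m \<le> length v \<and> conn d x v \<omega>}"
    and "{\<omega> \<in> space Q. \<forall>m. \<exists>v\<in>subtree d x. m \<le> length v \<and> conn d x v \<omega>} \<in> sets (local_sigma (loops_in d x))"
proof -
  let ?F = "\<lambda>m. {\<omega> \<in> space Q. \<exists>v\<in>subtree d x. m \<le> length v \<and> conn d x v \<omega>}"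
  define K where "K = real ((d - 1) ^ n)"
  have K1: "1 \<le> K" using d3 by (simp add: K_def)
  have c0: "conn_prob 0 = 1" using conn_prob_renewal[of 0] by (simp add: closed_prob_0)
  \<comment> \<open>For \<open>n = 0\<close> the mean would be 1. Hence \<open>m\<close> blocks
    reach depth at least \<open>m\<close>.\<close>
  have n0: "0 < n" using n c0 by (cases n) auto
  \<comment> \<open>Chosen so that \<open>K\<^sup>2 * \<delta>\<close> does not exceed the excess of
    the mean offspring number over 1.\<close>
  define \<delta> where "\<delta> = min 1 ((K * conn_prob n - 1) / K\<^sup>2)"
  have \<delta>: "0 < \<delta>" "\<delta> \<le> 1" proof -
    have "1 < K * conn_prob n" using n unfolding K_def .
    then have "0 < (K * conn_prob n - 1) / K\<^sup>2" using K1 by (intro divide_pos_pos) auto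
    then show "0 < \<delta>" "\<delta> \<le> 1" by (auto simp: \<delta>_def)
  qed
  have "K\<^sup>2 * \<delta> \<le> K * conn_prob n - 1"
    using K1 mult_left_mono[of \<delta> "(K * conn_prob n - 1) / K\<^sup>2" "K\<^sup>2"] by (auto simp: \<delta>_def)
  then have "\<delta> * (K\<^sup>2 * \<delta>) \<le> \<delta> * (K * conn_prob n - 1)" using \<delta> by (intro mult_left_mono) auto
  then have \<delta>3: "\<delta> \<le> K * conn_prob n * \<delta> - K\<^sup>2 * \<delta>\<^sup>2" by (simp add: algebra_simps power2_eq_square)
  have Floc: "?F m \<in> sets (local_sigma (loops_in d x))" for m
  proof -
    have "countable {v \<in> subtree d x. m \<le> length v}" by simp
    then have "(\<Union>v\<in>{v \<in> subtree d x. m \<le> length v}. {\<omega> \<in> space Q. conn d x v \<omega>}) \<in> sets (local_sigma (loops_in d x))"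
      using conn_local_loops_in by (intro sets.countable_UN'') auto
    moreover have "(\<Union>v\<in>{v \<in> subtree d x. m \<le> length v}. {\<omega> \<in> space Q. conn d x v \<omega>}) = ?F m" by auto
    ultimately show ?thesis by (simp only:)
  qed
  have "loops_in d x \<subseteq> loops d" by (auto simp: loops_in_def)
  then have Fev: "?F m \<in> events" for m
    using Floc[of m] local_sigma_events[of "loops_in d x"] by blast
  have eq: "{\<omega> \<in> space Q. \<forall>m. \<exists>v\<in>subtree d x. m \<le> length v \<and> conn d x v \<omega>} = (\<Inter>m. ?F m)" by auto
  show "{\<omega> \<in> space Q. \<forall>m. \<exists>v\<in>subtree d x. m \<le> length v \<and> conn d x v \<omega>} \<in> sets (local_sigma (loops_in d x))"
    unfolding eq by (rule sets.countable_INT) (use Floc in blast)+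
  have lower: "\<delta> \<le> prob (?F m)" for m
  proof -
    have "\<delta> \<le> prob {\<omega> \<in> space Q. survives d n m x \<omega>}"
      using \<delta> \<delta>3 x unfolding K_def by (intro prob_survives_ge) auto
    also have "\<dots> \<le> prob (?F m)"
    proof (rule finite_measure_mono[OF _ Fev], safe)
      fix \<omega> assume "survives d n m x \<omega>"
      then obtain v where v: "v \<in> subtree d x" "length v = length x + m * n" "conn d x v \<omega>"
        using survives_conn[OF _ x(1)] by blast
      have "m \<le> m * n" using n0 by simp
      then have "m \<le> length v" unfolding v(2) by (rule trans_le_add2)
      then show "\<exists>v\<in>subtree d x. m \<le> length v \<and> conn d x v \<omega>"
        using v(1,3) by blast
    qed
    finally show ?thesis .
  qed
  have lim: "(\<lambda>m. prob (?F m)) \<longlonglongrightarrow> prob (\<Inter>m. ?F m)"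
  proof (rule finite_Lim_measure_decseq)
    show "range ?F \<subseteq> events" using Fev by blast
    show "decseq ?F"
      unfolding decseq_def
    proof safe
      fix m m' :: nat and \<omega> v
      assume "m \<le> m'" "v \<in> subtree d x" "m' \<le> length v" "conn d x v \<omega>"
      then show "\<exists>v\<in>subtree d x. m \<le> length v \<and> conn d x v \<omega>"
        by (meson order_trans)
    qed
  qed
  have "\<delta> \<le> prob (\<Inter>m. ?F m)" by (rule LIMSEQ_le_const[OF lim]) (use lower in blast)
  then show "0 < prob {\<omega> \<in> space Q. \<forall>m. \<exists>v\<in>subtree d x. m \<le> length v \<and> conn d x v \<omega>}"
    unfolding eq using \<delta>(1) by linarith
qed

text \<open>The block process starts at a child of the root, since the root has a different number
  of children. Covering the connecting edge involves only loops not contained in the subtree of that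
  child.\<close>

lemma percolates:
  assumes n: "1 < real ((d - 1) ^ n) * conn_prob n" and \<alpha>: "0 < \<alpha>"
  shows "0 < percolation_prob d \<alpha> \<kappa>"
proof -
  have x: "[0] \<in> tree_vertices d" using d3 by (simp add: tree_vertices_Cons_iff tree_vertices.root)
  let ?G = "{\<omega> \<in> space Q. \<forall>m. \<exists>v\<in>subtree d [0]. m \<le> length v \<and> conn d [0] v \<omega>}"
  let ?H = "{\<omega> \<in> space Q. hit (cross d [] [0]) \<omega>}"
  have "prob {\<omega> \<in> space Q. \<not> hit (cross d [] [0]) \<omega>} = (1 - q) powr \<alpha>"
    using x prob_closed[of "[0]" "[]"] by (simp add: subtree_def)
  also have "\<dots> < 1"
    using q_pos q_less_1 \<alpha> powr_less_mono2[of \<alpha> "1 - q" 1] by simp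
  finally have H: "0 < prob ?H"
    using prob_neg[OF hit_events[OF cross_subset_loops]] by simp
  have "prob (?H \<inter> ?G) = prob ?H * prob ?G"
  proof (rule indep_local[OF cross_subset_loops _ _ hit_local[OF order_refl cross_subset_loops]])
    show "?G \<in> sets (local_sigma (loops_in d [0]))" by (rule prob_reach_infinity_pos(2)[OF n x]) simp
    show "cross d [] [0] \<inter> loops_in d [0] = {}" by (rule cross_disjoint_loops_in) simp
    show "loops_in d [0] \<subseteq> loops d" by (auto simp: loops_in_def)
  qed
  moreover have "0 < prob ?G" by (rule prob_reach_infinity_pos(1)[OF n x]) simp
  ultimately have "0 < prob (?H \<inter> ?G)" using H by (simp only: mult_pos_pos)
  also have "\<dots> \<le> percolation_prob d \<alpha> \<kappa>"
    unfolding percolation_prob_def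
  proof (rule finite_measure_mono[OF _ sets_infinite_cluster], safe)
    fix \<omega> assume \<omega>: "hit (cross d [] [0]) \<omega>" "\<forall>m. \<exists>v\<in>subtree d [0]. m \<le> length v \<and> conn d [0] v \<omega>"
      and fin: "finite (cluster d \<omega> [])"
    have "conn d [] [0] \<omega>" using \<omega>(1) by (simp add: conn_Cons)
    then have "v \<in> cluster d \<omega> []" if "v \<in> subtree d [0]" "conn d [0] v \<omega>" for v
      using that conn_trans[of d "[]" "[0]" \<omega> v] by (auto simp: cluster_eq subtree_def)
    then have "infinite (cluster d \<omega> [])" using \<omega>(2) by (intro infinite_clusterI) blast
    then show False using fin by simp
  qed
  finally show ?thesis .
qed

text \<open>An infinite cluster has a connected vertex on every level, and level n + 1 has at most d
  (d - 1)^n vertices.\<close>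

lemma not_percolates:
  assumes "(\<lambda>n. (1 - (1 - q) powr \<alpha> * (\<Sum>k<n. conn_prob k)) * (real d - 1) ^ n) \<longlonglongrightarrow> 0"
  shows "percolation_prob d \<alpha> \<kappa> = 0"
proof -
  define r where "r n = (1 - (1 - q) powr \<alpha> * (\<Sum>k<n. conn_prob k)) * (real d - 1) ^ n" for n
  have "percolation_prob d \<alpha> \<kappa> \<le> real d / (real d - 1) * r (Suc n)" for n
  proof -
    let ?Y = "level d (Suc n) []"
    have "percolation_prob d \<alpha> \<kappa> \<le> prob (\<Union>v\<in>?Y. {\<omega> \<in> space Q. conn d [] v \<omega>})"
      unfolding percolation_prob_def
      using conn_events infinite_cluster_level by (intro finite_measure_mono sets.finite_UN) fastforce+
    also have "\<dots> \<le> (\<Sum>v\<in>?Y. prob {\<omega> \<in> space Q. conn d [] v \<omega>})"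
      using conn_events by (intro finite_measure_subadditive_finite) auto
    also have "\<dots> = (\<Sum>v\<in>?Y. 1 - (1 - q) powr \<alpha> * (\<Sum>k<Suc n. conn_prob k))"
      using prob_conn_root by (intro sum.cong refl) (auto simp: level_def subtree_def)
    also have "\<dots> = real (card ?Y) * (1 - (1 - q) powr \<alpha> * (\<Sum>k<Suc n. conn_prob k))" by simp
    also have "\<dots> \<le> real (d * (d - 1) ^ n) * (1 - (1 - q) powr \<alpha> * (\<Sum>k<Suc n. conn_prob k))"
    proof (rule mult_right_mono)
      have v: "replicate n 0 @ [0] \<in> tree_vertices d" using replicate_in_subtree by (auto simp: subtree_def)
      show "0 \<le> 1 - (1 - q) powr \<alpha> * (\<Sum>k<Suc n. conn_prob k)"
        using prob_conn_root[OF v] measure_nonneg[of Q "{\<omega> \<in> space Q. conn d [] (replicate n 0 @ [0]) \<omega>}"] by simp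
    qed (use card_level_root in \<open>simp only: of_nat_le_iff\<close>)
    also have "\<dots> = real d / (real d - 1) * r (Suc n)"
      using d3 real_d by (simp add: r_def)
    finally show ?thesis .
  qed
  moreover have "(\<lambda>n. real d / (real d - 1) * r (Suc n)) \<longlonglongrightarrow> real d / (real d - 1) * 0"
    using assms unfolding r_def[symmetric] by (intro tendsto_mult_left LIMSEQ_Suc)
  ultimately have "percolation_prob d \<alpha> \<kappa> \<le> real d / (real d - 1) * 0"
    by (intro LIMSEQ_le_const) auto
  then show ?thesis by (simp add: percolation_prob_def antisym)
qed

end

section \<open>Infinite crossing masses\<close>

context soup
begin

lemma percolates_low:
  assumes d: "3 \<le> d" and \<kappa>: "1 < 4 * real (d - 1) * (1 / ((1 + \<kappa>) * real d))\<^sup>2" and \<alpha>: "0 < \<alpha>"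
  shows "0 < percolation_prob d \<alpha> \<kappa>"
proof -
  have \<omega>: "0 < 1 / ((1 + \<kappa>) * real d)" using \<kappa>_gt d by simp
  have AE1: "AE \<omega> in Q. hit (cross d [] v) \<omega>" if v: "v \<in> tree_vertices d" "v \<noteq> []" for v
  proof -
    have "prob {\<omega> \<in> space Q. \<not> hit (cross d [] v) \<omega>} = 0"
      unfolding cross_def
      using loop_mass_cross_infinite[OF _ v(2) \<kappa> \<omega>] v \<alpha> by (intro prob_not_hit(2)) (auto simp: subtree_def)
    moreover have "{\<omega> \<in> space Q. \<not> hit (cross d [] v) \<omega>} \<in> events"
      by (intro sets.sets_Collect_neg hit_events cross_subset_loops)
    ultimately show ?thesis by (simp add: prob_Collect_eq_0)
  qed
  have "AE \<omega> in Q. \<forall>v\<in>{v \<in> tree_vertices d. v \<noteq> []}. hit (cross d [] v) \<omega>"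
    using AE1 by (subst AE_ball_countable) auto
  then have "AE \<omega> in Q. infinite (cluster d \<omega> [])"
  proof (rule eventually_mono)
    fix \<omega> assume *: "\<forall>v\<in>{v \<in> tree_vertices d. v \<noteq> []}. hit (cross d [] v) \<omega>"
    have "conn d [] v \<omega>" if "v \<in> tree_vertices d" for v
      unfolding conn_def using * that tree_vertices_suffix by (auto simp: below_def)
    then have "cluster d \<omega> [] = tree_vertices d" by (auto simp: cluster_eq)
    moreover have "replicate m 0 \<in> tree_vertices d" for m
      using d by (induction m) (auto simp: tree_vertices_Cons_iff tree_vertices.root)
    ultimately show "infinite (cluster d \<omega> [])"
      by (intro infinite_clusterI) (metis length_replicate order_refl)
  qed
  then have "prob {\<omega> \<in> space Q. infinite (cluster d \<omega> [])} = 1"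
    using sets_infinite_cluster by (simp add: prob_Collect_eq_1)
  then show ?thesis by (simp add: percolation_prob_def)
qed

end

section \<open>The critical intensity\<close>

text \<open>The coefficients of D: \<open>closed_prob k = (1 - q) powr \<alpha> * (1 + bcoef q
  \<alpha> k)\<close>.\<close>

definition bcoef :: "real \<Rightarrow> real \<Rightarrow> nat \<Rightarrow> real" where
  "bcoef q \<alpha> n = (1 - q ^ Suc n) powr (- \<alpha>) - 1"

section \<open>Dependence of the series on the intensity\<close>

context
  fixes q :: real
  assumes q: "0 < q" "q < 1"
begin

lemma power_Suc_unit_interval: "0 < q ^ Suc n" "q ^ Suc n \<le> q" "q ^ Suc n < 1" "q ^ Suc n \<le> q ^ n"
proof -
  show "0 < q ^ Suc n" using q by simp
  show "q ^ Suc n \<le> q" using q power_decreasing[of 1 "Suc n" q] by simp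
  then show "q ^ Suc n < 1" using q by linarith
  show "q ^ Suc n \<le> q ^ n" using q by (intro power_decreasing) auto
qed

lemma bcoef_exp: "bcoef q \<alpha> n = exp (\<alpha> * - ln (1 - q ^ Suc n)) - 1"
  using power_Suc_unit_interval[of n] by (simp add: bcoef_def powr_def del: power_Suc)

lemma bcoef_strict_mono: "\<alpha> < \<beta> \<Longrightarrow> bcoef q \<alpha> n < bcoef q \<beta> n"
  using power_Suc_unit_interval[of n] by (simp add: bcoef_exp mult_strict_right_mono_neg del: power_Suc)

lemma bcoef_0 [simp]: "bcoef q 0 n = 0"
  by (simp add: bcoef_exp)

lemma bcoef_nonneg: "0 \<le> \<alpha> \<Longrightarrow> 0 \<le> bcoef q \<alpha> n"
  using bcoef_strict_mono[of 0 \<alpha> n] by (cases "\<alpha> = 0") auto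

text \<open>This linear bound makes the series diverge at the critical killing parameter and lets it
  reach any prescribed value above it.\<close>

lemma bcoef_ge: "0 \<le> \<alpha> \<Longrightarrow> \<alpha> * q ^ Suc n \<le> bcoef q \<alpha> n"
proof -
  assume \<alpha>: "0 \<le> \<alpha>"
  have "q ^ Suc n \<le> - ln (1 - q ^ Suc n)"
    using ln_le_minus_one[of "1 - q ^ Suc n"] power_Suc_unit_interval(3)[of n] by linarith
  then have "\<alpha> * q ^ Suc n \<le> \<alpha> * - ln (1 - q ^ Suc n)" using \<alpha> by (intro mult_left_mono)
  also have "\<dots> \<le> bcoef q \<alpha> n"
    unfolding bcoef_exp using exp_ge_add_one_self[of "\<alpha> * - ln (1 - q ^ Suc n)"] by linarith
  finally show ?thesis .
qed

text \<open>The geometric decay is uniform for intensities in [0, A], as the Weierstrass test for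
  continuity requires.\<close>

lemma bcoef_le:
  assumes "0 \<le> \<alpha>" "\<alpha> \<le> A"
  shows "bcoef q \<alpha> n \<le> A / (1 - q) * exp (A / (1 - q)) * q ^ n"
proof -
  let ?L = "- ln (1 - q ^ Suc n)"
  have "- ln (1 - q ^ Suc n) = ln (1 / (1 - q ^ Suc n))"
    using power_Suc_unit_interval(3)[of n] by (simp add: ln_div del: power_Suc)
  also have "\<dots> \<le> 1 / (1 - q ^ Suc n) - 1"
    using power_Suc_unit_interval(3)[of n] by (intro ln_le_minus_one) (simp del: power_Suc)
  also have "\<dots> = q ^ Suc n / (1 - q ^ Suc n)"
    using power_Suc_unit_interval(3)[of n] by (simp add: field_simps del: power_Suc)
  also have "\<dots> \<le> q ^ n / (1 - q)"
    using power_Suc_unit_interval[of n] q by (intro frac_le) auto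
  finally have L: "?L \<le> q ^ n / (1 - q)" .
  have L0: "0 \<le> ?L" using power_Suc_unit_interval[of n] by (simp del: power_Suc)
  have qn: "q ^ n \<le> 1" using q by (simp add: power_le_one)
  have "\<alpha> * ?L \<le> A * (q ^ n / (1 - q))"
    using L L0 assms by (intro mult_mono) auto
  then have y: "\<alpha> * ?L \<le> A / (1 - q) * q ^ n" by simp
  also have "\<dots> \<le> A / (1 - q) * 1" using qn assms q by (intro mult_left_mono) auto
  finally have y1: "\<alpha> * ?L \<le> A / (1 - q)" by simp
  \<comment> \<open>The inequality \<open>exp y - 1 \<le> y * exp y\<close>, from
    \<open>1 - y \<le> exp (- y)\<close>.\<close>
  have "exp (\<alpha> * ?L) * (1 - \<alpha> * ?L) \<le> exp (\<alpha> * ?L) * exp (- (\<alpha> * ?L))"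
    using exp_ge_add_one_self[of "- (\<alpha> * ?L)"] by (intro mult_left_mono) auto
  then have "bcoef q \<alpha> n \<le> (\<alpha> * ?L) * exp (\<alpha> * ?L)"
    unfolding bcoef_exp by (simp add: mult_exp_exp algebra_simps)
  also have "\<dots> \<le> (A / (1 - q) * q ^ n) * exp (A / (1 - q))"
    using y y1 L0 assms q by (intro mult_mono[OF y]) auto
  finally show ?thesis by (simp add: mult_ac)
qed

lemma summable_bcoef:
  assumes "0 \<le> \<alpha>" "0 \<le> s" "q * s < 1"
  shows "summable (\<lambda>n. bcoef q \<alpha> n * s ^ n)"
proof (rule summable_comparison_test)
  define C where "C = \<alpha> / (1 - q) * exp (\<alpha> / (1 - q))"
  show "summable (\<lambda>n. C * (q * s) ^ n)"
    using assms q by (intro summable_mult summable_geometric) (simp add: abs_mult)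
  show "\<exists>N. \<forall>n\<ge>N. norm (bcoef q \<alpha> n * s ^ n) \<le> C * (q * s) ^ n"
  proof (intro exI allI impI)
    fix n
    have "bcoef q \<alpha> n * s ^ n \<le> C * q ^ n * s ^ n"
      unfolding C_def using assms by (intro mult_right_mono bcoef_le) auto
    then show "norm (bcoef q \<alpha> n * s ^ n) \<le> C * (q * s) ^ n"
      using assms bcoef_nonneg[of \<alpha> n] by (simp add: power_mult_distrib abs_mult mult.assoc)
  qed
qed

lemma bcoef_series:
  assumes s: "0 < s" "q * s < 1"
  defines "D \<equiv> \<lambda>\<alpha>. \<Sum>n. bcoef q \<alpha> n * s ^ n"
  shows bcoef_series_strict_mono: "0 \<le> \<alpha> \<Longrightarrow> \<alpha> < \<beta> \<Longrightarrow> D \<alpha> < D \<beta>"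
    and bcoef_series_solution: "0 < T \<Longrightarrow> \<exists>\<alpha>>0. D \<alpha> = T"
proof -
  show mono: "D \<alpha> < D \<beta>" if "0 \<le> \<alpha>" "\<alpha> < \<beta>" for \<alpha> \<beta>
  proof -
    have sm: "summable (\<lambda>n. bcoef q \<beta> n * s ^ n - bcoef q \<alpha> n * s ^ n)"
      using that s by (intro summable_diff summable_bcoef) auto
    have "0 < (\<Sum>n. bcoef q \<beta> n * s ^ n - bcoef q \<alpha> n * s ^ n)"
      using bcoef_strict_mono[OF that(2)] s by (intro suminf_pos sm) (simp flip: left_diff_distrib)
    also have "\<dots> = D \<beta> - D \<alpha>"
      unfolding D_def using that s by (intro suminf_diff[symmetric] summable_bcoef) auto
    finally show ?thesis by simp
  qed
  show "\<exists>\<alpha>>0. D \<alpha> = T" if T: "0 < T"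
  proof -
    \<comment> \<open>By \<open>bcoef_ge\<close> the term \<open>n = 0\<close> at intensity
      \<open>A\<close> is at least \<open>A * q = T\<close>, so the intermediate value theorem
      applies on [0, A].\<close>
    define A where "A = T / q"
    have A: "0 < A" using T q by (simp add: A_def)
    have "uniform_limit {0..A} (\<lambda>n \<alpha>. \<Sum>i<n. bcoef q \<alpha> i * s ^ i) D sequentially"
      unfolding D_def
    proof (rule Weierstrass_m_test)
      define C where "C = A / (1 - q) * exp (A / (1 - q))"
      show "summable (\<lambda>n. C * (q * s) ^ n)"
        using s q by (intro summable_mult summable_geometric) (simp add: abs_mult)
      fix n \<alpha> assume \<alpha>: "\<alpha> \<in> {0..A}"
      then have "bcoef q \<alpha> n * s ^ n \<le> C * q ^ n * s ^ n"
        unfolding C_def using s by (intro mult_right_mono bcoef_le) auto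
      then show "norm (bcoef q \<alpha> n * s ^ n) \<le> C * (q * s) ^ n"
        using s \<alpha> bcoef_nonneg[of \<alpha> n] by (simp add: power_mult_distrib abs_mult mult.assoc)
    qed
    moreover have "continuous_on {0..A} (\<lambda>\<alpha>. \<Sum>i<n. bcoef q \<alpha> i * s ^ i)" for n
      unfolding bcoef_exp by (intro continuous_intros)
    ultimately have cont: "continuous_on {0..A} D"
      by (intro uniform_limit_theorem[where F = sequentially]) auto
    have "T = A * q ^ Suc 0 * s ^ 0" using q by (simp add: A_def)
    also have "\<dots> \<le> bcoef q A 0 * s ^ 0" using bcoef_ge[of A 0] A by simp
    also have "\<dots> = (\<Sum>n\<in>{0}. bcoef q A n * s ^ n)" by simp
    also have "\<dots> \<le> D A"
      unfolding D_def using A s bcoef_nonneg by (intro sum_le_suminf summable_bcoef) auto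
    finally have "T \<le> D A" .
    moreover have "D 0 = 0" by (simp add: D_def)
    ultimately obtain \<alpha> where "0 \<le> \<alpha>" "D \<alpha> = T"
      using IVT'[of D 0 T A] cont A T by auto
    moreover have "\<alpha> \<noteq> 0" using \<open>D 0 = 0\<close> \<open>D \<alpha> = T\<close> T by auto
    ultimately show ?thesis by (intro exI[of _ \<alpha>]) auto
  qed
qed

end

section \<open>Comparison of the series with the threshold\<close>

context tree_soup
begin

sublocale renewal conn_prob "bcoef q \<alpha>" "(1 - q) powr \<alpha>"
proof
  show "0 \<le> conn_prob n" for n by (simp add: conn_prob_def)
  show "0 \<le> bcoef q \<alpha> n" for n using q_pos q_less_1 \<alpha>_nonneg by (rule bcoef_nonneg)
  show "0 < (1 - q) powr \<alpha>" using q_less_1 by simp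
  show "(\<Sum>k\<le>n. (1 - q) powr \<alpha> * (1 + bcoef q \<alpha> k) * conn_prob (n - k)) = 1" for n
    using conn_prob_renewal[of n] by (simp add: closed_prob_def bcoef_def)
qed

lemma no_percolation_below:
  assumes "(real d - 1) * q < 1" "(real d - 2) * (\<Sum>n. bcoef q \<alpha> n * (real d - 1) ^ n) < 1"
  shows "percolation_prob d \<alpha> \<kappa> = 0"
proof (rule not_percolates, rule subcritical_delayed)
  show "summable (\<lambda>n. bcoef q \<alpha> n * (real d - 1) ^ n)"
    using assms q_pos q_less_1 \<alpha>_nonneg d3 by (intro summable_bcoef) (auto simp: mult.commute)
  show "(real d - 1 - 1) * (\<Sum>n. bcoef q \<alpha> n * (real d - 1) ^ n) < 1"
    using assms(2) by (simp add: algebra_simps)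
qed (use d3 in simp)

text \<open>A partial sum in the hypothesis makes the criterion applicable at
  \<open>kappa_c\<close>, where the full series diverges.\<close>

lemma percolation_above:
  assumes "1 < (real d - 2) * (\<Sum>k<N. bcoef q \<alpha> k * (real d - 1) ^ k)"
  shows "0 < percolation_prob d \<alpha> \<kappa>"
proof -
  have \<alpha>: "0 < \<alpha>"
  proof (rule ccontr)
    assume "\<not> 0 < \<alpha>"
    then have "\<alpha> = 0" using \<alpha>_nonneg by simp
    then show False using assms q_pos q_less_1 by simp
  qed
  have "\<exists>n. 1 < conn_prob n * (real d - 1) ^ n"
  proof (rule supercritical)
    show "1 < real d - 1" using d3 by simp
    show "1 < (real d - 1 - 1) * (\<Sum>k<N. bcoef q \<alpha> k * (real d - 1) ^ k)"
      using assms by (simp add: algebra_simps)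
    fix t assume t: "0 \<le> t" "t < real d - 1"
    have "q * t < q * (real d - 1)" using t q_pos by (intro mult_strict_left_mono) auto
    also have "\<dots> \<le> 1" using q_le by (simp add: mult.commute)
    finally show "summable (\<lambda>n. bcoef q \<alpha> n * t ^ n)"
      using t q_pos q_less_1 \<alpha>_nonneg by (intro summable_bcoef) auto
  qed
  then obtain n where "1 < conn_prob n * (real d - 1) ^ n" ..
  then show ?thesis using \<alpha> real_d by (intro percolates[of n]) (auto simp: mult.commute)
qed

end

section \<open>From percolation probabilities to the critical intensity\<close>

lemma alpha_c_le:
  assumes "0 \<le> a" "\<And>\<alpha>. a < \<alpha> \<Longrightarrow> 0 < percolation_prob d \<alpha> \<kappa>"
  shows "alpha_c d \<kappa> \<le> ereal a"
proof (rule ccontr)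
  assume "\<not> alpha_c d \<kappa> \<le> ereal a"
  then obtain z where z: "ereal a < ereal z" "ereal z < alpha_c d \<kappa>"
    using ereal_dense2[of "ereal a" "alpha_c d \<kappa>"] by (auto simp: not_le)
  then have "alpha_c d \<kappa> \<le> ereal z"
    unfolding alpha_c_def using assms by (intro Inf_lower) auto
  then show False using z by simp
qed

text \<open>Position relative to \<open>kappa_c\<close> is the sign of the discriminant under the
  root in \<open>tau\<close>.\<close>

lemma kappa_c_less_iff:
  assumes "3 \<le> d" "-1 < \<kappa>"
  shows "kappa_c d < \<kappa> \<longleftrightarrow> 4 * (real d - 1) < (real d * (1 + \<kappa>))\<^sup>2"
    and "kappa_c d = \<kappa> \<longleftrightarrow> 4 * (real d - 1) = (real d * (1 + \<kappa>))\<^sup>2"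
proof -
  have X: "0 < real d * (1 + \<kappa>)" using assms by simp
  have sq: "(2 * sqrt (real d - 1))\<^sup>2 = 4 * (real d - 1)" using assms by (simp add: power_mult_distrib)
  have s0: "0 \<le> 2 * sqrt (real d - 1)" using assms by simp
  have "kappa_c d < \<kappa> \<longleftrightarrow> 2 * sqrt (real d - 1) < real d * (1 + \<kappa>)"
    using assms by (simp add: kappa_c_def field_simps)
  also have "\<dots> \<longleftrightarrow> (2 * sqrt (real d - 1))\<^sup>2 < (real d * (1 + \<kappa>))\<^sup>2"
    using s0 X power_strict_mono[of "2 * sqrt (real d - 1)" "real d * (1 + \<kappa>)" 2]
      power2_less_imp_less[of "2 * sqrt (real d - 1)" "real d * (1 + \<kappa>)"] by auto
  finally show "kappa_c d < \<kappa> \<longleftrightarrow> 4 * (real d - 1) < (real d * (1 + \<kappa>))\<^sup>2" unfolding sq .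
  have "kappa_c d = \<kappa> \<longleftrightarrow> 2 * sqrt (real d - 1) = real d * (1 + \<kappa>)"
    using assms by (simp add: kappa_c_def field_simps)
  also have "\<dots> \<longleftrightarrow> (2 * sqrt (real d - 1))\<^sup>2 = (real d * (1 + \<kappa>))\<^sup>2"
    using X s0 by (intro power_eq_iff_eq_base[symmetric]) auto
  finally show "kappa_c d = \<kappa> \<longleftrightarrow> 4 * (real d - 1) = (real d * (1 + \<kappa>))\<^sup>2" unfolding sq .
qed

text \<open>With X = d (1 + kappa) = 1 / omega, \<open>tau\<close> is the smaller root of (d - 1)
  t^2 - X t + 1 = 0, so X tau is the smaller root of the equation for gamma. At
  \<open>kappa_c\<close> the two roots coincide.\<close>

lemma tau_tree_soup:
  assumes d: "3 \<le> d" and \<kappa>: "-1 < \<kappa>" "kappa_c d \<le> \<kappa>" and \<alpha>: "0 \<le> \<alpha>"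
  defines "\<omega> \<equiv> 1 / ((1 + \<kappa>) * real d)"
  shows "tree_soup d \<alpha> \<kappa> \<omega> (tau d \<kappa> / \<omega>)"
    and "walk_weight.q \<omega> (tau d \<kappa> / \<omega>) = (tau d \<kappa>)\<^sup>2"
    and "kappa_c d < \<kappa> \<Longrightarrow> (real d - 1) * (tau d \<kappa>)\<^sup>2 < 1"
    and "kappa_c d = \<kappa> \<Longrightarrow> (real d - 1) * (tau d \<kappa>)\<^sup>2 = 1"
proof -
  define X where "X = real d * (1 + \<kappa>)"
  define r where "r = sqrt (X\<^sup>2 - 4 * (real d - 1))"
  define t where "t = tau d \<kappa>"
  have X: "0 < X" using d \<kappa> by (simp add: X_def)
  have disc: "0 \<le> X\<^sup>2 - 4 * (real d - 1)"
    using kappa_c_less_iff[OF d \<kappa>(1)] \<kappa>(2) by (auto simp: X_def le_less)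
  then have r: "0 \<le> r" "r\<^sup>2 = X\<^sup>2 - 4 * (real d - 1)" by (auto simp: r_def)
  have "r\<^sup>2 < X\<^sup>2" using r d by simp
  then have rX: "r < X" using X by (simp add: power_less_imp_less_base)
  have t_eq: "2 * (real d - 1) * t = X - r"
    using d by (simp add: t_def tau_def r_def X_def power_mult_distrib)
  have b: "0 < real d - 1" using d by simp
  have t: "0 < t"
  proof -
    have "0 < 2 * (real d - 1) * t" using t_eq rX by simp
    then show ?thesis using b by (simp add: zero_less_mult_iff)
  qed
  have "4 * B * (B * t\<^sup>2) = (2 * B * t)\<^sup>2" for B :: real
    by (simp add: power2_eq_square)
  then have "4 * (real d - 1) * ((real d - 1) * t\<^sup>2) = (2 * (real d - 1) * t)\<^sup>2" .
  also have "\<dots> = X\<^sup>2 - 2 * X * r + r\<^sup>2" unfolding t_eq by (simp add: power2_eq_square algebra_simps)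
  also have "\<dots> = 2 * X * (X - r) - 4 * (real d - 1)" using r by (simp add: power2_eq_square algebra_simps)
  also have "\<dots> = 4 * (real d - 1) * (X * t - 1)" unfolding t_eq[symmetric] by (simp add: algebra_simps)
  finally have quad: "(real d - 1) * t\<^sup>2 = X * t - 1" using b by simp
  have \<omega>: "\<omega> = 1 / X" "0 < \<omega>" using X by (simp_all add: \<omega>_def X_def mult.commute)
  have g: "t / \<omega> = X * t" "\<omega> * (t / \<omega>) = t" using \<omega> X by auto
  show "tree_soup d \<alpha> \<kappa> \<omega> (tau d \<kappa> / \<omega>)"
    unfolding t_def[symmetric]
  proof
    have "\<omega>\<^sup>2 * (t / \<omega>)\<^sup>2 = t\<^sup>2" using \<omega>(2) by (simp add: power_divide)
    then show "t / \<omega> = 1 + (real d - 1) * \<omega>\<^sup>2 * (t / \<omega>)\<^sup>2"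
      using quad unfolding g(1) by (simp add: mult.assoc)
    have "2 * (real d - 1) * \<omega>\<^sup>2 * (t / \<omega>) = \<omega> * (2 * (real d - 1) * t)"
      using \<omega>(2) by (simp add: power2_eq_square)
    also have "\<dots> \<le> \<omega> * X" unfolding t_eq using r \<omega> by (intro mult_left_mono) auto
    finally show "2 * (real d - 1) * \<omega>\<^sup>2 * (t / \<omega>) \<le> 1" using \<omega> X by simp
  qed (use d \<kappa> \<alpha> \<omega> t in \<open>auto simp: \<omega>_def\<close>)
  then interpret tree_soup d \<alpha> \<kappa> \<omega> "tau d \<kappa> / \<omega>" .
  show "q = (tau d \<kappa>)\<^sup>2" unfolding q_def using g(2) by (simp only: t_def)
  show "(real d - 1) * (tau d \<kappa>)\<^sup>2 < 1" if "kappa_c d < \<kappa>"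
  proof -
    have "0 < r" using that kappa_c_less_iff[OF d \<kappa>(1)] by (simp add: r_def X_def)
    \<comment> \<open>It follows that
      \<open>X * (X - r) < X\<^sup>2 - r\<^sup>2 = 4 * (d - 1)\<close>, that is
      \<open>X * t < 2\<close>.\<close>
    then have "r * r < X * r" using rX by simp
    then have "X * (X - r) < 4 * (real d - 1)" using r by (simp add: power2_eq_square algebra_simps)
    then have "2 * (real d - 1) * (X * t) < 2 * (real d - 1) * 2" unfolding t_eq[symmetric] by (simp add: algebra_simps)
    moreover have "0 < 2 * (real d - 1)" using b by simp
    ultimately have "X * t < 2" by (simp only: mult_less_cancel_left_pos)
    then show ?thesis using quad by (simp add: t_def)
  qed
  show "(real d - 1) * (tau d \<kappa>)\<^sup>2 = 1" if "kappa_c d = \<kappa>"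
  proof -
    have "X\<^sup>2 = 4 * (real d - 1)" using that kappa_c_less_iff[OF d \<kappa>(1)] by (simp add: X_def)
    then have "r = 0" by (simp add: r_def)
    then have "2 * (real d - 1) * (X * t) = 2 * (real d - 1) * 2"
      using t_eq \<open>X\<^sup>2 = 4 * (real d - 1)\<close> by (simp add: power2_eq_square algebra_simps)
    moreover have "2 * (real d - 1) \<noteq> 0" using b by simp
    ultimately have "X * t = 2" by (metis mult_left_cancel)
    then show ?thesis using quad by (simp add: t_def)
  qed
qed

text \<open>At \<open>kappa_c\<close>, (d - 1) q = 1 and \<open>bcoef_ge\<close> bound every term of
  the series below by alpha / (d - 1), so some partial sum is large enough. Below
  \<open>kappa_c\<close> the crossing masses are infinite.\<close>

lemma alpha_c_nonpos:
  assumes d: "3 \<le> d" and \<kappa>: "-1 < \<kappa>" "\<kappa> \<le> kappa_c d"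
  shows "alpha_c d \<kappa> \<le> 0"
  unfolding zero_ereal_def
proof (rule alpha_c_le)
  fix \<alpha> :: real assume \<alpha>: "0 < \<alpha>"
  show "0 < percolation_prob d \<alpha> \<kappa>"
  proof (cases "\<kappa> = kappa_c d")
    case True
    let ?\<omega> = "1 / ((1 + \<kappa>) * real d)" and ?b = "real d - 1"
    note facts = tau_tree_soup[OF d \<kappa>(1) eq_refl[OF True[symmetric]] less_imp_le[OF \<alpha>]]
    interpret tree_soup d \<alpha> \<kappa> ?\<omega> "tau d \<kappa> / ?\<omega>" by (rule facts(1))
    have bq: "?b * q = 1" unfolding facts(2) by (rule facts(4)[OF True[symmetric]])
    have b: "0 < ?b" "1 \<le> real d - 2" using d by auto
    \<comment> \<open>\<open>N\<close> terms of size at least \<open>\<alpha> / ?b\<close> sum to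
      more than 1, and the factor \<open>d - 2\<close> is at least 1.\<close>
    obtain N :: nat where "?b / \<alpha> < real N" using reals_Archimedean2 by blast
    then have N: "1 < real N * (\<alpha> / ?b)" using \<alpha> b by (simp add: field_simps)
    also have "\<dots> = (\<Sum>k<N. \<alpha> / ?b)" by simp
    also have "\<dots> \<le> (\<Sum>k<N. bcoef q \<alpha> k * ?b ^ k)"
    proof (rule sum_mono)
      fix k
      have "\<alpha> / ?b = \<alpha> * q * (q * ?b) ^ k" using bq b by (simp add: field_simps)
      also have "\<dots> = \<alpha> * q ^ Suc k * ?b ^ k" by (simp add: power_mult_distrib)
      also have "\<dots> \<le> bcoef q \<alpha> k * ?b ^ k"
        using bcoef_ge[OF q_pos q_less_1, of \<alpha> k] \<alpha> b by (intro mult_right_mono) auto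
      finally show "\<alpha> / ?b \<le> bcoef q \<alpha> k * ?b ^ k" .
    qed
    finally have S: "1 < (\<Sum>k<N. bcoef q \<alpha> k * ?b ^ k)" .
    have "1 * (\<Sum>k<N. bcoef q \<alpha> k * ?b ^ k) \<le> (real d - 2) * (\<Sum>k<N. bcoef q \<alpha> k * ?b ^ k)"
      using S b by (intro mult_right_mono) auto
    then show ?thesis using S by (intro percolation_above[of N]) linarith
  next
    case False
    then have "\<not> 4 * (real d - 1) \<le> (real d * (1 + \<kappa>))\<^sup>2"
      using kappa_c_less_iff[OF d \<kappa>(1)] \<kappa>(2) by auto
    then have low: "1 < 4 * real (d - 1) * (1 / ((1 + \<kappa>) * real d))\<^sup>2"
      using d \<kappa>(1) by (simp add: power_divide mult.commute of_nat_diff)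
    interpret soup d \<alpha> \<kappa> by standard (use \<alpha> \<kappa> in auto)
    show ?thesis by (rule percolates_low[OF d low \<alpha>])
  qed
qed simp

text \<open>Strict monotonicity of the series makes its solution \<open>a\<close> unique, and the
  strict inequalities on either side of \<open>a\<close> determine the infimum.\<close>

lemma alpha_c_characterization:
  assumes d: "3 \<le> d" and \<kappa>: "kappa_c d < \<kappa>"
  shows "\<exists>\<alpha>>0. alpha_c d \<kappa> = ereal \<alpha> \<and>
       (\<forall>\<beta>>0. (\<lambda>n. bcoef ((tau d \<kappa>)\<^sup>2) \<beta> n * (real d - 1) ^ n) sums (1 / (real d - 2)) \<longleftrightarrow> \<beta> = \<alpha>)"
proof -
  have \<kappa>1: "-1 < \<kappa>"
  proof -
    have "0 \<le> 2 * sqrt (real d - 1) / real d" using d by simp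
    then show ?thesis using \<kappa> by (simp add: kappa_c_def)
  qed
  let ?\<omega> = "1 / ((1 + \<kappa>) * real d)" and ?b = "real d - 1"
  define q where "q = (tau d \<kappa>)\<^sup>2"
  define D where "D \<beta> = (\<Sum>n. bcoef q \<beta> n * ?b ^ n)" for \<beta>
  have ts: "tree_soup d \<beta> \<kappa> ?\<omega> (tau d \<kappa> / ?\<omega>)" "walk_weight.q ?\<omega> (tau d \<kappa> / ?\<omega>) = q" if "0 \<le> \<beta>" for \<beta>
    using tau_tree_soup(1,2)[OF d \<kappa>1 less_imp_le[OF \<kappa>] that] by (simp_all only: q_def)
  have bq: "?b * q < 1"
    using tau_tree_soup(3)[OF d \<kappa>1 less_imp_le[OF \<kappa>] order.refl \<kappa>] by (simp only: q_def)
  \<comment> \<open>\<open>q\<close> does not depend on the intensity, so its bounds are taken from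
    intensity 0.\<close>
  interpret z: tree_soup d 0 \<kappa> ?\<omega> "tau d \<kappa> / ?\<omega>" by (rule ts(1)) simp
  have q: "0 < q" "q < 1" using z.q_pos z.q_less_1 unfolding ts(2)[OF order_refl] by blast+
  have b: "0 < ?b" "q * ?b < 1" using d bq by (simp_all add: mult.commute)
  have d2: "0 < real d - 2" using d by simp
  note mono = bcoef_series_strict_mono[OF q b, folded D_def]
  obtain a where a: "0 < a" "D a = 1 / (real d - 2)"
    using bcoef_series_solution[OF q b, of "1 / (real d - 2)"] d2 by (auto simp: D_def)
  have sums: "(\<lambda>n. bcoef q \<beta> n * ?b ^ n) sums D \<beta>" if "0 \<le> \<beta>" for \<beta>
    unfolding D_def using that b by (intro summable_sums summable_bcoef q) auto
  have below: "percolation_prob d \<beta> \<kappa> = 0" if "0 \<le> \<beta>" "\<beta> < a" for \<beta>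
  proof -
    interpret tree_soup d \<beta> \<kappa> ?\<omega> "tau d \<kappa> / ?\<omega>" by (rule ts(1)[OF that(1)])
    have "D \<beta> < 1 / (real d - 2)" using mono[OF that] a by simp
    then have "(real d - 2) * D \<beta> < 1" using d2 by (simp add: field_simps)
    then show ?thesis
      using bq unfolding D_def ts(2)[OF that(1), symmetric] by (intro no_percolation_below)
  qed
  have above: "0 < percolation_prob d \<beta> \<kappa>" if "a < \<beta>" for \<beta>
  proof -
    have \<beta>: "0 \<le> \<beta>" using that a by simp
    interpret tree_soup d \<beta> \<kappa> ?\<omega> "tau d \<kappa> / ?\<omega>" by (rule ts(1)[OF \<beta>])
    have "1 / (real d - 2) < D \<beta>" using mono[of a \<beta>] that a by simp
    moreover have "(\<lambda>N. \<Sum>k<N. bcoef q \<beta> k * ?b ^ k) \<longlonglongrightarrow> D \<beta>"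
      using sums[OF \<beta>] by (simp add: sums_def)
    ultimately have "eventually (\<lambda>N. 1 / (real d - 2) < (\<Sum>k<N. bcoef q \<beta> k * ?b ^ k)) sequentially"
      by (simp add: order_tendstoD(1))
    then obtain N where "1 / (real d - 2) < (\<Sum>k<N. bcoef q \<beta> k * ?b ^ k)"
      by (auto simp: eventually_sequentially)
    then have "1 < (real d - 2) * (\<Sum>k<N. bcoef q \<beta> k * ?b ^ k)" using d2 by (simp add: field_simps)
    then show ?thesis
      unfolding ts(2)[OF \<beta>, symmetric] by (rule percolation_above)
  qed
  have "alpha_c d \<kappa> = ereal a"
  proof (rule antisym)
    show "alpha_c d \<kappa> \<le> ereal a" using a above by (intro alpha_c_le) auto
    show "ereal a \<le> alpha_c d \<kappa>"
      unfolding alpha_c_def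
    proof (rule Inf_greatest, safe)
      fix \<beta> assume "0 \<le> \<beta>" "0 < percolation_prob d \<beta> \<kappa>"
      then show "ereal a \<le> ereal \<beta>" using below[of \<beta>] by (cases "\<beta> < a") auto
    qed
  qed
  moreover have "(\<lambda>n. bcoef q \<beta> n * ?b ^ n) sums (1 / (real d - 2)) \<longleftrightarrow> \<beta> = a" if "0 < \<beta>" for \<beta>
  proof -
    have "(\<lambda>n. bcoef q \<beta> n * ?b ^ n) sums (1 / (real d - 2)) \<longleftrightarrow> D \<beta> = D a"
      using sums[of \<beta>] that a sums_unique2 by (metis less_imp_le)
    also have "\<dots> \<longleftrightarrow> \<beta> = a"
      using mono[of a \<beta>] mono[of \<beta> a] that a(1) by (cases \<beta> a rule: linorder_cases) auto
    finally show ?thesis .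
  qed
  ultimately show ?thesis using a(1) unfolding q_def by blast
qed

theorem theorem1p1:
  fixes d :: nat
  assumes "3 \<le> d"
  shows "(\<forall>\<kappa>>-1. 0 < alpha_c d \<kappa> \<longleftrightarrow> kappa_c d < \<kappa>) \<and>
    (\<forall>\<kappa>>kappa_c d. \<exists>\<alpha>>0. alpha_c d \<kappa> = ereal \<alpha> \<and>
       (\<forall>\<beta>>0. (\<lambda>n. ((1 - tau d \<kappa> ^ (2 * (n + 1))) powr (- \<beta>) - 1) * (real d - 1) ^ n)
                  sums (1 / (real d - 2)) \<longleftrightarrow> \<beta> = \<alpha>))"
proof (intro conjI allI impI)
  fix \<kappa> assume \<kappa>: "kappa_c d < \<kappa>"
  have "bcoef ((tau d \<kappa>)\<^sup>2) \<beta> n = (1 - tau d \<kappa> ^ (2 * (n + 1))) powr (- \<beta>) - 1" for \<beta> n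
    unfolding bcoef_def power_mult[symmetric] by simp
  then show "\<exists>\<alpha>>0. alpha_c d \<kappa> = ereal \<alpha> \<and>
       (\<forall>\<beta>>0. (\<lambda>n. ((1 - tau d \<kappa> ^ (2 * (n + 1))) powr (- \<beta>) - 1) * (real d - 1) ^ n)
                  sums (1 / (real d - 2)) \<longleftrightarrow> \<beta> = \<alpha>)"
    using alpha_c_characterization[OF assms \<kappa>] by (simp only:)
next
  fix \<kappa> :: real assume \<kappa>: "\<kappa> > - 1"
  show "0 < alpha_c d \<kappa> \<longleftrightarrow> kappa_c d < \<kappa>"
  proof
    assume "0 < alpha_c d \<kappa>"
    then show "kappa_c d < \<kappa>"
      using alpha_c_nonpos[OF assms \<kappa>] by (cases "\<kappa> \<le> kappa_c d") auto
  next
    assume "kappa_c d < \<kappa>"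
    then show "0 < alpha_c d \<kappa>" using alpha_c_characterization[OF assms] by fastforce
  qed
qed

end
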